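(* Let $V\colon\mathbb{R}\to[0,\infty)$ be lower semicontinuous. Fix $t\in(0,\infty)$. There exists an $\alpha\in\mathbb{R}$ for which the function $$r\mapsto V(r)+\frac{r^2}{2}+\frac{(r-\alpha)^2}{2t}-\inf_{s\in\mathbb{R}}\Big[V(s)+\frac{s^2}{2}+\frac{(s-\alpha)^2}{2t}\Big],\qquad r\in\mathbb{R},$$ has multiple global minimisers if and only if $\Phi_2V\not>-\frac{1+t}{2t}$, i.e., if and only if there exist $a,b,c\in\mathbb{R}$ with $a<b<c$ for which $\Phi_2V(a,b,c)\le-\frac{1+t}{2t}$. Consequently, there exists a crossover time $t_c\in[0,\infty]$ such that $(\mu_{n,t})_{n\in\mathbb{N}}$ is sequentially Gibbs for $t\in(0,t_c)$ and not sequentially Gibbs for $t\in(t_c,\infty)$.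
   Context: The second difference quotient of $f\colon\mathbb{R}\to\mathbb{R}$ is, for $x<y<z$, $\Phi_2f(x,y,z)=\frac1{z-x}\Big(\frac{f(z)-f(y)}{z-y}-\frac{f(y)-f(x)}{y-x}\Big)$. $\mathcal{B}(\cdot)$ denotes the Borel $\sigma$-algebra. $\mu_{\mathcal{N}(v,A)}$ is the normal distribution with mean $v$ and (co)variance $A$; $I_n$ is the $n\times n$ identity matrix. The empirical magnetisation is $m_n(x_1,\dots,x_n)=\frac1n\sum_{i=1}^n x_i$. Time-evolved measures: for the potential $V\colon\mathbb{R}\to[0,\infty)$ and $t>0$, $$\mu_{n,t}(A)=\frac1{Z_n}\int_{\mathbb{R}^n}\mu_{\mathcal{N}(z,tI_n)}(A)\,e^{-nV(m_n(z))}\,d\mu_{\mathcal{N}(0,I_n)}(z)\qquad(A\in\mathcal{B}(\mathbb{R}^n)),$$ with $Z_n$ the normalising constant (the law at time $t$ of $n$ independent Brownian motions started from the mean-field Gibbs measure with density $\frac1{Z_n}e^{-nV\circ m_n}$ with respect to $\mu_{\mathcal{N}(0,I_n)}$). For a probability measure $\rho_n$ on $\mathcal{B}(\mathbb{R}^n)$, $n\ge2$, let $\pi_{(2:n)}(y_1,\dots,y_n)=(y_2,\dots,y_n)$. A regular conditional probability under $\rho_n$ of the first spin given the other spins is a transition kernel $\gamma_n\colon\mathbb{R}^{n-1}\times\mathcal{B}(\mathbb{R})\to[0,1]$ with $\rho_n(A\times B)=\int \mathbf{1}_B(y)\,\gamma_n(y,A)\,d[\rho_n\circ\pi_{(2:n)}^{-1}](y)$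 for all $A\in\mathcal{B}(\mathbb{R})$, $B\in\mathcal{B}(\mathbb{R}^{n-1})$. It is proper if $\gamma_n(y,\cdot)=0$ for all $y$ outside the support of $\rho_n\circ\pi_{(2:n)}^{-1}$, and weakly continuous if $y\mapsto\gamma_n(y,\cdot)$ is continuous for the weak topology; a weakly continuous proper one is unique if it exists (and it exists for $\rho_n=\mu_{n,t}$). Let $(\rho_n)_{n\in\mathbb{N}}$ be probability measures on $\mathcal{B}(\mathbb{R}^n)$ such that for every $n\ge 2$ a weakly continuous proper regular conditional probability $\gamma_n$ of the first spin given the other spins exists. Then $\alpha\in\mathbb{R}$ is a good magnetisation for $(\rho_n)$ if there is a probability measure $\gamma_\alpha$ on $\mathcal{B}(\mathbb{R})$ such that $\gamma_n(v_{n-1},\cdot)\to\gamma_\alpha$ weakly for all sequences $(v_{n-1})_{n\ge2}$ with $v_{n-1}\in\mathbb{R}^{n-1}$ and $m_{n-1}(v_{n-1})\to\alpha$. The sequence $(\rho_n)$ is sequentially Gibbs if all $\alpha\in\mathbb{R}$ are good magnetisations. *)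

theory Defs
  imports "HOL-Probability.Probability"
begin

definition lower_semicontinuous :: "(real \<Rightarrow> real) \<Rightarrow> bool" where
  "lower_semicontinuous f \<longleftrightarrow> (\<forall>x. \<forall>c < f x. \<forall>\<^sub>F y in nhds x. c < f y)"

definition second_diff_quot :: "(real \<Rightarrow> real) \<Rightarrow> real \<Rightarrow> real \<Rightarrow> real \<Rightarrow> real" where
  "second_diff_quot f x y z = ((f z - f y) / (z - y) - (f y - f x) / (y - x)) / (z - x)"

definition rate_function :: "(real \<Rightarrow> real) \<Rightarrow> real \<Rightarrow> real \<Rightarrow> real \<Rightarrow> real" where
  "rate_function V t \<alpha> r =
     V r + r\<^sup>2 / 2 + (r - \<alpha>)\<^sup>2 / (2 * t) - (INF s. V s + s\<^sup>2 / 2 + (s - \<alpha>)\<^sup>2 / (2 * t))"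

definition has_multiple_global_minimisers :: "(real \<Rightarrow> real) \<Rightarrow> bool" where
  "has_multiple_global_minimisers f \<longleftrightarrow>
     (\<exists>r s. r \<noteq> s \<and> is_arg_min f (\<lambda>_. True) r \<and> is_arg_min f (\<lambda>_. True) s)"

text \<open>
  Points of $\mathbb{R}^n$ are functions on \<open>{1..n}\<close>, extended by \<open>undefined\<close> outside.
  The Borel sets of $\mathbb{R}^n$ are the sets of the product sigma-algebra, as the real
  line is second countable.
\<close>

abbreviation borel_Rn :: "nat \<Rightarrow> (nat \<Rightarrow> real) measure" where
  "borel_Rn n \<equiv> (\<Pi>\<^sub>M i\<in>{1..n}. borel)"

abbreviation top_Rn :: "nat \<Rightarrow> (nat \<Rightarrow> real) topology" where
  "top_Rn n \<equiv> product_topology (\<lambda>_. euclideanreal) {1..n}"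

definition magnetisation :: "nat \<Rightarrow> (nat \<Rightarrow> real) \<Rightarrow> real" where
  "magnetisation n x = (\<Sum>i=1..n. x i) / real n"

text \<open>
  The normal distribution on $\mathbb{R}^n$ with mean \<open>v\<close> and covariance matrix $t I_n$: the
  components are independent with variance \<open>t\<close>. The second parameter of
  \<^const>\<open>normal_density\<close> is the standard deviation.
\<close>

definition normal_Rn :: "nat \<Rightarrow> (nat \<Rightarrow> real) \<Rightarrow> real \<Rightarrow> (nat \<Rightarrow> real) measure" where
  "normal_Rn n v t = (\<Pi>\<^sub>M i\<in>{1..n}. density lborel (normal_density (v i) (sqrt t)))"

definition norm_const :: "(real \<Rightarrow> real) \<Rightarrow> nat \<Rightarrow> ennreal" where
  "norm_const V n =
     (\<integral>\<^sup>+ z. ennreal (exp (- real n * V (magnetisation n z))) \<partial>normal_Rn n (\<lambda>_. 0) 1)"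

definition time_evolved :: "(real \<Rightarrow> real) \<Rightarrow> real \<Rightarrow> nat \<Rightarrow> (nat \<Rightarrow> real) measure" where
  "time_evolved V t n = measure_of (space (borel_Rn n)) (sets (borel_Rn n))
     (\<lambda>A. (\<integral>\<^sup>+ z. emeasure (normal_Rn n z t) A * ennreal (exp (- real n * V (magnetisation n z)))
             \<partial>normal_Rn n (\<lambda>_. 0) 1) / norm_const V n)"

text \<open>
  \<^const>\<open>measure_of\<close> returns the zero measure if the given set function is not countably
  additive; the following facts rule this out for \<^const>\<open>time_evolved\<close>.
\<close>

lemma lower_semicontinuous_borel_measurable:
  assumes "lower_semicontinuous f"
  shows "f \<in> borel_measurable borel"
proof (rule borel_measurableI_greater)
  fix c :: real
  have "open {x. c < f x}"
  proof (rule topological_space_class.openI)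
    fix x assume "x \<in> {x. c < f x}"
    then have "\<forall>\<^sub>F y in nhds x. c < f y"
      using assms by (simp add: lower_semicontinuous_def)
    then show "\<exists>T. open T \<and> x \<in> T \<and> T \<subseteq> {x. c < f x}"
      unfolding eventually_nhds by (metis mem_Collect_eq subsetI)
  qed
  then show "{x \<in> space borel. c < f x} \<in> sets borel" by simp
qed

lemma sets_normal_Rn [simp, measurable_cong]: "sets (normal_Rn n v t) = sets (borel_Rn n)"
  unfolding normal_Rn_def by (intro sets_PiM_cong) auto

lemma prob_space_normal_Rn: "0 < t \<Longrightarrow> prob_space (normal_Rn n v t)"
  unfolding normal_Rn_def by (intro prob_space_PiM prob_space_normal_density) simp

lemma measurable_normal_Rn:
  assumes t: "0 < t"
  shows "(\<lambda>z. normal_Rn n z t) \<in> borel_Rn n \<rightarrow>\<^sub>M prob_algebra (borel_Rn n)"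
proof (rule measurable_prob_algebra_generated)
  let ?G = "prod_algebra {1..n} (\<lambda>_. borel :: real measure)"
  show "Int_stable ?G" by (rule Int_stable_prod_algebra)
  show "?G \<subseteq> Pow (\<Pi>\<^sub>E i\<in>{1..n}. space borel)" by (rule prod_algebra_sets_into_space)
  show "sets (borel_Rn n) = sigma_sets (\<Pi>\<^sub>E i\<in>{1..n}. space borel) ?G" by (rule sets_PiM)
  show "prob_space (normal_Rn n z t)" for z using t by (rule prob_space_normal_Rn)
  show "sets (normal_Rn n z t) = sets (borel_Rn n)" for z by simp
  fix A assume "A \<in> ?G"
  then obtain E where A: "A = (\<Pi>\<^sub>E i\<in>{1..n}. E i)" "\<And>i. i \<in> {1..n} \<Longrightarrow> E i \<in> sets borel"
    unfolding prod_algebra_eq_finite[OF finite_atLeastAtMost] by blast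
  have "emeasure (normal_Rn n z t) A =
      (\<Prod>i\<in>{1..n}. \<integral>\<^sup>+ x. ennreal (normal_density (z i) (sqrt t) x) * indicator (E i) x \<partial>lborel)" for z
  proof -
    interpret product_sigma_finite "\<lambda>i. density lborel (normal_density (z i) (sqrt t))"
      using t by (auto simp: product_sigma_finite_def
          intro!: prob_space_imp_sigma_finite prob_space_normal_density)
    show ?thesis
      unfolding normal_Rn_def A(1) using A(2)
      by (subst emeasure_PiM) (auto simp: emeasure_density intro!: prod.cong)
  qed
  moreover have "(\<lambda>z. \<Prod>i\<in>{1..n}. \<integral>\<^sup>+ x. ennreal (normal_density (z i) (sqrt t) x) * indicator (E i) x \<partial>lborel)
      \<in> borel_measurable (borel_Rn n)"
  proof (rule borel_measurable_prod_ennreal)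
    fix i assume i: "i \<in> {1..n}"
    have [measurable]: "E i \<in> sets borel" using A i by auto
    have [measurable]: "(\<lambda>z. z i) \<in> borel_Rn n \<rightarrow>\<^sub>M borel"
      using i by (rule measurable_component_singleton)
    show "(\<lambda>z. \<integral>\<^sup>+ x. ennreal (normal_density (z i) (sqrt t) x) * indicator (E i) x \<partial>lborel)
        \<in> borel_measurable (borel_Rn n)"
      unfolding normal_density_def by measurable
  qed
  ultimately show "(\<lambda>z. emeasure (normal_Rn n z t) A) \<in> borel_measurable (borel_Rn n)"
    by simp
qed

lemma magnetisation_measurable [measurable]: "magnetisation n \<in> borel_measurable (borel_Rn n)"
  unfolding magnetisation_def by measurable

lemma
  assumes V: "\<And>r. 0 \<le> V r" "lower_semicontinuous V" and t: "0 < t"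
  shows sets_time_evolved: "sets (time_evolved V t n) = sets (borel_Rn n)"
    and emeasure_time_evolved: "A \<in> sets (borel_Rn n) \<Longrightarrow> emeasure (time_evolved V t n) A =
      (\<integral>\<^sup>+ z. emeasure (normal_Rn n z t) A * ennreal (exp (- real n * V (magnetisation n z)))
         \<partial>normal_Rn n (\<lambda>_. 0) 1) / norm_const V n"
    and prob_space_time_evolved: "prob_space (time_evolved V t n)"
proof -
  let ?w = "\<lambda>z. ennreal (exp (- real n * V (magnetisation n z)))"
  let ?N = "normal_Rn n (\<lambda>_. 0) 1"
  let ?F = "\<lambda>A. (\<integral>\<^sup>+ z. emeasure (normal_Rn n z t) A * ?w z \<partial>?N) / norm_const V n"
  note [measurable] = lower_semicontinuous_borel_measurable[OF V(2)]
    measurable_prob_algebraD[OF measurable_normal_Rn[OF t, of n]]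
  interpret N: prob_space ?N by (rule prob_space_normal_Rn) simp
  show sets: "sets (time_evolved V t n) = sets (borel_Rn n)"
    unfolding time_evolved_def by (rule sets.sets_measure_of_eq)
  have [measurable]: "(\<lambda>z. emeasure (normal_Rn n z t) A) \<in> borel_measurable (borel_Rn n)"
    if "A \<in> sets (borel_Rn n)" for A
    using that by (rule measurable_emeasure_kernel[OF measurable_prob_algebraD[OF measurable_normal_Rn[OF t]]])
  show emeasure: "emeasure (time_evolved V t n) A = ?F A" if A: "A \<in> sets (borel_Rn n)" for A
  proof (rule emeasure_measure_of[OF time_evolved_def])
    show "sets (borel_Rn n) \<subseteq> Pow (space (borel_Rn n))" by (rule sets.space_closed)
    show "A \<in> sets (time_evolved V t n)" using A sets by simp
    show "positive (sets (time_evolved V t n)) ?F" by (simp add: positive_def)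
    show "countably_additive (sets (time_evolved V t n)) ?F"
    proof (rule countably_additiveI, unfold sets)
      fix B :: "nat \<Rightarrow> _" assume B: "range B \<subseteq> sets (borel_Rn n)" "disjoint_family B"
      then have [measurable]: "B i \<in> sets (borel_Rn n)" for i by auto
      have "(\<Sum>i. ?F (B i)) = (\<Sum>i. \<integral>\<^sup>+ z. emeasure (normal_Rn n z t) (B i) * ?w z \<partial>?N) / norm_const V n"
        by (simp add: divide_ennreal_def)
      also have "(\<Sum>i. \<integral>\<^sup>+ z. emeasure (normal_Rn n z t) (B i) * ?w z \<partial>?N) =
          (\<integral>\<^sup>+ z. (\<Sum>i. emeasure (normal_Rn n z t) (B i) * ?w z) \<partial>?N)"
        by (rule nn_integral_suminf[symmetric]) measurable
      also have "\<dots> = (\<integral>\<^sup>+ z. emeasure (normal_Rn n z t) (\<Union>i. B i) * ?w z \<partial>?N)"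
        using B by (simp add: suminf_emeasure)
      finally show "(\<Sum>i. ?F (B i)) = ?F (\<Union>i. B i)" .
    qed
  qed
  have le: "norm_const V n \<le> (\<integral>\<^sup>+ z. 1 \<partial>?N)"
    unfolding norm_const_def using V(1) by (intro nn_integral_mono) simp
  have "norm_const V n \<noteq> 0"
    unfolding norm_const_def by (simp add: nn_integral_0_iff_AE)
  moreover have "norm_const V n \<noteq> \<top>"
    using le N.emeasure_space_1 by (auto simp: top_unique)
  moreover have "emeasure (normal_Rn n z t) (space (borel_Rn n)) = 1" for z
    using prob_space.emeasure_space_1[OF prob_space_normal_Rn[OF t]]
      sets_eq_imp_space_eq[OF sets_normal_Rn] by metis
  ultimately show "prob_space (time_evolved V t n)"
    using emeasure[OF sets.top]
    by (intro prob_spaceI) (simp add: sets_eq_imp_space_eq[OF sets] norm_const_def less_top ennreal_divide_self)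
qed

definition other_spins :: "nat \<Rightarrow> (nat \<Rightarrow> real) \<Rightarrow> (nat \<Rightarrow> real)" where
  "other_spins n y = (\<lambda>i\<in>{1..n - 1}. y (i + 1))"

definition support_Rn :: "nat \<Rightarrow> (nat \<Rightarrow> real) measure \<Rightarrow> (nat \<Rightarrow> real) set" where
  "support_Rn n M =
     {y \<in> topspace (top_Rn n). \<forall>U. openin (top_Rn n) U \<and> y \<in> U \<longrightarrow> emeasure M U > 0}"

text \<open>
  A kernel takes values in measures of total mass at most \<open>1\<close>, not necessarily equal to \<open>1\<close>:
  properness forces the zero measure outside the support.
\<close>

definition first_spin_rcp ::
  "nat \<Rightarrow> (nat \<Rightarrow> real) measure \<Rightarrow> ((nat \<Rightarrow> real) \<Rightarrow> real measure) \<Rightarrow> bool" where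
  "first_spin_rcp n \<rho> \<gamma> \<longleftrightarrow>
     \<gamma> \<in> borel_Rn (n - 1) \<rightarrow>\<^sub>M subprob_algebra borel \<and>
     (\<forall>A \<in> sets borel. \<forall>B \<in> sets (borel_Rn (n - 1)).
        emeasure \<rho> {x \<in> space (borel_Rn n). x 1 \<in> A \<and> other_spins n x \<in> B} =
        (\<integral>\<^sup>+ y. indicator B y * emeasure (\<gamma> y) A \<partial>distr \<rho> (borel_Rn (n - 1)) (other_spins n)))"

definition proper_rcp ::
  "nat \<Rightarrow> (nat \<Rightarrow> real) measure \<Rightarrow> ((nat \<Rightarrow> real) \<Rightarrow> real measure) \<Rightarrow> bool" where
  "proper_rcp n \<rho> \<gamma> \<longleftrightarrow>
     (\<forall>y \<in> space (borel_Rn (n - 1)).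
        y \<notin> support_Rn (n - 1) (distr \<rho> (borel_Rn (n - 1)) (other_spins n)) \<longrightarrow>
        (\<forall>A \<in> sets borel. emeasure (\<gamma> y) A = 0))"

text \<open>
  The weak topology on finite measures is the initial topology of the integrals of bounded
  continuous functions. The library's \<^const>\<open>weak_conv_m\<close> is not used: it compares
  distribution functions and so does not describe this topology when the total masses vary.
\<close>

definition weakly_continuous :: "nat \<Rightarrow> ((nat \<Rightarrow> real) \<Rightarrow> real measure) \<Rightarrow> bool" where
  "weakly_continuous n \<gamma> \<longleftrightarrow>
     (\<forall>f :: real \<Rightarrow> real. continuous_on UNIV f \<and> bounded (range f) \<longrightarrow>
        continuous_map (top_Rn (n - 1)) euclideanreal (\<lambda>y. LINT x|\<gamma> y. f x))"

definition weakly_converges :: "(nat \<Rightarrow> real measure) \<Rightarrow> real measure \<Rightarrow> bool" where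
  "weakly_converges M N \<longleftrightarrow>
     (\<forall>f :: real \<Rightarrow> real. continuous_on UNIV f \<and> bounded (range f) \<longrightarrow>
        (\<lambda>n. LINT x|M n. f x) \<longlonglongrightarrow> (LINT x|N. f x))"

text \<open>
  The weakly continuous proper kernels \<open>\<gamma> n\<close> below are unique on $\mathbb{R}^{n-1}$, so the
  existential quantifier over \<open>\<gamma>\<close> only names them.
\<close>

definition good_magnetisation :: "(nat \<Rightarrow> (nat \<Rightarrow> real) measure) \<Rightarrow> real \<Rightarrow> bool" where
  "good_magnetisation \<rho> \<alpha> \<longleftrightarrow>
     (\<exists>\<gamma>. (\<forall>n\<ge>2. first_spin_rcp n (\<rho> n) (\<gamma> n) \<and> proper_rcp n (\<rho> n) (\<gamma> n) \<and>
                  weakly_continuous n (\<gamma> n)) \<and>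
          (\<exists>\<gamma>\<^sub>\<alpha>. prob_space \<gamma>\<^sub>\<alpha> \<and> sets \<gamma>\<^sub>\<alpha> = sets borel \<and>
             (\<forall>v. (\<forall>n\<ge>2. v (n - 1) \<in> space (borel_Rn (n - 1))) \<and>
                  (\<lambda>n. magnetisation (n - 1) (v (n - 1))) \<longlonglongrightarrow> \<alpha> \<longrightarrow>
                  weakly_converges (\<lambda>n. \<gamma> n (v (n - 1))) \<gamma>\<^sub>\<alpha>)))"

definition sequentially_Gibbs :: "(nat \<Rightarrow> (nat \<Rightarrow> real) measure) \<Rightarrow> bool" where
  "sequentially_Gibbs \<rho> \<longleftrightarrow> (\<forall>\<alpha>. good_magnetisation \<rho> \<alpha>)"

end

(*
  Write k = (1 + t) / (2 t) and b = alpha / (1 + t). Up to a constant the rate function is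
  V r + k (r - b)^2, so uniqueness of minimisers for all alpha concerns the minimisers of
  v + k (r - b)^2 over the epigraph S of V. Minimisers depend on b with a closed graph and leave
  every bounded set as b tends to +-infinity; if they are unique for every b, then by connectedness
  of the real line every point is a minimiser for some b, and comparing it with two outer points
  gives the strict bound on the second difference quotient. The same comparison shows that
  uniqueness for k implies uniqueness for every k' >= k, that is, for all earlier times.

  The measures mu_{n,t} only see V up to Lebesgue null sets, and V is merely lower semicontinuous,
  so their large n behaviour is governed by the closed set of essential limit points of the
  epigraph of V instead of the epigraph itself. By Gaussian conjugacy the conditional law of the
  first spin is a mixture of normal laws, the mixing measure having density proportional to
  exp (-n (V r + k_n (r - b_n)^2)) with k_n --> k and b_n --> b, and Laplace's method shows that it
  concentrates at the essential minimisers. A unique minimiser yields convergence for all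
  configurations; with two minimisers, tilting b slightly to either side selects different ones,
  which excludes a common limit. The crossover time is the infimum of the times at which
  uniqueness fails.
*)

theory Submission
  imports Defs
begin

section \<open>Minimisers of tilted functionals over closed planar sets\<close>

text \<open>Minimisation is stated for closed planar sets rather than for functions because the
  essential epigraph may have empty fibres: for V 0 = 0 and V r = 1 / |r| elsewhere, no point of it
  lies over 0, although V is real-valued. The two halves of the theorem concern different sets, the
  epigraph and the essential epigraph. These may disagree (lower a constant V at one point), so the
  crossover is not read off from the second difference quotient of V; what the halves share are the
  planar lemmas. Time enters them only through (1 + t) / (2 t), which decreases in t.
  \<open>good_magnetisation\<close> only asserts that some kernel exists, so disproving it requires
  uniqueness of weakly continuous kernels, which comes from the full support of the law of the other
  spins. The exact conditional laws have parameters depending on n, so Laplace's method is carried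
  out for moving k_n and b_n, and for integrands that move with n as well.\<close>

definition argmin_pairs :: "(real \<times> real) set \<Rightarrow> real \<Rightarrow> real \<Rightarrow> (real \<times> real) set" where
  "argmin_pairs S k b =
     {(r, v) \<in> S. \<forall>(s, w) \<in> S. v + k * (r - b)\<^sup>2 \<le> w + k * (s - b)\<^sup>2}"

text \<open>Only first coordinates are compared: two minimisers over the same \<open>r\<close> have
  equal total value, hence equal height.\<close>

definition unique_minimisers :: "(real \<times> real) set \<Rightarrow> real \<Rightarrow> bool" where
  "unique_minimisers S k \<longleftrightarrow> (\<forall>b. \<forall>x \<in> argmin_pairs S k b. \<forall>y \<in> argmin_pairs S k b. fst x = fst y)"

lemma bounded_sublevel:
  assumes "0 < k"
  shows "bounded {(r, v). 0 \<le> v \<and> v + k * (r - b)\<^sup>2 \<le> (c::real)}"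
proof -
  have "{(r, v). 0 \<le> v \<and> v + k * (r - b)\<^sup>2 \<le> c} \<subseteq> {b - sqrt (c / k) .. b + sqrt (c / k)} \<times> {0..c}"
  proof (clarify, intro conjI SigmaI)
    fix r v assume v: "0 \<le> v" and le: "v + k * (r - b)\<^sup>2 \<le> c"
    have "0 \<le> k * (r - b)\<^sup>2" using assms by simp
    then show "v \<in> {0..c}" using v le by simp
    have "(r - b)\<^sup>2 \<le> c / k" using assms v le by (simp add: pos_le_divide_eq mult.commute)
    then have "\<bar>r - b\<bar> \<le> sqrt (c / k)" by (metis real_sqrt_abs real_sqrt_le_iff)
    then show "r \<in> {b - sqrt (c / k) .. b + sqrt (c / k)}" by auto
  qed
  then show ?thesis by (rule bounded_subset[rotated]) (auto intro: bounded_Times)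
qed

lemma argmin_pairs_nonempty:
  assumes S: "closed S" "S \<noteq> {}" and nonneg: "\<And>r v. (r, v) \<in> S \<Longrightarrow> 0 \<le> v" and k: "0 < k"
  shows "argmin_pairs S k b \<noteq> {}"
proof -
  obtain r0 v0 where x0: "(r0, v0) \<in> S" using S(2) by auto
  define H where "H = (\<lambda>x::real \<times> real. snd x + k * (fst x - b)\<^sup>2)"
  have H: "continuous_on A H" for A unfolding H_def by (intro continuous_intros)
  define C where "C = S \<inter> {x. H x \<le> H (r0, v0)}"
  have "C \<subseteq> {(r, v). 0 \<le> v \<and> v + k * (r - b)\<^sup>2 \<le> H (r0, v0)}"
    unfolding C_def H_def using nonneg by auto
  then have "bounded C" using bounded_sublevel[OF k] bounded_subset by blast
  moreover have "closed C" unfolding C_def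
    by (intro closed_Int S(1) closed_Collect_le H continuous_on_const)
  ultimately have "compact C" by (simp add: compact_eq_bounded_closed)
  moreover have "C \<noteq> {}" using x0 by (auto simp: C_def)
  ultimately have "\<exists>x\<in>C. \<forall>y\<in>C. H x \<le> H y"
    by (rule continuous_attains_inf[OF _ _ H])
  then obtain x where x: "x \<in> C" "\<And>y. y \<in> C \<Longrightarrow> H x \<le> H y"
    by blast
  have "H x \<le> H y" if "y \<in> S" for y
  proof (cases "H y \<le> H (r0, v0)")
    case True then show ?thesis using that x(2) by (simp add: C_def)
  next
    case False then show ?thesis using x(1) by (simp add: C_def)
  qed
  then have "x \<in> argmin_pairs S k b"
    using x(1) unfolding argmin_pairs_def C_def H_def by auto
  then show ?thesis by blast
qed

text \<open>Closed graph together with compactness. Comparing every minimiser with one fixed point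
  of \<open>S\<close> bounds them all, since the fields \<open>b n\<close> are bounded; optimality
  then passes to the limit of a subsequence.\<close>

lemma argmin_pairs_limit:
  assumes S: "closed S" and nonneg: "\<And>r v. (r, v) \<in> S \<Longrightarrow> 0 \<le> v" and k: "0 < k"
    and x: "\<And>n. x n \<in> argmin_pairs S k (b n)" and b: "b \<longlonglongrightarrow> b0"
  obtains l f where "l \<in> argmin_pairs S k b0" "strict_mono (f :: nat \<Rightarrow> nat)" "(x \<circ> f) \<longlonglongrightarrow> l"
proof -
  have xS: "x n \<in> S" for n using x[of n] by (auto simp: argmin_pairs_def)
  obtain r0 v0 where x0: "(r0, v0) \<in> S" using xS[of 0] by (cases "x 0") auto
  obtain B where B: "\<And>n. \<bar>b n\<bar> \<le> B" using b convergent_imp_Bseq convergentI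
    by (metis BseqD real_norm_def)
  define c where "c = v0 + k * (\<bar>r0\<bar> + B)\<^sup>2"
  have le: "snd (x n) + k * (fst (x n) - b n)\<^sup>2 \<le> c" for n
  proof -
    have "snd (x n) + k * (fst (x n) - b n)\<^sup>2 \<le> v0 + k * (r0 - b n)\<^sup>2"
      using x[of n] x0 by (auto simp: argmin_pairs_def)
    moreover have "\<bar>r0 - b n\<bar> \<le> \<bar>r0\<bar> + B" using B[of n] by linarith
    then have "(r0 - b n)\<^sup>2 \<le> (\<bar>r0\<bar> + B)\<^sup>2" by (metis abs_ge_zero power2_abs power_mono)
    then have "k * (r0 - b n)\<^sup>2 \<le> k * (\<bar>r0\<bar> + B)\<^sup>2" using k by simp
    ultimately show ?thesis unfolding c_def by linarith
  qed
  have "\<bar>fst (x n)\<bar> \<le> sqrt (c / k) + B \<and> \<bar>snd (x n)\<bar> \<le> c" for n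
  proof -
    have v: "0 \<le> snd (x n)" using nonneg xS[of n] by (cases "x n") auto
    have "0 \<le> k * (fst (x n) - b n)\<^sup>2" using k by simp
    moreover have "(fst (x n) - b n)\<^sup>2 \<le> c / k"
      using k v le[of n] by (simp add: pos_le_divide_eq mult.commute)
    then have "\<bar>fst (x n) - b n\<bar> \<le> sqrt (c / k)" by (metis real_sqrt_abs real_sqrt_le_iff)
    ultimately show ?thesis using B[of n] v le[of n] by linarith
  qed
  then have "range x \<subseteq> {- (sqrt (c / k) + B) .. sqrt (c / k) + B} \<times> {- c .. c}"
    by (auto simp only: mem_Times_iff atLeastAtMost_iff abs_le_iff minus_le_iff image_iff UNIV_I subset_iff)
  then have "bounded (range x)"
    by (rule bounded_subset[rotated]) (auto intro: bounded_Times)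
  then obtain l f where f: "strict_mono (f :: nat \<Rightarrow> nat)" and l: "(x \<circ> f) \<longlonglongrightarrow> l"
    using bounded_imp_convergent_subsequence by blast
  have "l \<in> S" using S l xS closed_sequentially[of S "x \<circ> f" l] by (auto simp: o_def)
  moreover have "snd l + k * (fst l - b0)\<^sup>2 \<le> w + k * (s - b0)\<^sup>2" if "(s, w) \<in> S" for s w
  proof (rule LIMSEQ_le)
    have bf: "(\<lambda>n. b (f n)) \<longlonglongrightarrow> b0" using LIMSEQ_subseq_LIMSEQ[OF b f] by (simp add: o_def)
    have l': "(\<lambda>n. x (f n)) \<longlonglongrightarrow> l" using l by (simp add: o_def)
    show "(\<lambda>n. snd (x (f n)) + k * (fst (x (f n)) - b (f n))\<^sup>2) \<longlonglongrightarrow> snd l + k * (fst l - b0)\<^sup>2"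
      by (intro tendsto_intros bf l')
    show "(\<lambda>n. w + k * (s - b (f n))\<^sup>2) \<longlonglongrightarrow> w + k * (s - b0)\<^sup>2"
      by (intro tendsto_intros bf)
    show "\<exists>N. \<forall>n\<ge>N. snd (x (f n)) + k * (fst (x (f n)) - b (f n))\<^sup>2 \<le> w + k * (s - b (f n))\<^sup>2"
    proof (intro exI allI impI)
      fix n
      show "snd (x (f n)) + k * (fst (x (f n)) - b (f n))\<^sup>2 \<le> w + k * (s - b (f n))\<^sup>2"
        using x[of "f n"] that unfolding argmin_pairs_def by (auto split: prod.splits)
    qed
  qed
  ultimately have "l \<in> argmin_pairs S k b0" by (cases l) (auto simp: argmin_pairs_def)
  then show ?thesis using that f l by blast
qed

text \<open>\<open>P\<close> and \<open>Q\<close> are the fields with a minimiser at or to the left,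
  respectively right, of \<open>c\<close>. They are closed by the closed graph, cover the line by
  existence, and are nonempty because for extreme fields \<open>x1\<close> or \<open>x2\<close>
  beats everything beyond \<open>c\<close>. So they meet, and at a common field uniqueness pins the
  first coordinate to \<open>c\<close>.\<close>

lemma unique_minimisers_attained:
  assumes S: "closed S" and nonneg: "\<And>r v. (r, v) \<in> S \<Longrightarrow> 0 \<le> v" and k: "0 < k"
    and unique: "unique_minimisers S k"
    and x1: "(x1, w1) \<in> S" "x1 < c" and x2: "(x2, w2) \<in> S" "c < x2"
  obtains b v where "(c, v) \<in> argmin_pairs S k b"
proof -
  define P where "P = {b. \<exists>x \<in> argmin_pairs S k b. fst x \<le> c}"
  define Q where "Q = {b. \<exists>x \<in> argmin_pairs S k b. c \<le> fst x}"
  have ne: "argmin_pairs S k b \<noteq> {}" for b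
    by (rule argmin_pairs_nonempty[OF S _ nonneg k]) (use x1 in auto)
  have "closed P"
  proof (unfold closed_sequential_limits, intro allI impI, elim conjE)
    fix b b0 assume "\<forall>n. b n \<in> P" and b: "b \<longlonglongrightarrow> b0"
    then have "\<forall>n. \<exists>x. x \<in> argmin_pairs S k (b n) \<and> fst x \<le> c"
      unfolding P_def by blast
    then obtain x where x: "\<And>n. x n \<in> argmin_pairs S k (b n)" "\<And>n. fst (x n) \<le> c"
      by metis
    obtain l f where l: "l \<in> argmin_pairs S k b0" "strict_mono f" "(x \<circ> f) \<longlonglongrightarrow> l"
      by (rule argmin_pairs_limit[OF S nonneg k x(1) b])
    have "fst l \<le> c" using x(2) tendsto_fst[OF l(3)] by (intro LIMSEQ_le_const2) (auto simp: o_def)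
    then show "b0 \<in> P" using l(1) by (auto simp: P_def)
  qed
  moreover have "closed Q"
  proof (unfold closed_sequential_limits, intro allI impI, elim conjE)
    fix b b0 assume "\<forall>n. b n \<in> Q" and b: "b \<longlonglongrightarrow> b0"
    then have "\<forall>n. \<exists>x. x \<in> argmin_pairs S k (b n) \<and> c \<le> fst x"
      unfolding Q_def by blast
    then obtain x where x: "\<And>n. x n \<in> argmin_pairs S k (b n)" "\<And>n. c \<le> fst (x n)"
      by metis
    obtain l f where l: "l \<in> argmin_pairs S k b0" "strict_mono f" "(x \<circ> f) \<longlonglongrightarrow> l"
      by (rule argmin_pairs_limit[OF S nonneg k x(1) b])
    have "c \<le> fst l" using x(2) tendsto_fst[OF l(3)] by (intro LIMSEQ_le_const) (auto simp: o_def)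
    then show "b0 \<in> Q" using l(1) by (auto simp: Q_def)
  qed
  moreover have "P \<union> Q = UNIV"
  proof -
    have "b \<in> P \<union> Q" for b
    proof -
      obtain x where x: "x \<in> argmin_pairs S k b" using ne by blast
      show ?thesis
      proof (cases "fst x \<le> c")
        case True then show ?thesis using x by (auto simp: P_def)
      next
        case False then show ?thesis using x by (force simp: Q_def)
      qed
    qed
    then show ?thesis by blast
  qed
  moreover have "P \<noteq> {}"
  proof -
    \<comment> \<open>\<open>e\<close> solves \<open>k * ((c - x1) * e) = w1\<close>. For
      \<open>b\<close> this far left, the quadratic term of a point right of \<open>c\<close>
      exceeds that of \<open>x1\<close> by more than \<open>w1\<close>, and its height cannot
      compensate, being nonnegative.\<close>
    define e where "e = w1 / (k * (c - x1))"
    have e: "0 \<le> e" "k * ((c - x1) * e) = w1" using k x1 nonneg[OF x1(1)] by (auto simp: e_def)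
    define b where "b = (c + x1 - e - 1) / 2"
    have "fst x \<le> c" if x: "x \<in> argmin_pairs S k b" for x
    proof (rule ccontr)
      assume gt: "\<not> fst x \<le> c"
      have v: "0 \<le> snd x" using nonneg x by (auto simp: argmin_pairs_def)
      have "snd x + k * (fst x - b)\<^sup>2 \<le> w1 + k * (x1 - b)\<^sup>2"
        using x x1 by (auto simp: argmin_pairs_def)
      then have le: "k * ((fst x - x1) * (fst x + x1 - 2 * b)) \<le> w1"
        using v by (simp add: power2_eq_square algebra_simps)
      have "fst x + x1 - 2 * b = fst x - c + e + 1" by (simp add: b_def field_simps)
      then have "e + 1 \<le> fst x + x1 - 2 * b" using gt by simp
      then have "(c - x1) * (e + 1) \<le> (fst x - x1) * (fst x + x1 - 2 * b)"
        using gt x1 e by (intro mult_mono) auto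
      then have "k * ((c - x1) * (e + 1)) \<le> w1"
        using le k by (meson less_imp_le mult_left_mono order_trans)
      moreover have "k * ((c - x1) * (e + 1)) = w1 + k * (c - x1)"
        using e(2) by (simp add: distrib_left)
      ultimately show False using mult_pos_pos[OF k, of "c - x1"] x1 by simp
    qed
    then show ?thesis using ne[of b] by (auto simp: P_def)
  qed
  moreover have "Q \<noteq> {}"
  proof -
    define e where "e = w2 / (k * (x2 - c))"
    have e: "0 \<le> e" "k * ((x2 - c) * e) = w2" using k x2 nonneg[OF x2(1)] by (auto simp: e_def)
    define b where "b = (c + x2 + e + 1) / 2"
    have "c \<le> fst x" if x: "x \<in> argmin_pairs S k b" for x
    proof (rule ccontr)
      assume gt: "\<not> c \<le> fst x"
      have v: "0 \<le> snd x" using nonneg x by (auto simp: argmin_pairs_def)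
      have "snd x + k * (fst x - b)\<^sup>2 \<le> w2 + k * (x2 - b)\<^sup>2"
        using x x2 by (auto simp: argmin_pairs_def)
      then have le: "k * ((x2 - fst x) * (2 * b - fst x - x2)) \<le> w2"
        using v by (simp add: power2_eq_square algebra_simps)
      have "2 * b - fst x - x2 = c - fst x + e + 1" by (simp add: b_def field_simps)
      then have "e + 1 \<le> 2 * b - fst x - x2" using gt by simp
      then have "(x2 - c) * (e + 1) \<le> (x2 - fst x) * (2 * b - fst x - x2)"
        using gt x2 e by (intro mult_mono) auto
      then have "k * ((x2 - c) * (e + 1)) \<le> w2"
        using le k by (meson less_imp_le mult_left_mono order_trans)
      moreover have "k * ((x2 - c) * (e + 1)) = w2 + k * (x2 - c)"
        using e(2) by (simp add: distrib_left)
      ultimately show False using mult_pos_pos[OF k, of "x2 - c"] x2 by simp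
    qed
    then show ?thesis using ne[of b] by (auto simp: Q_def)
  qed
  ultimately have "P \<inter> Q \<noteq> {}"
  proof -
    assume *: "closed P" "closed Q" "P \<union> Q = UNIV" "P \<noteq> {}" "Q \<noteq> {}"
    show "P \<inter> Q \<noteq> {}"
    proof
      assume "P \<inter> Q = {}"
      with * have "\<exists>A B. closed A \<and> closed B \<and> (UNIV :: real set) \<subseteq> A \<union> B \<and> A \<inter> B \<inter> UNIV = {}
          \<and> A \<inter> UNIV \<noteq> {} \<and> B \<inter> UNIV \<noteq> {}"
        by (intro exI[of _ P] exI[of _ Q]) simp
      then show False using connected_UNIV[where 'a=real] unfolding connected_closed by blast
    qed
  qed
  then obtain b x y where "x \<in> argmin_pairs S k b" "fst x \<le> c" "y \<in> argmin_pairs S k b" "c \<le> fst y"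
    by (auto simp: P_def Q_def)
  moreover from this have "fst x = fst y" using unique unfolding unique_minimisers_def by blast
  ultimately have "(c, snd x) \<in> argmin_pairs S k b" by (cases x) auto
  then show ?thesis using that by blast
qed

text \<open>Strict optimality at \<open>c\<close> against both outer points is weighted with
  \<open>x2 - c\<close> and \<open>c - x1\<close>. The field cancels by the identity (x2-c)(x1-b)^2
  + (c-x1)(x2-b)^2 - (x2-x1)(c-b)^2 = (x2-c)(c-x1)(x2-x1). With denominators cleared, the conclusion
  says that the second difference quotient of the heights \<open>w1\<close>, \<open>v\<close>,
  \<open>w2\<close> exceeds \<open>- k\<close>.\<close>

lemma unique_minimisers_strict_convex:
  assumes S: "closed S" and nonneg: "\<And>r v. (r, v) \<in> S \<Longrightarrow> 0 \<le> v" and k: "0 < k"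
    and unique: "unique_minimisers S k"
    and x1: "(x1, w1) \<in> S" "x1 < c" and x2: "(x2, w2) \<in> S" "c < x2"
  obtains v where "(c, v) \<in> S"
    "(x2 - x1) * v < (x2 - c) * w1 + (c - x1) * w2 + k * ((x2 - c) * (c - x1) * (x2 - x1))"
proof -
  obtain b v where cv: "(c, v) \<in> argmin_pairs S k b"
    using unique_minimisers_attained[OF assms] .
  have less: "v + k * (c - b)\<^sup>2 < w + k * (x - b)\<^sup>2" if "(x, w) \<in> S" "x \<noteq> c" for x w
  proof (rule ccontr)
    assume "\<not> ?thesis"
    \<comment> \<open>A tie would make \<open>(x, w)\<close> a second minimiser at the same
      field.\<close>
    then have "(x, w) \<in> argmin_pairs S k b" using cv that(1) by (fastforce simp: argmin_pairs_def)
    then show False using cv unique that(2) by (fastforce simp: unique_minimisers_def)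
  qed
  have "(x2 - c) * (v + k * (c - b)\<^sup>2) < (x2 - c) * (w1 + k * (x1 - b)\<^sup>2)"
    using less[OF x1(1)] x1 x2 by (intro mult_strict_left_mono) auto
  moreover have "(c - x1) * (v + k * (c - b)\<^sup>2) < (c - x1) * (w2 + k * (x2 - b)\<^sup>2)"
    using less[OF x2(1)] x1 x2 by (intro mult_strict_left_mono) auto
  ultimately have "(x2 - x1) * v < (x2 - c) * w1 + (c - x1) * w2 + k * ((x2 - c) * (c - x1) * (x2 - x1))"
    by (simp add: power2_eq_square algebra_simps)
  then show ?thesis using that cv by (auto simp: argmin_pairs_def)
qed

text \<open>The weights of \<open>unique_minimisers_strict_convex\<close> again, now with the outer
  points optimal: the inequality is reversed and no longer strict.\<close>

lemma two_minimisers_chord_le: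
  assumes x1: "(x1, w1) \<in> argmin_pairs S k b" "x1 < c" and x2: "(x2, w2) \<in> argmin_pairs S k b" "c < x2"
    and cv: "(c, v) \<in> S"
  shows "(x2 - c) * w1 + (c - x1) * w2 + k * ((x2 - c) * (c - x1) * (x2 - x1)) \<le> (x2 - x1) * v"
proof -
  have "(x2 - c) * (w1 + k * (x1 - b)\<^sup>2) \<le> (x2 - c) * (v + k * (c - b)\<^sup>2)"
    using x1 x2 cv by (intro mult_left_mono) (auto simp: argmin_pairs_def)
  moreover have "(c - x1) * (w2 + k * (x2 - b)\<^sup>2) \<le> (c - x1) * (v + k * (c - b)\<^sup>2)"
    using x1 x2 cv by (intro mult_left_mono) (auto simp: argmin_pairs_def)
  ultimately show ?thesis by (simp add: power2_eq_square algebra_simps)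
qed

text \<open>Two minimisers for \<open>k'\<close> would set the chord bound for \<open>k'\<close>
  against the strict bound for \<open>k\<close> at a point between them. The product of the three
  distances is positive, so \<open>k \<le> k'\<close> makes the bounds incompatible.\<close>

lemma unique_minimisers_mono:
  assumes S: "closed S" and nonneg: "\<And>r v. (r, v) \<in> S \<Longrightarrow> 0 \<le> v" and k: "0 < k" "k \<le> k'"
    and unique: "unique_minimisers S k"
  shows "unique_minimisers S k'"
proof (rule ccontr)
  assume "\<not> ?thesis"
  then obtain b x y where xy: "x \<in> argmin_pairs S k' b" "y \<in> argmin_pairs S k' b" "fst x < fst y"
    unfolding unique_minimisers_def by (metis linorder_neq_iff)
  obtain x1 w1 x2 w2 where eq: "x = (x1, w1)" "y = (x2, w2)" by (metis surj_pair)
  define c where "c = (x1 + x2) / 2"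
  have c: "x1 < c" "c < x2" using xy eq by (auto simp: c_def)
  have in_S: "(x1, w1) \<in> S" "(x2, w2) \<in> S" using xy eq by (auto simp: argmin_pairs_def)
  obtain v where v: "(c, v) \<in> S"
    "(x2 - x1) * v < (x2 - c) * w1 + (c - x1) * w2 + k * ((x2 - c) * (c - x1) * (x2 - x1))"
    using unique_minimisers_strict_convex[OF S nonneg k(1) unique in_S(1) c(1) in_S(2) c(2)] .
  moreover have "k * ((x2 - c) * (c - x1) * (x2 - x1)) \<le> k' * ((x2 - c) * (c - x1) * (x2 - x1))"
    using k c by (intro mult_right_mono) auto
  moreover have "(x2 - c) * w1 + (c - x1) * w2 + k' * ((x2 - c) * (c - x1) * (x2 - x1)) \<le> (x2 - x1) * v"
    using two_minimisers_chord_le[of x1 w1 S k' b c x2 w2 v] xy(1,2) c eq v(1) by simp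
  ultimately show False by linarith
qed

section \<open>Rate functions and second difference quotients\<close>

definition epigraph_of :: "(real \<Rightarrow> real) \<Rightarrow> (real \<times> real) set" where
  "epigraph_of V = {(r, v). V r \<le> v}"

lemma closed_epigraph_of:
  assumes "lower_semicontinuous V"
  shows "closed (epigraph_of V)"
proof -
  have "\<exists>T. open T \<and> (r, v) \<in> T \<and> T \<subseteq> - epigraph_of V" if "v < V r" for r v
  proof -
    define c where "c = (v + V r) / 2"
    have c: "v < c" "c < V r" using that by (auto simp: c_def)
    then have "\<forall>\<^sub>F y in nhds r. c < V y"
      using assms by (simp add: lower_semicontinuous_def)
    then obtain U where U: "open U" "r \<in> U" "\<And>y. y \<in> U \<Longrightarrow> c < V y"
      by (auto simp: eventually_nhds)
    then show ?thesis
      using c by (intro exI[of _ "U \<times> {..<c}"]) (force simp: open_Times epigraph_of_def)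
  qed
  then have "open (- epigraph_of V)"
    by (intro topological_space_class.openI) (auto simp: epigraph_of_def not_le)
  then show ?thesis by (simp add: closed_def)
qed

text \<open>Completing the square turns r^2 / 2 + (r - \<alpha>)^2 / (2 t) into k (r - b)^2 +
  \<alpha>^2 / (2 (1 + t)). The last term and the subtracted infimum are constant in
  \<open>r\<close> and drop out of every comparison.\<close>

lemma rate_function_minimiser_iff:
  assumes t: "0 < t"
  shows "is_arg_min (rate_function V t \<alpha>) (\<lambda>_. True) r \<longleftrightarrow>
    (r, V r) \<in> argmin_pairs (epigraph_of V) ((1 + t) / (2 * t)) (\<alpha> / (1 + t))"
proof -
  let ?k = "(1 + t) / (2 * t)" and ?b = "\<alpha> / (1 + t)"
  have *: "V r + r\<^sup>2 / 2 + (r - \<alpha>)\<^sup>2 / (2 * t) = V r + ?k * (r - ?b)\<^sup>2 + \<alpha>\<^sup>2 / (2 * (1 + t))" for r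
  proof -
    have "r\<^sup>2 / 2 + (r - \<alpha>)\<^sup>2 / (2 * t) - ?k * (r - ?b)\<^sup>2 - \<alpha>\<^sup>2 / (2 * (1 + t)) = 0"
      using t add_pos_pos[OF zero_less_one t] by (simp add: divide_simps power2_eq_square) algebra
    then show ?thesis by simp
  qed
  show ?thesis
  proof
    assume "is_arg_min (rate_function V t \<alpha>) (\<lambda>_. True) r"
    then have "V r + ?k * (r - ?b)\<^sup>2 \<le> V s + ?k * (s - ?b)\<^sup>2" for s
      unfolding is_arg_min_linorder rate_function_def * by simp
    then show "(r, V r) \<in> argmin_pairs (epigraph_of V) ?k ?b"
      unfolding argmin_pairs_def epigraph_of_def
      by (auto simp del: times_divide_eq_left intro: order_trans[OF _ add_right_mono])
  next
    assume "(r, V r) \<in> argmin_pairs (epigraph_of V) ?k ?b"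
    then have "V r + ?k * (r - ?b)\<^sup>2 \<le> V s + ?k * (s - ?b)\<^sup>2" for s
      unfolding argmin_pairs_def epigraph_of_def by auto
    then show "is_arg_min (rate_function V t \<alpha>) (\<lambda>_. True) r"
      unfolding is_arg_min_linorder rate_function_def * by simp
  qed
qed

lemma argmin_pairs_epigraph_of:
  assumes "(r, v) \<in> argmin_pairs (epigraph_of V) k b"
  shows "v = V r"
proof -
  have "(r, V r) \<in> epigraph_of V" by (simp add: epigraph_of_def)
  then have "v + k * (r - b)\<^sup>2 \<le> V r + k * (r - b)\<^sup>2"
    using assms unfolding argmin_pairs_def by blast
  moreover have "V r \<le> v" using assms by (simp add: argmin_pairs_def epigraph_of_def)
  ultimately show ?thesis by simp
qed

lemma has_multiple_global_minimisers_rate_function_iff: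
  assumes t: "0 < t"
  shows "(\<exists>\<alpha>. has_multiple_global_minimisers (rate_function V t \<alpha>)) \<longleftrightarrow>
    \<not> unique_minimisers (epigraph_of V) ((1 + t) / (2 * t))"
proof -
  have "(\<exists>\<alpha>. has_multiple_global_minimisers (rate_function V t \<alpha>)) \<longleftrightarrow>
    (\<exists>b r s. r \<noteq> s \<and> (r, V r) \<in> argmin_pairs (epigraph_of V) ((1 + t) / (2 * t)) b
       \<and> (s, V s) \<in> argmin_pairs (epigraph_of V) ((1 + t) / (2 * t)) b)" (is "_ = (\<exists>b. ?P b)")
  proof
    assume "\<exists>b. ?P b"
    then obtain b where "?P b" ..
    moreover have "(b * (1 + t)) / (1 + t) = b" using t by simp
    ultimately have "has_multiple_global_minimisers (rate_function V t (b * (1 + t)))"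
      unfolding has_multiple_global_minimisers_def rate_function_minimiser_iff[OF t] by simp
    then show "\<exists>\<alpha>. has_multiple_global_minimisers (rate_function V t \<alpha>)" ..
  qed (auto simp: has_multiple_global_minimisers_def rate_function_minimiser_iff[OF t])
  also have "\<dots> \<longleftrightarrow> \<not> unique_minimisers (epigraph_of V) ((1 + t) / (2 * t))"
  proof -
    have "x = (fst x, V (fst x))" if "x \<in> argmin_pairs (epigraph_of V) k b" for x k b
      using that argmin_pairs_epigraph_of by (cases x) auto
    then show ?thesis unfolding unique_minimisers_def by (metis fst_conv)
  qed
  finally show ?thesis .
qed

lemma second_diff_quot_le_iff:
  assumes "x < y" "y < z"
  shows "second_diff_quot V x y z \<le> - k \<longleftrightarrow>
    (z - y) * V x + (y - x) * V z + k * ((z - y) * (y - x) * (z - x)) \<le> (z - x) * V y"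
proof -
  let ?d = "(z - y) * (y - x) * (z - x)"
  have d: "0 < ?d" using assms by simp
  have "second_diff_quot V x y z * ?d = (z - y) * V x + (y - x) * V z - (z - x) * V y"
  proof -
    have *: "(A / p - B / q) / d * (p * q * d) = A * q - B * p"
      if "p \<noteq> 0" "q \<noteq> 0" "d \<noteq> 0" for A B p q d :: real
      using that by (simp add: diff_divide_distrib algebra_simps)
    have "second_diff_quot V x y z * ?d = (V z - V y) * (y - x) - (V y - V x) * (z - y)"
      unfolding second_diff_quot_def by (rule *) (use assms in auto)
    then show ?thesis by (simp add: algebra_simps)
  qed
  moreover have "second_diff_quot V x y z \<le> - k \<longleftrightarrow> second_diff_quot V x y z * ?d \<le> - k * ?d"
    by (rule mult_le_cancel_right_pos[OF d, symmetric])
  ultimately show ?thesis by (simp only:) linarith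
qed

text \<open>From left to right, the midpoint of two minimisers serves as \<open>b\<close>, by the
  chord bound. Conversely, uniqueness would give the strict bound for some height \<open>v\<close>
  over \<open>b\<close>, and \<open>V b \<le> v\<close> carries it down to the graph.\<close>

lemma unique_minimisers_epigraph_of_iff:
  assumes V: "\<And>r. 0 \<le> V r" "lower_semicontinuous V" and k: "0 < k"
  shows "\<not> unique_minimisers (epigraph_of V) k \<longleftrightarrow>
    (\<exists>a b c. a < b \<and> b < c \<and> second_diff_quot V a b c \<le> - k)"
proof
  assume "\<not> unique_minimisers (epigraph_of V) k"
  then obtain b x y where xy: "x \<in> argmin_pairs (epigraph_of V) k b"
      "y \<in> argmin_pairs (epigraph_of V) k b" "fst x < fst y"
    unfolding unique_minimisers_def by (metis linorder_neq_iff)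
  define c where "c = (fst x + fst y) / 2"
  have c: "fst x < c" "c < fst y" using xy by (auto simp: c_def)
  have "x = (fst x, V (fst x))" "y = (fst y, V (fst y))"
    using xy argmin_pairs_epigraph_of by (metis prod.collapse)+
  then have "second_diff_quot V (fst x) c (fst y) \<le> - k"
    using two_minimisers_chord_le[of "fst x" "V (fst x)" "epigraph_of V" k b c "fst y" "V (fst y)" "V c"] xy c
    by (auto simp: second_diff_quot_le_iff epigraph_of_def)
  then show "\<exists>a b c. a < b \<and> b < c \<and> second_diff_quot V a b c \<le> - k" using c by blast
next
  assume "\<exists>a b c. a < b \<and> b < c \<and> second_diff_quot V a b c \<le> - k"
  then obtain a b c where abc: "a < b" "b < c"
    "(c - b) * V a + (b - a) * V c + k * ((c - b) * (b - a) * (c - a)) \<le> (c - a) * V b"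
    by (auto simp: second_diff_quot_le_iff)
  show "\<not> unique_minimisers (epigraph_of V) k"
  proof
    assume unique: "unique_minimisers (epigraph_of V) k"
    have "0 \<le> v" if "(r, v) \<in> epigraph_of V" for r v
      using that V(1)[of r] by (simp add: epigraph_of_def)
    then obtain v where "V b \<le> v"
        "(c - a) * v < (c - b) * V a + (b - a) * V c + k * ((c - b) * (b - a) * (c - a))"
      using unique_minimisers_strict_convex[OF closed_epigraph_of[OF V(2)] _ k unique, of a "V a" b c "V c"] abc
      by (auto simp: epigraph_of_def)
    moreover have "(c - a) * V b \<le> (c - a) * v" using \<open>V b \<le> v\<close> abc by (intro mult_left_mono) auto
    ultimately show False using abc by linarith
  qed
qed

section \<open>The essential epigraph\<close>

text \<open>The fibre over \<open>r\<close> consists of the reals above the essential lower limit of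
  \<open>V\<close> at \<open>r\<close>, and is empty if that limit is infinite. Only the Lebesgue
  class of \<open>V\<close> enters. A single \<open>e\<close> can serve as radius and as height
  tolerance because the condition weakens when either grows.\<close>

definition ess_epigraph :: "(real \<Rightarrow> real) \<Rightarrow> (real \<times> real) set" where
  "ess_epigraph V = {(r, v). \<forall>e>0. 0 < emeasure lborel {s \<in> ball r e. V s < v + e}}"

lemma ess_epigraph_nonneg:
  assumes "\<And>r. 0 \<le> V r" "(r, v) \<in> ess_epigraph V"
  shows "0 \<le> v"
proof (rule ccontr)
  assume "\<not> 0 \<le> v"
  then have "0 < - v" by simp
  moreover have "\<forall>e>0. 0 < emeasure lborel {s \<in> ball r e. V s < v + e}"
    using assms(2) unfolding ess_epigraph_def mem_Collect_eq prod.case .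
  ultimately have "0 < emeasure lborel {s \<in> ball r (- v). V s < v + (- v)}" by blast
  moreover have "\<not> V s < v + (- v)" for s using assms(1)[of s] by simp
  ultimately show False by simp
qed

lemma closed_ess_epigraph:
  assumes [measurable]: "V \<in> borel_measurable borel"
  shows "closed (ess_epigraph V)"
proof (unfold closed_sequential_limits, intro allI impI, elim conjE)
  fix x and l :: "real \<times> real" assume x: "\<forall>n. x n \<in> ess_epigraph V" and lim: "x \<longlonglongrightarrow> l"
  have "0 < emeasure lborel {s \<in> ball (fst l) e. V s < snd l + e}" if e: "0 < e" for e
  proof -
    have "\<forall>\<^sub>F n in sequentially. dist (fst (x n)) (fst l) < e / 2"
      "\<forall>\<^sub>F n in sequentially. dist (snd (x n)) (snd l) < e / 2"
      using tendstoD[OF tendsto_fst[OF lim], of "e/2"] tendstoD[OF tendsto_snd[OF lim], of "e/2"] e by auto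
    then obtain n where n: "dist (fst (x n)) (fst l) < e / 2" "dist (snd (x n)) (snd l) < e / 2"
      using eventually_happens'[OF sequentially_bot eventually_conj] by blast
    have "(fst (x n), snd (x n)) \<in> ess_epigraph V" using x by simp
    then have "\<forall>d>0. 0 < emeasure lborel {s \<in> ball (fst (x n)) d. V s < snd (x n) + d}"
      unfolding ess_epigraph_def mem_Collect_eq prod.case .
    moreover have "0 < e / 2" using e by simp
    ultimately have "0 < emeasure lborel {s \<in> ball (fst (x n)) (e / 2). V s < snd (x n) + e / 2}"
      by blast
    also have "\<dots> \<le> emeasure lborel {s \<in> ball (fst l) e. V s < snd l + e}"
    proof (rule emeasure_mono)
      show "{s \<in> ball (fst (x n)) (e / 2). V s < snd (x n) + e / 2} \<subseteq> {s \<in> ball (fst l) e. V s < snd l + e}"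
      proof
        fix s assume "s \<in> {s \<in> ball (fst (x n)) (e / 2). V s < snd (x n) + e / 2}"
        then have s: "dist (fst (x n)) s < e / 2" "V s < snd (x n) + e / 2" by auto
        have "dist (fst l) s < e" "V s < snd l + e"
          using s n unfolding dist_real_def by linarith+
        then show "s \<in> {s \<in> ball (fst l) e. V s < snd l + e}" by simp
      qed
    qed simp
    finally show ?thesis .
  qed
  then show "l \<in> ess_epigraph V" by (cases l) (auto simp: ess_epigraph_def)
qed

text \<open>Passage from local to global: a point missing from the essential epigraph has a ball in
  which the violating set is null, and continuity of \<open>q\<close> lets the level
  \<open>c - q r\<close> at the centre stand for the nearby levels.\<close>

lemma AE_ge_if_not_ess_epigraph:
  assumes V: "V \<in> borel_measurable borel" and q: "continuous_on UNIV q"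
    and C: "\<And>r. r \<in> C \<Longrightarrow> (r, c - q r) \<notin> ess_epigraph V"
  shows "AE s in lborel. s \<in> C \<longrightarrow> c \<le> V s + q s"
proof -
  have "\<exists>d>0. AE s in lborel. s \<in> ball r d \<longrightarrow> c \<le> V s + q s" if r: "r \<in> C" for r
  proof -
    obtain e where e: "0 < e" "\<not> 0 < emeasure lborel {s \<in> ball r e. V s < c - q r + e}"
      using C[OF r] unfolding ess_epigraph_def by auto
    have "isCont q r" using q by (simp add: continuous_on_eq_continuous_at)
    then obtain d where d: "0 < d" "\<And>s. dist s r < d \<Longrightarrow> dist (q s) (q r) < e"
      using e(1) unfolding continuous_at_eps_delta by blast
    have "{s \<in> ball r e. V s < c - q r + e} \<in> null_sets lborel"
      using e(2) V by (intro null_setsI) auto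
    then have "AE s in lborel. s \<in> ball r (min d e) \<longrightarrow> c \<le> V s + q s"
    proof (rule AE_I')
      show "{s \<in> space lborel. \<not> (s \<in> ball r (min d e) \<longrightarrow> c \<le> V s + q s)}
        \<subseteq> {s \<in> ball r e. V s < c - q r + e}"
      proof
        fix s assume "s \<in> {s \<in> space lborel. \<not> (s \<in> ball r (min d e) \<longrightarrow> c \<le> V s + q s)}"
        then have s: "s \<in> ball r e" "dist s r < d" "V s + q s < c" by (auto simp: dist_commute)
        then have "\<bar>q s - q r\<bar> < e" using d(2) by (simp add: dist_real_def)
        then show "s \<in> {s \<in> ball r e. V s < c - q r + e}" using s by auto
      qed
    qed
    then show ?thesis using d(1) e(1) by (intro exI[of _ "min d e"]) auto
  qed
  then obtain d where d: "\<And>r. r \<in> C \<Longrightarrow> 0 < d r"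
      "\<And>r. r \<in> C \<Longrightarrow> AE s in lborel. s \<in> ball r (d r) \<longrightarrow> c \<le> V s + q s"
    by metis
  have "\<And>U. U \<in> (\<lambda>r. ball r (d r)) ` C \<Longrightarrow> open U" by auto
  \<comment> \<open>The balls are indexed by the possibly uncountable set \<open>C\<close>; a
    countable subcover keeps the exceptional set null.\<close>
  then obtain F where F: "F \<subseteq> (\<lambda>r. ball r (d r)) ` C" "countable F" "\<Union>F = \<Union>((\<lambda>r. ball r (d r)) ` C)"
    by (rule Lindelof)
  have "AE s in lborel. \<forall>U\<in>F. s \<in> U \<longrightarrow> c \<le> V s + q s"
    using F(1) d(2) by (subst AE_ball_countable[OF F(2)]) auto
  then show ?thesis
  proof (rule AE_mp, intro AE_I2 impI)
    fix s assume *: "\<forall>U\<in>F. s \<in> U \<longrightarrow> c \<le> V s + q s" and "s \<in> C"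
    then have "s \<in> \<Union>F" unfolding F(3) using d(1) by force
    then show "c \<le> V s + q s" using * by blast
  qed
qed

text \<open>Otherwise \<open>V\<close> would exceed every natural number almost everywhere, although
  its values are finite.\<close>

lemma ess_epigraph_nonempty:
  assumes V: "V \<in> borel_measurable borel"
  shows "ess_epigraph V \<noteq> {}"
proof
  assume "ess_epigraph V = {}"
  then have "AE s in lborel. s \<in> UNIV \<longrightarrow> real n \<le> V s + 0" for n
    by (intro AE_ge_if_not_ess_epigraph V continuous_on_const) auto
  then have "AE s in lborel. \<forall>n. real n \<le> V s" by (simp add: AE_all_countable)
  moreover have "\<not> (\<forall>n. real n \<le> V s)" for s using reals_Archimedean2[of "V s"] by (auto simp: not_le)
  ultimately have "eventually (\<lambda>s :: real. False) (ae_filter lborel)" by simp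
  from AE_E2[OF this] show False by simp
qed

section \<open>Exponential weights and their lower bound\<close>

definition laplace_weight :: "(real \<Rightarrow> real) \<Rightarrow> nat \<Rightarrow> real \<Rightarrow> real \<Rightarrow> real \<Rightarrow> real" where
  "laplace_weight V n k b r = exp (- real n * (V r + k * (r - b)\<^sup>2))"

lemma laplace_weight_measurable [measurable]:
  assumes [measurable]: "V \<in> borel_measurable borel"
  shows "laplace_weight V n k b \<in> borel_measurable borel"
  unfolding laplace_weight_def by measurable

lemma nn_integral_gaussian_finite:
  assumes "0 < a"
  shows "(\<integral>\<^sup>+ s. ennreal (exp (- a * (s - b)\<^sup>2)) \<partial>lborel) < \<infinity>"
proof -
  define \<sigma> where "\<sigma> = 1 / sqrt (2 * a)"
  have \<sigma>: "0 < \<sigma>" "2 * \<sigma>\<^sup>2 = 1 / a" using assms by (auto simp: \<sigma>_def power_divide)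
  have "exp (- a * (s - b)\<^sup>2) = sqrt (2 * pi * \<sigma>\<^sup>2) * normal_density b \<sigma> s" for s
    using \<sigma> assms by (simp add: normal_density_def)
  then have "integrable lborel (\<lambda>s. exp (- a * (s - b)\<^sup>2))"
    using integrable_mult_right[OF integrable_normal_density[OF \<sigma>(1), of b]] by simp
  then show ?thesis by (auto simp: integrable_iff_bounded)
qed

text \<open>Convergence along the product filter supplies one neighbourhood of \<open>r\<close> that
  works for all large \<open>n\<close>, as needed to bound an integrand on a fixed set.\<close>

lemma tendsto_quadratic_prod:
  fixes k b :: "nat \<Rightarrow> real"
  assumes "k \<longlonglongrightarrow> k0" "b \<longlonglongrightarrow> b0"
  shows "((\<lambda>(n, s). k n * (s - b n)\<^sup>2) \<longlongrightarrow> k0 * (r - b0)\<^sup>2) (sequentially \<times>\<^sub>F nhds r)"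
proof -
  have "filterlim (\<lambda>p. k (fst p)) (nhds k0) (sequentially \<times>\<^sub>F nhds r)"
    "filterlim (\<lambda>p. b (fst p)) (nhds b0) (sequentially \<times>\<^sub>F nhds r)"
    "filterlim (\<lambda>p. snd p) (nhds r) (sequentially \<times>\<^sub>F nhds r)"
    using filterlim_compose[OF assms(1) filterlim_fst] filterlim_compose[OF assms(2) filterlim_fst]
      filterlim_snd by auto
  then show ?thesis unfolding case_prod_beta by (intro tendsto_intros)
qed

text \<open>The integral is cut down to a set \<open>A\<close> near \<open>r\<close> on which the
  exponent is within \<open>2 * e / 3\<close> of its value at \<open>(r, v)\<close>; membership in
  the essential epigraph gives \<open>A\<close> positive measure.\<close>

lemma nn_integral_laplace_weight_ge:
  assumes V[measurable]: "V \<in> borel_measurable borel"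
    and lim: "k \<longlonglongrightarrow> k0" "b \<longlonglongrightarrow> b0"
    and rv: "(r, v) \<in> ess_epigraph V" and e: "0 < e"
  shows "\<forall>\<^sub>F n in sequentially. ennreal (exp (- real n * (v + k0 * (r - b0)\<^sup>2 + e)))
    \<le> (\<integral>\<^sup>+ s. ennreal (laplace_weight V n (k n) (b n) s) \<partial>lborel)"
proof -
  define H where "H = v + k0 * (r - b0)\<^sup>2"
  have "\<forall>\<^sub>F p in sequentially \<times>\<^sub>F nhds r. (case p of (n, s) \<Rightarrow> k n * (s - b n)\<^sup>2) < k0 * (r - b0)\<^sup>2 + e / 3"
    using e by (intro order_tendstoD(2)[OF tendsto_quadratic_prod[OF lim]]) simp
  then obtain P Q where PQ: "eventually P sequentially" "eventually Q (nhds r)"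
      "\<And>n s. P n \<Longrightarrow> Q s \<Longrightarrow> k n * (s - b n)\<^sup>2 < k0 * (r - b0)\<^sup>2 + e / 3"
    unfolding eventually_prod_filter by auto
  obtain d where d: "0 < d" "\<And>s. dist s r < d \<Longrightarrow> Q s"
    using PQ(2) unfolding eventually_nhds_metric by blast
  define e' where "e' = min d (e / 3)"
  define A where "A = {s \<in> ball r e'. V s < v + e'}"
  have [measurable]: "A \<in> sets borel" unfolding A_def by measurable
  have "0 < e'" using d e by (simp add: e'_def)
  then have pos: "0 < emeasure lborel A" using rv by (auto simp: ess_epigraph_def A_def)
  have "emeasure lborel A \<le> emeasure lborel (ball r e')"
    by (intro emeasure_mono) (auto simp: A_def)
  also have "\<dots> < \<infinity>" using emeasure_lborel_ball_finite by simp
  finally obtain m where m: "emeasure lborel A = ennreal m" "0 < m"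
    using pos by (cases "emeasure lborel A") auto
  \<comment> \<open>The remaining \<open>e / 3\<close> of the exponent absorbs the fixed measure
    \<open>m\<close> of \<open>A\<close>, however small.\<close>
  have "(\<lambda>n. exp (- (e / 3) * real n)) \<longlonglongrightarrow> 0" using e by real_asymp
  then have "\<forall>\<^sub>F n in sequentially. exp (- (e / 3) * real n) < m" using m(2) by (rule order_tendstoD)
  with PQ(1) show ?thesis
  proof eventually_elim
    case (elim n)
    have "ennreal (exp (- real n * (H + e))) = ennreal (exp (- real n * (H + 2 * e / 3)) * exp (- (e / 3) * real n))"
      by (simp add: algebra_simps flip: exp_add)
    also have "\<dots> \<le> ennreal (exp (- real n * (H + 2 * e / 3)) * m)"
      using elim(2) by (intro ennreal_leI) simp
    also have "\<dots> = (\<integral>\<^sup>+ s. ennreal (exp (- real n * (H + 2 * e / 3))) * indicator A s \<partial>lborel)"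
      by (simp add: nn_integral_cmult_indicator m(1) ennreal_mult')
    also have "\<dots> \<le> (\<integral>\<^sup>+ s. ennreal (laplace_weight V n (k n) (b n) s) \<partial>lborel)"
    proof (rule nn_integral_mono)
      fix s
      show "ennreal (exp (- real n * (H + 2 * e / 3))) * indicator A s \<le> ennreal (laplace_weight V n (k n) (b n) s)"
      proof (cases "s \<in> A")
        case True
        then have "V s \<le> v + e / 3" "k n * (s - b n)\<^sup>2 \<le> k0 * (r - b0)\<^sup>2 + e / 3"
          using PQ(3)[OF elim(1), of s] d(2)[of s] by (auto simp: A_def e'_def dist_commute)
        then have "real n * (V s + k n * (s - b n)\<^sup>2) \<le> real n * (H + 2 * e / 3)"
          by (intro mult_left_mono) (auto simp: H_def)
        then show ?thesis using True by (simp add: laplace_weight_def)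
      qed simp
    qed
    finally show ?case by (simp add: H_def)
  qed
qed

section \<open>Laplace's method\<close>

text \<open>The bound is uniform in \<open>s\<close> on the whole line. An additive error alone
  could not achieve this, since a change of \<open>k\<close> changes the quadratic by an unbounded
  amount; hence the lost factor \<open>1 - 2 * e\<close>.\<close>

lemma quadratic_lower_bound:
  fixes k b :: "nat \<Rightarrow> real"
  assumes lim: "k \<longlonglongrightarrow> k0" "b \<longlonglongrightarrow> b0" and k0: "0 < k0" and e: "0 < e" "e < 1"
  shows "\<forall>\<^sub>F n in sequentially. \<forall>s. (1 - 2 * e) * (k0 * (s - b0)\<^sup>2) - e \<le> k n * (s - b n)\<^sup>2"
proof -
  have "(\<lambda>n. k n * (b0 - b n)\<^sup>2 / e) \<longlonglongrightarrow> k0 * (b0 - b0)\<^sup>2 / e"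
    using e by (intro tendsto_intros lim) auto
  then have "\<forall>\<^sub>F n in sequentially. k n * (b0 - b n)\<^sup>2 / e < e"
    using e by (intro order_tendstoD(2)) auto
  moreover have "\<forall>\<^sub>F n in sequentially. (1 - e) * k0 < k n"
    using e k0 by (intro order_tendstoD(1)[OF lim(1)]) auto
  ultimately show ?thesis
  proof eventually_elim
    case (elim n)
    show ?case
    proof
      fix s
      define x y where "x = s - b0" and "y = b0 - b n"
      have "0 \<le> (1 - e) * k0" using e k0 by simp
      then have kn: "0 \<le> k n" using elim(2) by simp
      \<comment> \<open>Young's inequality: the mixed term is absorbed at the price of
        \<open>e * x\<^sup>2\<close> and \<open>y\<^sup>2 / e\<close>, and the latter tends to zero
        with the shift \<open>y\<close> of the field.\<close>
      have "0 \<le> (e * x + y)\<^sup>2 / e" using e by simp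
      also have "\<dots> = e * x\<^sup>2 + 2 * x * y + y\<^sup>2 / e"
        using e by (simp add: power2_eq_square field_simps)
      finally have "(1 - e) * x\<^sup>2 - y\<^sup>2 / e \<le> (x + y)\<^sup>2 - y\<^sup>2"
        by (simp add: power2_eq_square algebra_simps)
      then have "(1 - e) * x\<^sup>2 - y\<^sup>2 / e \<le> (x + y)\<^sup>2" using zero_le_power2[of y] by linarith
      then have "k n * ((1 - e) * x\<^sup>2 - y\<^sup>2 / e) \<le> k n * (x + y)\<^sup>2" using kn by (rule mult_left_mono)
      moreover have "k n * ((1 - e) * x\<^sup>2 - y\<^sup>2 / e) = k n * ((1 - e) * x\<^sup>2) - k n * y\<^sup>2 / e"
        by (simp add: algebra_simps)
      moreover have "k n * y\<^sup>2 / e < e" using elim(1) by (simp add: y_def)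
      moreover have "(1 - e) * k0 * ((1 - e) * x\<^sup>2) \<le> k n * ((1 - e) * x\<^sup>2)"
        using elim(2) e by (intro mult_right_mono) auto
      moreover have "(1 - e) * k0 * ((1 - e) * x\<^sup>2) = (1 - 2 * e) * (k0 * x\<^sup>2) + e\<^sup>2 * (k0 * x\<^sup>2)"
        by (simp add: power2_eq_square algebra_simps)
      moreover have "0 \<le> e\<^sup>2 * (k0 * x\<^sup>2)" using k0 by simp
      moreover have "x + y = s - b n" by (simp add: x_def y_def)
      ultimately show "(1 - 2 * e) * (k0 * (s - b0)\<^sup>2) - e \<le> k n * (s - b n)\<^sup>2"
        by (simp only: x_def)
    qed
  qed
qed

text \<open>A small share \<open>d\<close> of the quadratic is set aside as an integrable Gaussian
  factor. The rest, with a correspondingly reduced share of \<open>V\<close>, is still bounded below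
  by almost \<open>c\<close> on \<open>C\<close>.\<close>

lemma nn_integral_laplace_weight_le:
  assumes V[measurable]: "V \<in> borel_measurable borel" and V_nonneg: "\<And>r. 0 \<le> V r"
    and lim: "k \<longlonglongrightarrow> k0" "b \<longlonglongrightarrow> b0" and k0: "0 < k0"
    and c: "0 \<le> c" and AE: "AE s in lborel. s \<in> C \<longrightarrow> c \<le> V s + k0 * (s - b0)\<^sup>2" and e: "0 < e"
  obtains M where "0 \<le> M" "\<forall>\<^sub>F n in sequentially.
    (\<integral>\<^sup>+ s. ennreal (laplace_weight V n (k n) (b n) s) * indicator C s \<partial>lborel)
      \<le> ennreal (M * exp (- real n * (c - e)))"
proof -
  \<comment> \<open>The exponent loses \<open>d * (3 * c + 1)\<close> in total, which is at most
    \<open>e\<close>; the cap keeps \<open>1 - 3 * d\<close> positive.\<close>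
  define d where "d = min (1 / 4) (e / (3 * c + 1))"
  have d: "0 < d" "d < 1" "3 * d < 1" using e c by (auto simp: d_def)
  have "d * (3 * c + 1) \<le> e / (3 * c + 1) * (3 * c + 1)"
    using c by (intro mult_right_mono) (auto simp: d_def)
  then have dc: "d * (3 * c + 1) \<le> e" using c by simp
  define I where "I = (\<integral>\<^sup>+ s. ennreal (exp (- (d * k0) * (s - b0)\<^sup>2)) \<partial>lborel)"
  have "I < \<infinity>" unfolding I_def using d k0 by (intro nn_integral_gaussian_finite) simp
  then obtain M where M: "I = ennreal M" "0 \<le> M" by (cases I) auto
  have "\<forall>\<^sub>F n in sequentially. \<forall>s. (1 - 2 * d) * (k0 * (s - b0)\<^sup>2) - d \<le> k n * (s - b n)\<^sup>2"
    by (rule quadratic_lower_bound[OF lim k0 d(1,2)])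
  then have "\<forall>\<^sub>F n in sequentially.
    (\<integral>\<^sup>+ s. ennreal (laplace_weight V n (k n) (b n) s) * indicator C s \<partial>lborel)
      \<le> ennreal (M * exp (- real n * (c - e)))"
    using eventually_ge_at_top[of 1]
  proof eventually_elim
    case (elim n)
    have "(\<integral>\<^sup>+ s. ennreal (laplace_weight V n (k n) (b n) s) * indicator C s \<partial>lborel)
      \<le> (\<integral>\<^sup>+ s. ennreal (exp (- real n * (c - e))) * ennreal (exp (- (d * k0) * (s - b0)\<^sup>2)) \<partial>lborel)"
    proof (rule nn_integral_mono_AE, rule AE_mp[OF AE], intro AE_I2 impI)
      fix s assume s: "s \<in> C \<longrightarrow> c \<le> V s + k0 * (s - b0)\<^sup>2"
      show "ennreal (laplace_weight V n (k n) (b n) s) * indicator C s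
        \<le> ennreal (exp (- real n * (c - e))) * ennreal (exp (- (d * k0) * (s - b0)\<^sup>2))"
      proof (cases "s \<in> C")
        case True
        define q where "q = k0 * (s - b0)\<^sup>2"
        have q: "0 \<le> q" using k0 by (simp add: q_def)
        have "(1 - 3 * d) * c \<le> (1 - 3 * d) * (V s + q)"
          using s True d by (intro mult_left_mono) (auto simp: q_def)
        also have "\<dots> \<le> V s + (1 - 3 * d) * q"
          using V_nonneg[of s] d mult_right_mono[of "1 - 3 * d" 1 "V s"] by (simp add: distrib_left)
        finally have "(1 - 3 * d) * c + d * q - d \<le> V s + ((1 - 2 * d) * q - d)"
          by (simp add: algebra_simps)
        also have "\<dots> \<le> V s + k n * (s - b n)\<^sup>2" using elim(1) by (simp add: q_def)
        finally have "c - e + d * q \<le> V s + k n * (s - b n)\<^sup>2"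
          using dc by (simp add: algebra_simps)
        then have "real n * (c - e + d * q) \<le> real n * (V s + k n * (s - b n)\<^sup>2)"
          by (intro mult_left_mono) auto
        \<comment> \<open>\<open>1 \<le> n\<close> trades \<open>n * d * q\<close> for
          \<open>d * q\<close>, so that the Gaussian integral, and with it \<open>M\<close>, is the
          same for all \<open>n\<close>.\<close>
        moreover have "1 * (d * q) \<le> real n * (d * q)"
          using elim(2) d q by (intro mult_right_mono) auto
        ultimately have "real n * (c - e) + d * q \<le> real n * (V s + k n * (s - b n)\<^sup>2)"
          by (simp add: distrib_left)
        then have "laplace_weight V n (k n) (b n) s \<le> exp (- real n * (c - e) + - (d * q))"
          by (simp add: laplace_weight_def)
        also have "\<dots> = exp (- real n * (c - e)) * exp (- (d * k0) * (s - b0)\<^sup>2)"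
          by (subst exp_add) (simp add: q_def mult.assoc)
        finally show ?thesis using True by (simp add: ennreal_leI flip: ennreal_mult)
      qed simp
    qed
    also have "\<dots> = ennreal (exp (- real n * (c - e))) * I"
      unfolding I_def by (subst nn_integral_cmult) auto
    also have "\<dots> = ennreal (M * exp (- real n * (c - e)))"
      using M by (simp add: mult.commute flip: ennreal_mult)
    finally show ?case .
  qed
  then show ?thesis using that M(2) by blast
qed

text \<open>Compactness turns the absence of minimisers over \<open>C\<close> into a definite gap.
  The conclusion is phrased as non-membership at level \<open>c\<close>, the form in which
  \<open>AE_ge_if_not_ess_epigraph\<close> takes it.\<close>

lemma gap_above_minimum:
  assumes S: "closed S" and nonneg: "\<And>r v. (r, v) \<in> S \<Longrightarrow> 0 \<le> v" and k: "0 < k" and C: "closed C"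
    and x0: "(r0, v0) \<in> argmin_pairs S k b" and disj: "\<And>x. x \<in> argmin_pairs S k b \<Longrightarrow> fst x \<notin> C"
  obtains c where "v0 + k * (r0 - b)\<^sup>2 < c" "\<And>r. r \<in> C \<Longrightarrow> (r, c - k * (r - b)\<^sup>2) \<notin> S"
proof -
  define H where "H = (\<lambda>x::real \<times> real. snd x + k * (fst x - b)\<^sup>2)"
  define m where "m = v0 + k * (r0 - b)\<^sup>2"
  have H: "continuous_on A H" for A unfolding H_def by (intro continuous_intros)
  have m_le: "m \<le> H y" if "y \<in> S" for y
    using x0 that by (auto simp: argmin_pairs_def m_def H_def)
  have m_less: "m < H y" if y: "y \<in> S" "fst y \<in> C" for y
  proof (rule ccontr)
    assume "\<not> m < H y"
    then have "H y \<le> H z" if "z \<in> S" for z using m_le[OF that] by linarith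
    then have "y \<in> argmin_pairs S k b" using y(1) by (auto simp: argmin_pairs_def H_def)
    then show False using disj y(2) by blast
  qed
  \<comment> \<open>Truncating at \<open>m + 1\<close> gives a compact set, on which
    \<open>H\<close> attains a minimum above \<open>m\<close>. If nothing is left, the level
    \<open>m + 1\<close> itself serves.\<close>
  define D where "D = S \<inter> (C \<times> UNIV) \<inter> {x. H x \<le> m + 1}"
  show ?thesis
  proof (cases "D = {}")
    case True
    then have "(r, m + 1 - k * (r - b)\<^sup>2) \<notin> S" if "r \<in> C" for r
      using that by (auto simp: D_def H_def)
    then show ?thesis using that[of "m + 1"] by (simp add: m_def)
  next
    case False
    have "D \<subseteq> {(r, v). 0 \<le> v \<and> v + k * (r - b)\<^sup>2 \<le> m + 1}"
      unfolding D_def H_def using nonneg by auto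
    then have "bounded D" using bounded_sublevel[OF k] bounded_subset by blast
    moreover have "closed D" unfolding D_def
      by (intro closed_Int S closed_Times C closed_UNIV closed_Collect_le H continuous_on_const)
    ultimately have "compact D" by (simp add: compact_eq_bounded_closed)
    then have "\<exists>x\<in>D. \<forall>y\<in>D. H x \<le> H y" by (rule continuous_attains_inf[OF _ False H])
    then obtain x where x: "x \<in> D" "\<And>y. y \<in> D \<Longrightarrow> H x \<le> H y" by blast
    define c where "c = (m + H x) / 2"
    have "m < H x" "H x \<le> m + 1" using x(1) m_less[of x] by (auto simp: D_def)
    then have c: "m < c" "c < H x" "c \<le> m + 1" by (auto simp: c_def)
    have "(r, c - k * (r - b)\<^sup>2) \<notin> S" if "r \<in> C" for r
      using x(2)[of "(r, c - k * (r - b)\<^sup>2)"] that c(2,3) by (auto simp: D_def H_def)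
    then show ?thesis using that[of c] c(1) by (simp add: m_def)
  qed
qed

text \<open>The mass over \<open>C\<close> decays at a rate near \<open>c\<close>, the total mass at
  a rate near the minimum \<open>m\<close>, and \<open>m < c\<close>.\<close>

lemma laplace_weight_concentration:
  assumes V[measurable]: "V \<in> borel_measurable borel" and V_nonneg: "\<And>r. 0 \<le> V r"
    and lim: "k \<longlonglongrightarrow> k0" "b \<longlonglongrightarrow> b0" and k0: "0 < k0"
    and C: "closed C" and disj: "\<And>x. x \<in> argmin_pairs (ess_epigraph V) k0 b0 \<Longrightarrow> fst x \<notin> C"
    and e: "0 < e"
  shows "\<forall>\<^sub>F n in sequentially.
    (\<integral>\<^sup>+ s. ennreal (laplace_weight V n (k n) (b n) s) * indicator C s \<partial>lborel)
      \<le> ennreal e * (\<integral>\<^sup>+ s. ennreal (laplace_weight V n (k n) (b n) s) \<partial>lborel)"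
proof -
  let ?S = "ess_epigraph V"
  have nonneg: "0 \<le> v" if "(r, v) \<in> ?S" for r v
    using V_nonneg that by (rule ess_epigraph_nonneg)
  have "argmin_pairs ?S k0 b0 \<noteq> {}"
    by (rule argmin_pairs_nonempty[OF closed_ess_epigraph[OF V] ess_epigraph_nonempty[OF V] nonneg k0])
  then obtain r0 v0 where x0: "(r0, v0) \<in> argmin_pairs ?S k0 b0" by auto
  then have in_S: "(r0, v0) \<in> ?S" by (auto simp: argmin_pairs_def)
  define m where "m = v0 + k0 * (r0 - b0)\<^sup>2"
  have m: "0 \<le> m" using nonneg[OF in_S] k0 by (simp add: m_def)
  obtain c where c: "m < c" "\<And>r. r \<in> C \<Longrightarrow> (r, c - k0 * (r - b0)\<^sup>2) \<notin> ?S"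
    unfolding m_def by (rule gap_above_minimum[OF closed_ess_epigraph[OF V] nonneg k0 C x0 disj]) blast+
  have AE: "AE s in lborel. s \<in> C \<longrightarrow> c \<le> V s + k0 * (s - b0)\<^sup>2"
    by (intro AE_ge_if_not_ess_epigraph V c(2) continuous_intros)
  have c0: "0 \<le> c" using c(1) m by simp
  \<comment> \<open>One third of the gap is lost in each of the two Laplace bounds; the last third
    makes the quotient of the masses decay like \<open>M * exp (- d * real n)\<close>.\<close>
  define d where "d = (c - m) / 3"
  have d: "0 < d" "c - d = m + 2 * d" using c(1) by (auto simp: d_def field_simps)
  obtain M where M: "0 \<le> M" "\<forall>\<^sub>F n in sequentially.
    (\<integral>\<^sup>+ s. ennreal (laplace_weight V n (k n) (b n) s) * indicator C s \<partial>lborel)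
      \<le> ennreal (M * exp (- real n * (c - d)))"
    using nn_integral_laplace_weight_le[OF V V_nonneg lim k0 c0 AE d(1)] .
  have "(\<lambda>n. M * exp (- d * real n)) \<longlonglongrightarrow> M * 0" using d by (intro tendsto_mult tendsto_const) real_asymp
  then have "\<forall>\<^sub>F n in sequentially. M * exp (- d * real n) < e" using e by (intro order_tendstoD) auto
  with M(2) nn_integral_laplace_weight_ge[OF V lim in_S d(1)] show ?thesis
  proof eventually_elim
    case (elim n)
    note elim(1)
    also have "ennreal (M * exp (- real n * (c - d))) = ennreal (M * exp (- d * real n) * exp (- real n * (m + d)))"
    proof -
      have "- real n * (c - d) = - d * real n + - real n * (m + d)"
        unfolding d(2) by (simp add: algebra_simps)
      then show ?thesis by (simp only: exp_add mult.assoc)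
    qed
    also have "\<dots> \<le> ennreal (e * exp (- real n * (m + d)))"
      using elim(3) by (intro ennreal_leI mult_right_mono) auto
    also have "\<dots> = ennreal e * ennreal (exp (- real n * (m + d)))" using e by (simp add: ennreal_mult)
    also have "\<dots> \<le> ennreal e * (\<integral>\<^sup>+ s. ennreal (laplace_weight V n (k n) (b n) s) \<partial>lborel)"
      using elim(2) by (intro mult_left_mono) (auto simp: m_def add.assoc)
    finally show ?case .
  qed
qed

text \<open>The normaliser is infinite for \<open>n = 0\<close>, where the weight is constant and
  division in \<open>ennreal\<close> yields the zero density. It is a probability measure for
  \<open>0 < n\<close> and \<open>0 < k\<close>, hence eventually along the sequences
  considered.\<close>

definition gibbs_measure :: "(real \<Rightarrow> real) \<Rightarrow> nat \<Rightarrow> real \<Rightarrow> real \<Rightarrow> real measure" where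
  "gibbs_measure V n k b = density lborel
     (\<lambda>r. ennreal (laplace_weight V n k b r) / (\<integral>\<^sup>+ s. ennreal (laplace_weight V n k b s) \<partial>lborel))"

lemma sets_gibbs_measure [simp, measurable_cong]: "sets (gibbs_measure V n k b) = sets borel"
  by (simp add: gibbs_measure_def)

lemma laplace_weight_normaliser:
  assumes V[measurable]: "V \<in> borel_measurable borel" and V_nonneg: "\<And>r. 0 \<le> V r"
    and n: "0 < n" and k: "0 < k"
  shows "0 < (\<integral>\<^sup>+ s. ennreal (laplace_weight V n k b s) \<partial>lborel)"
    and "(\<integral>\<^sup>+ s. ennreal (laplace_weight V n k b s) \<partial>lborel) < \<infinity>"
proof -
  have "(\<integral>\<^sup>+ s. ennreal (laplace_weight V n k b s) \<partial>lborel) \<noteq> 0"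
  proof
    assume "(\<integral>\<^sup>+ s. ennreal (laplace_weight V n k b s) \<partial>lborel) = 0"
    then have "AE s in lborel. ennreal (laplace_weight V n k b s) = 0"
      by (subst (asm) nn_integral_0_iff_AE) auto
    then have "eventually (\<lambda>s :: real. False) (ae_filter lborel)"
      by (simp add: laplace_weight_def)
    from AE_E2[OF this] show False by simp
  qed
  then show "0 < (\<integral>\<^sup>+ s. ennreal (laplace_weight V n k b s) \<partial>lborel)" by (simp add: zero_less_iff_neq_zero)
  have "(\<integral>\<^sup>+ s. ennreal (laplace_weight V n k b s) \<partial>lborel)
      \<le> (\<integral>\<^sup>+ s. ennreal (exp (- (real n * k) * (s - b)\<^sup>2)) \<partial>lborel)"
    using V_nonneg by (intro nn_integral_mono ennreal_leI) (simp add: laplace_weight_def distrib_left)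
  also have "\<dots> < \<infinity>" using n k by (intro nn_integral_gaussian_finite) simp
  finally show "(\<integral>\<^sup>+ s. ennreal (laplace_weight V n k b s) \<partial>lborel) < \<infinity>" .
qed

lemma nn_integral_gibbs_measure:
  assumes [measurable]: "V \<in> borel_measurable borel" "f \<in> borel_measurable borel"
  shows "(\<integral>\<^sup>+ r. f r \<partial>gibbs_measure V n k b) =
    (\<integral>\<^sup>+ r. ennreal (laplace_weight V n k b r) * f r \<partial>lborel) /
    (\<integral>\<^sup>+ s. ennreal (laplace_weight V n k b s) \<partial>lborel)"
  unfolding gibbs_measure_def
  by (subst nn_integral_density)
     (auto simp: divide_ennreal_def nn_integral_multc mult.assoc mult.left_commute mult.commute
       simp flip: nn_integral_cmult)

lemma emeasure_gibbs_measure: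
  assumes [measurable]: "V \<in> borel_measurable borel" "C \<in> sets borel"
  shows "emeasure (gibbs_measure V n k b) C =
    (\<integral>\<^sup>+ r. ennreal (laplace_weight V n k b r) * indicator C r \<partial>lborel) /
    (\<integral>\<^sup>+ s. ennreal (laplace_weight V n k b s) \<partial>lborel)"
  using nn_integral_gibbs_measure[of V "indicator C" n k b] by simp

lemma prob_space_gibbs_measure:
  assumes V[measurable]: "V \<in> borel_measurable borel" and V_nonneg: "\<And>r. 0 \<le> V r"
    and n: "0 < n" and k: "0 < k"
  shows "prob_space (gibbs_measure V n k b)"
proof
  have "space (gibbs_measure V n k b) = UNIV" by (simp add: gibbs_measure_def)
  then show "emeasure (gibbs_measure V n k b) (space (gibbs_measure V n k b)) = 1"
    using laplace_weight_normaliser[OF assms, of b]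
    by (simp add: emeasure_gibbs_measure ennreal_divide_self less_top)
qed

text \<open>For large \<open>n\<close>, the function \<open>a - K * indicator C\<close> lies below
  \<open>g n\<close>, and its integral is \<open>a\<close> minus \<open>K\<close> times the
  vanishing mass of \<open>C\<close>.\<close>

lemma gibbs_measure_integral_ge:
  fixes g :: "nat \<Rightarrow> real \<Rightarrow> real"
  assumes V[measurable]: "V \<in> borel_measurable borel" and V_nonneg: "\<And>r. 0 \<le> V r"
    and lim: "k \<longlonglongrightarrow> k0" "b \<longlonglongrightarrow> b0" and k0: "0 < k0"
    and C: "closed C" and disj: "\<And>x. x \<in> argmin_pairs (ess_epigraph V) k0 b0 \<Longrightarrow> fst x \<notin> C"
    and g[measurable]: "\<And>n. g n \<in> borel_measurable borel" and bound: "\<And>n r. \<bar>g n r\<bar> \<le> B"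
    and ge: "\<forall>\<^sub>F n in sequentially. \<forall>r. r \<notin> C \<longrightarrow> a \<le> g n r" and e: "0 < e"
  shows "\<forall>\<^sub>F n in sequentially. a - e \<le> (LINT r|gibbs_measure V n (k n) (b n). g n r)"
proof -
  \<comment> \<open>Chosen so that \<open>a - K \<le> - B\<close> on \<open>C\<close>, where only
    the uniform bound on \<open>g n\<close> is available; the summand 1 makes \<open>K\<close>
    positive.\<close>
  define K where "K = \<bar>a\<bar> + B + 1"
  have B: "0 \<le> B" using bound[of 0 0] by (meson abs_ge_zero order_trans)
  then have K: "0 < K" by (simp add: K_def)
  have [measurable]: "C \<in> sets borel" using C by (rule borel_closed)
  have "0 < e / K" using e K by simp
  then have "\<forall>\<^sub>F n in sequentially.
    (\<integral>\<^sup>+ s. ennreal (laplace_weight V n (k n) (b n) s) * indicator C s \<partial>lborel)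
      \<le> ennreal (e / K) * (\<integral>\<^sup>+ s. ennreal (laplace_weight V n (k n) (b n) s) \<partial>lborel)"
    by (intro laplace_weight_concentration[OF V V_nonneg lim k0 C] disj)
  moreover have "\<forall>\<^sub>F n in sequentially. 0 < k n" using k0 by (intro order_tendstoD(1)[OF lim(1)])
  ultimately show ?thesis using ge eventually_gt_at_top[of 0]
  proof eventually_elim
    case (elim n)
    let ?M = "gibbs_measure V n (k n) (b n)"
    interpret prob_space ?M by (intro prob_space_gibbs_measure V V_nonneg elim)
    note norm = laplace_weight_normaliser[OF V V_nonneg elim(4,2), of "b n"]
    have "emeasure ?M C \<le> ennreal (e / K)"
      unfolding emeasure_gibbs_measure[OF V \<open>C \<in> sets borel\<close>]
      using elim(1) norm by (intro divide_le_posI_ennreal) (auto simp: mult.commute)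
    then have "prob C \<le> e / K" using e K by (simp add: emeasure_eq_measure)
    then have "K * prob C \<le> e" using K by (simp add: pos_le_divide_eq mult.commute)
    then have "a - e \<le> a - K * prob C" by simp
    also have "\<dots> = (LINT r|?M. a - K * indicator C r)"
      by (subst Bochner_Integration.integral_diff) (auto simp: prob_space emeasure_eq_measure)
    also have "\<dots> \<le> (LINT r|?M. g n r)"
    proof (rule integral_mono)
      show "integrable ?M (g n)" using bound by (intro integrable_const_bound[of _ B]) auto
      show "a - K * indicator C r \<le> g n r" for r
        using elim(3) bound[of n r] by (cases "r \<in> C") (auto simp: K_def)
    qed (auto simp: emeasure_eq_measure)
    finally show ?case .
  qed
qed

lemma gibbs_measure_integral_le:
  fixes g :: "nat \<Rightarrow> real \<Rightarrow> real"
  assumes V: "V \<in> borel_measurable borel" and V_nonneg: "\<And>r. 0 \<le> V r"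
    and lim: "k \<longlonglongrightarrow> k0" "b \<longlonglongrightarrow> b0" and k0: "0 < k0"
    and C: "closed C" and disj: "\<And>x. x \<in> argmin_pairs (ess_epigraph V) k0 b0 \<Longrightarrow> fst x \<notin> C"
    and g[measurable]: "\<And>n. g n \<in> borel_measurable borel" and bound: "\<And>n r. \<bar>g n r\<bar> \<le> B"
    and le: "\<forall>\<^sub>F n in sequentially. \<forall>r. r \<notin> C \<longrightarrow> g n r \<le> a" and e: "0 < e"
  shows "\<forall>\<^sub>F n in sequentially. (LINT r|gibbs_measure V n (k n) (b n). g n r) \<le> a + e"
proof -
  have "\<forall>\<^sub>F n in sequentially. - a - e \<le> (LINT r|gibbs_measure V n (k n) (b n). - g n r)"
    using bound le by (intro gibbs_measure_integral_ge[OF V V_nonneg lim k0 C disj _ _ _ e, of _ B]) auto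
  then show ?thesis by eventually_elim simp
qed

text \<open>The mass concentrates near \<open>r0\<close>, and the joint limit along the product
  filter controls \<open>g n r\<close> there for all large \<open>n\<close> at once. The exceptional
  closed set is the complement of a neighbourhood of \<open>r0\<close>.\<close>

lemma gibbs_measure_integral_tendsto:
  fixes g :: "nat \<Rightarrow> real \<Rightarrow> real"
  assumes V: "V \<in> borel_measurable borel" and V_nonneg: "\<And>r. 0 \<le> V r"
    and lim: "k \<longlonglongrightarrow> k0" "b \<longlonglongrightarrow> b0" and k0: "0 < k0"
    and unique: "\<And>x. x \<in> argmin_pairs (ess_epigraph V) k0 b0 \<Longrightarrow> fst x = r0"
    and g[measurable]: "\<And>n. g n \<in> borel_measurable borel" and bound: "\<And>n r. \<bar>g n r\<bar> \<le> B"
    and g_lim: "((\<lambda>(n, r). g n r) \<longlongrightarrow> L) (sequentially \<times>\<^sub>F nhds r0)"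
  shows "(\<lambda>n. LINT r|gibbs_measure V n (k n) (b n). g n r) \<longlonglongrightarrow> L"
proof (rule tendstoI)
  fix e :: real assume e: "0 < e"
  have "\<forall>\<^sub>F p in sequentially \<times>\<^sub>F nhds r0. dist (case p of (n, r) \<Rightarrow> g n r) L < e / 3"
    using e by (intro tendstoD[OF g_lim]) simp
  then obtain P Q where PQ: "eventually P sequentially" "eventually Q (nhds r0)"
      "\<And>n r. P n \<Longrightarrow> Q r \<Longrightarrow> dist (g n r) L < e / 3"
    unfolding eventually_prod_filter by auto
  obtain U where U: "open U" "r0 \<in> U" "\<And>r. r \<in> U \<Longrightarrow> Q r"
    using PQ(2) unfolding eventually_nhds by blast
  have C: "closed (- U)" using U(1) by (simp add: closed_Compl)
  have disj: "fst x \<notin> - U" if "x \<in> argmin_pairs (ess_epigraph V) k0 b0" for x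
    using unique[OF that] U(2) by simp
  have near: "\<forall>\<^sub>F n in sequentially. \<forall>r. r \<notin> - U \<longrightarrow> L - e / 3 \<le> g n r \<and> g n r \<le> L + e / 3"
    using PQ(1)
  proof eventually_elim
    case (elim n)
    have "\<bar>g n r - L\<bar> < e / 3" if "r \<in> U" for r
      using PQ(3)[OF elim U(3)[OF that]] by (simp only: dist_real_def)
    then show ?case by (force simp only: Compl_iff abs_less_iff not_not dest: less_imp_le)
  qed
  have "\<forall>\<^sub>F n in sequentially. L - e / 3 - e / 3 \<le> (LINT r|gibbs_measure V n (k n) (b n). g n r)"
  proof (rule gibbs_measure_integral_ge[OF V V_nonneg lim k0 C disj g bound])
    show "\<forall>\<^sub>F n in sequentially. \<forall>r. r \<notin> - U \<longrightarrow> L - e / 3 \<le> g n r"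
      using near by eventually_elim blast
  qed (use e in auto)
  moreover have "\<forall>\<^sub>F n in sequentially. (LINT r|gibbs_measure V n (k n) (b n). g n r) \<le> L + e / 3 + e / 3"
  proof (rule gibbs_measure_integral_le[OF V V_nonneg lim k0 C disj g bound])
    show "\<forall>\<^sub>F n in sequentially. \<forall>r. r \<notin> - U \<longrightarrow> g n r \<le> L + e / 3"
      using near by eventually_elim blast
  qed (use e in auto)
  ultimately show "\<forall>\<^sub>F n in sequentially. dist (LINT r|gibbs_measure V n (k n) (b n). g n r) L < e"
    by eventually_elim (use e in \<open>auto simp: dist_real_def abs_less_iff\<close>)
qed

section \<open>Normal distributions\<close>

abbreviation normal_measure :: "real \<Rightarrow> real \<Rightarrow> real measure" where
  "normal_measure m s \<equiv> density lborel (normal_density m s)"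

text \<open>Standardising moves both parameters from the measure into the argument of
  \<open>f\<close>, so that continuity of \<open>f\<close> and dominated convergence can act on
  them.\<close>

lemma integral_normal_measure:
  assumes s: "0 < s" and f[measurable]: "f \<in> borel_measurable borel"
  shows "(LINT x|normal_measure m s. f x) = (LINT x|lborel. std_normal_density x * f (m + s * x))"
proof -
  have "(LINT x|normal_measure m s. f x) = (LINT x|lborel. normal_density m s x * f x)"
    by (subst integral_density) auto
  also have "\<dots> = s * (LINT x|lborel. normal_density m s (m + s * x) * f (m + s * x))"
    using s by (subst lborel_integral_real_affine[of s _ m]) auto
  also have "\<dots> = (LINT x|lborel. s * (normal_density m s (m + s * x) * f (m + s * x)))"
    by simp
  also have "\<dots> = (LINT x|lborel. std_normal_density x * f (m + s * x))"
    using s by (simp add: normal_density_def real_sqrt_mult power_mult_distrib)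
  finally show ?thesis .
qed

lemma integral_normal_measure_tendsto:
  assumes f: "continuous_on UNIV f" and bound: "\<And>x. \<bar>f x\<bar> \<le> (B::real)"
    and m: "(m \<longlongrightarrow> m0) F" and s: "(s \<longlongrightarrow> s0) F" and s0: "0 < s0"
  shows "((\<lambda>p. LINT x|normal_measure (m p) (s p). f x) \<longlongrightarrow> (LINT x|normal_measure m0 s0. f x)) F"
proof -
  have [measurable]: "f \<in> borel_measurable borel" using f by (rule borel_measurable_continuous_onI)
  \<comment> \<open>Dominated convergence speaks of sequences only. It gives continuity of
    \<open>\<Theta>\<close> at one point of the plane, and composition then handles the arbitrary
    filter \<open>F\<close>; \<open>\<Theta>\<close> is matched with the normal integrals where the
    deviation is positive.\<close>
  define \<Theta> where "\<Theta> = (\<lambda>p :: real \<times> real. LINT x|lborel. std_normal_density x * f (fst p + snd p * x))"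
  have "isCont \<Theta> (m0, s0)"
    unfolding continuous_at_sequentially comp_def
  proof (intro allI impI)
    fix u :: "nat \<Rightarrow> real \<times> real" assume u: "u \<longlonglongrightarrow> (m0, s0)"
    show "(\<lambda>n. \<Theta> (u n)) \<longlonglongrightarrow> \<Theta> (m0, s0)"
      unfolding \<Theta>_def
    proof (rule integral_dominated_convergence)
      show "integrable lborel (\<lambda>x. B * std_normal_density x)" by simp
      have "isCont f y" for y using f by (simp add: continuous_on_eq_continuous_at)
      then have "(\<lambda>n. f (fst (u n) + snd (u n) * x)) \<longlonglongrightarrow> f (fst (m0, s0) + snd (m0, s0) * x)" for x
        by (rule isCont_tendsto_compose) (intro tendsto_intros u)
      then show "AE x in lborel. (\<lambda>n. std_normal_density x * f (fst (u n) + snd (u n) * x))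
          \<longlonglongrightarrow> std_normal_density x * f (fst (m0, s0) + snd (m0, s0) * x)"
        by (intro AE_I2 tendsto_mult tendsto_const)
      show "AE x in lborel. norm (std_normal_density x * f (fst (u n) + snd (u n) * x)) \<le> B * std_normal_density x" for n
        using bound by (auto simp: abs_mult mult.commute[of B] intro!: mult_left_mono)
    qed auto
  qed
  then have "((\<lambda>p. \<Theta> (m p, s p)) \<longlongrightarrow> \<Theta> (m0, s0)) F"
    by (rule isCont_tendsto_compose) (intro tendsto_Pair m s)
  moreover have "\<forall>\<^sub>F p in F. \<Theta> (m p, s p) = (LINT x|normal_measure (m p) (s p). f x)"
    using order_tendstoD(1)[OF s s0]
    by eventually_elim (simp add: \<Theta>_def integral_normal_measure)
  moreover have "\<Theta> (m0, s0) = (LINT x|normal_measure m0 s0. f x)"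
    using s0 by (simp add: \<Theta>_def integral_normal_measure)
  ultimately show ?thesis using tendsto_cong by fastforce
qed

text \<open>Both laws are coupled through the same standard normal variable \<open>x\<close>:
  pointwise, \<open>m + s * x < m' + s * x\<close>.\<close>

lemma integral_normal_measure_strict_mono:
  assumes f: "continuous_on UNIV f" "strict_mono f" and bound: "\<And>x. \<bar>f x\<bar> \<le> (B::real)"
    and s: "0 < s" and less: "m < m'"
  shows "(LINT x|normal_measure m s. f x) < (LINT x|normal_measure m' s. f x)"
proof -
  have [measurable]: "f \<in> borel_measurable borel" using f(1) by (rule borel_measurable_continuous_onI)
  interpret prob_space "normal_measure 0 1" by (rule prob_space_normal_density) simp
  have eq: "(LINT x|normal_measure l s. f x) = (LINT x|normal_measure 0 1. f (l + s * x))" for l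
    using s by (simp add: integral_normal_measure)
  show ?thesis
    unfolding eq
  proof (rule integral_less_AE_space)
    show "integrable (normal_measure 0 1) (\<lambda>x. f (m + s * x))"
      "integrable (normal_measure 0 1) (\<lambda>x. f (m' + s * x))"
      using bound by (auto intro!: integrable_const_bound[of _ B])
    show "AE x in normal_measure 0 1. f (m + s * x) < f (m' + s * x)"
      using less f(2) by (auto simp: strict_mono_less)
    show "emeasure (normal_measure 0 1) (space (normal_measure 0 1)) \<noteq> 0"
      by (simp add: emeasure_space_1 del: space_density)
  qed
qed

lemma normal_density_bayes:
  assumes A: "0 < A" and B: "0 < B" and \<tau>: "\<tau> = B + p\<^sup>2 * A"
  shows "normal_density \<mu> (sqrt A) x * normal_density (p * x + q) (sqrt B) y =
    normal_density (p * \<mu> + q) (sqrt \<tau>) y *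
    normal_density (\<mu> + p * A * (y - p * \<mu> - q) / \<tau>) (sqrt (A * B / \<tau>)) x"
proof -
  have \<tau>0: "0 < \<tau>" using A B by (simp add: \<tau> add_pos_nonneg)
  have const: "1 / sqrt (2 * pi * A) * (1 / sqrt (2 * pi * B)) = 1 / sqrt (2 * pi * \<tau>) * (1 / sqrt (2 * pi * (A * B / \<tau>)))"
    using A B \<tau>0 by (simp flip: real_sqrt_mult real_sqrt_divide)
  define u v where "u = x - \<mu>" and "v = y - p * \<mu> - q"
  \<comment> \<open>Completing the square in \<open>u\<close>, multiplied by the common denominator
    of the exponents.\<close>
  have "(v - p * u)\<^sup>2 * A * \<tau> + u\<^sup>2 * B * \<tau> = v\<^sup>2 * (A * B) + (\<tau> * u - p * A * v)\<^sup>2"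
    unfolding \<tau> by (simp add: power2_eq_square algebra_simps)
  then have "u\<^sup>2 / (2 * A) + (v - p * u)\<^sup>2 / (2 * B) = v\<^sup>2 / (2 * \<tau>) + (u - p * A * v / \<tau>)\<^sup>2 / (2 * (A * B / \<tau>))"
  proof -
    have "u\<^sup>2 / (2 * A) = u\<^sup>2 * B * \<tau> / (2 * A * B * \<tau>)"
      "(v - p * u)\<^sup>2 / (2 * B) = (v - p * u)\<^sup>2 * A * \<tau> / (2 * A * B * \<tau>)"
      "v\<^sup>2 / (2 * \<tau>) = v\<^sup>2 * (A * B) / (2 * A * B * \<tau>)"
      using A B \<tau>0 by simp_all
    moreover have "(u - p * A * v / \<tau>)\<^sup>2 / (2 * (A * B / \<tau>)) = (\<tau> * u - p * A * v)\<^sup>2 / (2 * A * B * \<tau>)"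
    proof -
      have "u - p * A * v / \<tau> = (\<tau> * u - p * A * v) / \<tau>" using \<tau>0 by (simp add: diff_divide_distrib)
      then show ?thesis using \<tau>0 by (simp add: power_divide power2_eq_square)
    qed
    moreover assume "(v - p * u)\<^sup>2 * A * \<tau> + u\<^sup>2 * B * \<tau> = v\<^sup>2 * (A * B) + (\<tau> * u - p * A * v)\<^sup>2"
    ultimately show ?thesis by (simp only: add_divide_distrib[symmetric] add.commute)
  qed
  then have "- u\<^sup>2 / (2 * A) + - (v - p * u)\<^sup>2 / (2 * B) = - v\<^sup>2 / (2 * \<tau>) + - (u - p * A * v / \<tau>)\<^sup>2 / (2 * (A * B / \<tau>))"
    by linarith
  then have exps: "exp (- u\<^sup>2 / (2 * A)) * exp (- (v - p * u)\<^sup>2 / (2 * B)) =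
      exp (- v\<^sup>2 / (2 * \<tau>)) * exp (- (u - p * A * v / \<tau>)\<^sup>2 / (2 * (A * B / \<tau>)))"
    by (simp only: exp_add[symmetric])
  have "normal_density \<mu> (sqrt A) x * normal_density (p * x + q) (sqrt B) y =
    (1 / sqrt (2 * pi * A) * (1 / sqrt (2 * pi * B))) * (exp (- u\<^sup>2 / (2 * A)) * exp (- (v - p * u)\<^sup>2 / (2 * B)))"
    using A B by (simp add: normal_density_def u_def v_def algebra_simps)
  also have "\<dots> = normal_density (p * \<mu> + q) (sqrt \<tau>) y *
    normal_density (\<mu> + p * A * (y - p * \<mu> - q) / \<tau>) (sqrt (A * B / \<tau>)) x"
    unfolding const exps using A B \<tau>0 by (simp add: normal_density_def u_def v_def algebra_simps)
  finally show ?thesis .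
qed

section \<open>The time-evolved measures\<close>

interpretation lborel_Rn: product_sigma_finite "\<lambda>_ :: nat. lborel :: real measure" ..

abbreviation lborel_Rn :: "nat \<Rightarrow> (nat \<Rightarrow> real) measure" where
  "lborel_Rn n \<equiv> (\<Pi>\<^sub>M i\<in>{1..n}. lborel)"

lemma sets_lborel_Rn [measurable_cong]: "sets (lborel_Rn n) = sets (borel_Rn n)"
  by (intro sets_PiM_cong) auto

definition normal_density_Rn :: "nat \<Rightarrow> (nat \<Rightarrow> real) \<Rightarrow> real \<Rightarrow> (nat \<Rightarrow> real) \<Rightarrow> ennreal" where
  "normal_density_Rn n v t x = (\<Prod>i=1..n. ennreal (normal_density (v i) (sqrt t) (x i)))"

lemma measurable_normal_density_Rn_pair:
  assumes a: "a \<in> borel_measurable M" and f: "f \<in> M \<rightarrow>\<^sub>M borel_Rn n" and g: "g \<in> M \<rightarrow>\<^sub>M borel_Rn n"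
  shows "(\<lambda>p. normal_density_Rn n (f p) (a p) (g p)) \<in> borel_measurable M"
  unfolding normal_density_Rn_def
proof (rule borel_measurable_prod_ennreal)
  fix i assume i: "i \<in> {1..n}"
  have [measurable]: "(\<lambda>p. f p i) \<in> borel_measurable M" "(\<lambda>p. g p i) \<in> borel_measurable M"
    using measurable_compose[OF f measurable_component_singleton[OF i]]
      measurable_compose[OF g measurable_component_singleton[OF i]] by auto
  note [measurable] = a
  show "(\<lambda>p. ennreal (normal_density (f p i) (sqrt (a p)) (g p i))) \<in> borel_measurable M"
    unfolding normal_density_def by measurable
qed

lemma measurable_normal_density_Rn [measurable]:
  "normal_density_Rn n v t \<in> borel_measurable (borel_Rn n)"
  unfolding normal_density_Rn_def
proof (rule borel_measurable_prod_ennreal)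
  fix i assume i: "i \<in> {1..n}"
  have [measurable]: "(\<lambda>x. x i) \<in> borel_Rn n \<rightarrow>\<^sub>M borel"
    using i by (rule measurable_component_singleton)
  show "(\<lambda>x. ennreal (normal_density (v i) (sqrt t) (x i))) \<in> borel_measurable (borel_Rn n)"
    by measurable
qed

lemma measurable_normal_density_Rn_lborel [measurable]:
  "normal_density_Rn n v t \<in> borel_measurable (lborel_Rn n)"
  using measurable_normal_density_Rn measurable_cong_sets[OF sets_lborel_Rn refl] by blast

lemma normal_Rn_eq_density:
  assumes t: "0 < t"
  shows "normal_Rn n v t = density (lborel_Rn n) (normal_density_Rn n v t)"
proof -
  interpret N: product_sigma_finite "\<lambda>i. normal_measure (v i) (sqrt t)"
    using t by (auto simp: product_sigma_finite_def intro!: prob_space_imp_sigma_finite prob_space_normal_density)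
  have "density (lborel_Rn n) (normal_density_Rn n v t) = (\<Pi>\<^sub>M i\<in>{1..n}. normal_measure (v i) (sqrt t))"
  proof (rule N.PiM_eqI)
    show "sets (density (lborel_Rn n) (normal_density_Rn n v t)) = sets (\<Pi>\<^sub>M i\<in>{1..n}. normal_measure (v i) (sqrt t))"
      unfolding sets_density by (intro sets_PiM_cong) auto
    fix A assume A: "\<And>i. i \<in> {1..n} \<Longrightarrow> A i \<in> sets (normal_measure (v i) (sqrt t))"
    have A': "Pi\<^sub>E {1..n} A \<in> sets (lborel_Rn n)" using A by (intro sets_PiM_I_finite) auto
    have "emeasure (density (lborel_Rn n) (normal_density_Rn n v t)) (Pi\<^sub>E {1..n} A)
      = (\<integral>\<^sup>+ x. normal_density_Rn n v t x * indicator (Pi\<^sub>E {1..n} A) x \<partial>lborel_Rn n)"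
      by (rule emeasure_density[OF measurable_normal_density_Rn_lborel A'])
    also have "\<dots> = (\<integral>\<^sup>+ x. (\<Prod>i=1..n. ennreal (normal_density (v i) (sqrt t) (x i)) * indicator (A i) (x i)) \<partial>lborel_Rn n)"
    proof (rule nn_integral_cong)
      fix x assume x: "x \<in> space (lborel_Rn n)"
      show "normal_density_Rn n v t x * indicator (Pi\<^sub>E {1..n} A) x =
        (\<Prod>i=1..n. ennreal (normal_density (v i) (sqrt t) (x i)) * indicator (A i) (x i))"
      proof (cases "x \<in> Pi\<^sub>E {1..n} A")
        case True
        then show ?thesis by (auto simp: normal_density_Rn_def PiE_iff intro!: prod.cong)
      next
        case False
        then obtain i where "i \<in> {1..n}" "x i \<notin> A i" using x by (auto simp: space_PiM PiE_iff)
        then have "(\<Prod>i=1..n. ennreal (normal_density (v i) (sqrt t) (x i)) * indicator (A i) (x i)) = 0"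
          by (intro prod_zero) (auto intro!: bexI[of _ i])
        then show ?thesis using False by simp
      qed
    qed
    also have "\<dots> = (\<Prod>i=1..n. \<integral>\<^sup>+ x. ennreal (normal_density (v i) (sqrt t) x) * indicator (A i) x \<partial>lborel)"
      using A by (intro lborel_Rn.product_nn_integral_prod) auto
    also have "\<dots> = (\<Prod>i=1..n. emeasure (normal_measure (v i) (sqrt t)) (A i))"
      using A by (intro prod.cong) (auto simp: emeasure_density)
    finally show "emeasure (density (lborel_Rn n) (normal_density_Rn n v t)) (Pi\<^sub>E {1..n} A)
      = (\<Prod>i=1..n. emeasure (normal_measure (v i) (sqrt t)) (A i))" .
  qed simp
  then show ?thesis by (simp add: normal_Rn_def)
qed

text \<open>Conjugacy in each coordinate, with prior variance 1, noise variance \<open>t\<close>,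
  \<open>p = 1\<close> and \<open>q = 0\<close>.\<close>

lemma normal_density_Rn_bayes:
  assumes t: "0 < t"
  shows "normal_density_Rn n (\<lambda>_. 0) 1 z * normal_density_Rn n z t x =
    normal_density_Rn n (\<lambda>_. 0) (1 + t) x * normal_density_Rn n (\<lambda>i. x i / (1 + t)) (t / (1 + t)) z"
proof -
  have "normal_density 0 (sqrt 1) z * normal_density z (sqrt t) x =
    normal_density 0 (sqrt (1 + t)) x * normal_density (x / (1 + t)) (sqrt (t / (1 + t))) z" for x z :: real
    using normal_density_bayes[of 1 t "1 + t" 1 0 z 0 x] t by (simp add: add.commute)
  then show ?thesis
    unfolding normal_density_Rn_def prod.distrib[symmetric]
    by (intro prod.cong refl) (simp flip: ennreal_mult)
qed

text \<open>Time is reversed: Fubini exchanges the starting point \<open>z\<close> with the end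
  point \<open>x\<close>, and conjugacy splits the joint density into the law of \<open>x\<close>
  and that of \<open>z\<close> given \<open>x\<close>. This exhibits a density of the evolved
  measure with respect to a product of normal laws.\<close>

lemma nn_integral_normal_Rn_bayes:
  assumes t: "0 < t" and w: "w \<in> borel_measurable (borel_Rn n)" and A: "A \<in> sets (borel_Rn n)"
  shows "(\<integral>\<^sup>+ z. emeasure (normal_Rn n z t) A * w z \<partial>normal_Rn n (\<lambda>_. 0) 1) =
    (\<integral>\<^sup>+ x. indicator A x * (\<integral>\<^sup>+ z. w z \<partial>normal_Rn n (\<lambda>i. x i / (1 + t)) (t / (1 + t))) \<partial>normal_Rn n (\<lambda>_. 0) (1 + t))"
proof -
  let ?L = "lborel_Rn n"
  note [measurable] = w A
  interpret L: sigma_finite_measure ?L by (rule lborel_Rn.sigma_finite) simp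
  interpret LL: pair_sigma_finite ?L ?L ..
  have t': "0 < 1 + t" "0 < t / (1 + t)" using t by auto
  have [measurable]: "(\<lambda>p. normal_density_Rn n (fst p) t (snd p)) \<in> borel_measurable (?L \<Otimes>\<^sub>M ?L)"
    by (rule measurable_normal_density_Rn_pair) measurable
  have [measurable]: "(\<lambda>z. normal_density_Rn n z t x) \<in> borel_measurable ?L" if "x \<in> space (borel_Rn n)" for x
    using that by (intro measurable_normal_density_Rn_pair) auto
  have scale: "(\<lambda>p. \<lambda>i\<in>{1..n}. fst p i / (1 + t)) \<in> ?L \<Otimes>\<^sub>M ?L \<rightarrow>\<^sub>M borel_Rn n"
  proof (rule measurable_restrict)
    fix i assume "i \<in> {1..n}"
    then have [measurable]: "(\<lambda>x. x i) \<in> ?L \<rightarrow>\<^sub>M borel"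
      using measurable_component_singleton[of i "{1..n}" "\<lambda>_. lborel"] by simp
    show "(\<lambda>p. fst p i / (1 + t)) \<in> ?L \<Otimes>\<^sub>M ?L \<rightarrow>\<^sub>M borel" by measurable
  qed
  \<comment> \<open>The rescaled mean is not extensional outside \<open>{1..n}\<close>, so it is not
    a point of \<open>borel_Rn n\<close>; restricting it leaves the density unchanged and makes
    joint measurability available.\<close>
  have restrict: "normal_density_Rn n (\<lambda>i. x i / (1 + t)) = normal_density_Rn n (\<lambda>i\<in>{1..n}. x i / (1 + t))" for x
    by (intro ext) (auto simp: normal_density_Rn_def intro!: prod.cong)
  have [measurable]: "(\<lambda>p. normal_density_Rn n (\<lambda>i. fst p i / (1 + t)) (t / (1 + t)) (snd p)) \<in> borel_measurable (?L \<Otimes>\<^sub>M ?L)"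
    unfolding restrict using scale by (intro measurable_normal_density_Rn_pair) measurable
  have A': "A \<in> sets ?L" using A by (simp only: sets_lborel_Rn)
  have "(\<integral>\<^sup>+ z. emeasure (normal_Rn n z t) A * w z \<partial>normal_Rn n (\<lambda>_. 0) 1) =
    (\<integral>\<^sup>+ z. (\<integral>\<^sup>+ x. normal_density_Rn n z t x * indicator A x \<partial>?L) * w z \<partial>normal_Rn n (\<lambda>_. 0) 1)"
    unfolding normal_Rn_eq_density[OF t] emeasure_density[OF measurable_normal_density_Rn_lborel A'] ..
  also have "\<dots> =
    (\<integral>\<^sup>+ z. normal_density_Rn n (\<lambda>_. 0) 1 z * ((\<integral>\<^sup>+ x. normal_density_Rn n z t x * indicator A x \<partial>?L) * w z) \<partial>?L)"
    unfolding normal_Rn_eq_density[OF zero_less_one] by (rule nn_integral_density) measurable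
  also have "\<dots> = (\<integral>\<^sup>+ z. (\<integral>\<^sup>+ x. normal_density_Rn n (\<lambda>_. 0) 1 z * normal_density_Rn n z t x * indicator A x * w z \<partial>?L) \<partial>?L)"
  proof (rule nn_integral_cong)
    fix z
    have "(\<lambda>x. normal_density_Rn n z t x * indicator A x) \<in> borel_measurable ?L" by measurable
    then show "normal_density_Rn n (\<lambda>_. 0) 1 z * ((\<integral>\<^sup>+ x. normal_density_Rn n z t x * indicator A x \<partial>?L) * w z) =
      (\<integral>\<^sup>+ x. normal_density_Rn n (\<lambda>_. 0) 1 z * normal_density_Rn n z t x * indicator A x * w z \<partial>?L)"
      by (simp only: mult.assoc[of "normal_density_Rn n (\<lambda>_. 0) 1 z"] nn_integral_cmult nn_integral_multc
          borel_measurable_times_ennreal borel_measurable_const)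
  qed
  also have "\<dots> = (\<integral>\<^sup>+ x. (\<integral>\<^sup>+ z. normal_density_Rn n (\<lambda>_. 0) 1 z * normal_density_Rn n z t x * indicator A x * w z \<partial>?L) \<partial>?L)"
    by (rule LL.Fubini'[symmetric], unfold split_beta', measurable)
  also have "\<dots> = (\<integral>\<^sup>+ x. (\<integral>\<^sup>+ z. normal_density_Rn n (\<lambda>_. 0) (1 + t) x * indicator A x *
      (normal_density_Rn n (\<lambda>i. x i / (1 + t)) (t / (1 + t)) z * w z) \<partial>?L) \<partial>?L)"
    unfolding normal_density_Rn_bayes[OF t] by (simp only: mult_ac)
  also have "\<dots> = (\<integral>\<^sup>+ x. normal_density_Rn n (\<lambda>_. 0) (1 + t) x * (indicator A x *
      (\<integral>\<^sup>+ z. normal_density_Rn n (\<lambda>i. x i / (1 + t)) (t / (1 + t)) z * w z \<partial>?L)) \<partial>?L)"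
  proof (rule nn_integral_cong)
    fix x
    let ?q = "\<lambda>z. normal_density_Rn n (\<lambda>i. x i / (1 + t)) (t / (1 + t)) z * w z"
    have "?q \<in> borel_measurable ?L" by measurable
    from nn_integral_cmult[OF this, of "normal_density_Rn n (\<lambda>_. 0) (1 + t) x * indicator A x"]
    show "(\<integral>\<^sup>+ z. normal_density_Rn n (\<lambda>_. 0) (1 + t) x * indicator A x * ?q z \<partial>?L) =
      normal_density_Rn n (\<lambda>_. 0) (1 + t) x * (indicator A x * (\<integral>\<^sup>+ z. ?q z \<partial>?L))"
      by (simp only: mult.assoc)
  qed
  also have "\<dots> = (\<integral>\<^sup>+ x. indicator A x * (\<integral>\<^sup>+ z. w z \<partial>normal_Rn n (\<lambda>i. x i / (1 + t)) (t / (1 + t))) \<partial>normal_Rn n (\<lambda>_. 0) (1 + t))"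
  proof -
    have "(\<integral>\<^sup>+ z. w z \<partial>normal_Rn n (\<lambda>i. x i / (1 + t)) (t / (1 + t))) =
        (\<integral>\<^sup>+ z. normal_density_Rn n (\<lambda>i. x i / (1 + t)) (t / (1 + t)) z * w z \<partial>?L)" for x
      unfolding normal_Rn_eq_density[OF t'(2)] by (rule nn_integral_density) measurable
    then show ?thesis
      unfolding normal_Rn_eq_density[OF t'(1)] by (simp only:) (rule nn_integral_density[symmetric], measurable)
  qed
  finally show ?thesis .
qed

text \<open>Sums of independent normal variables are normal. The Gibbs weight depends on the
  magnetisation alone, so this reduces its integrals from dimension \<open>n\<close> to dimension
  1.\<close>

lemma nn_integral_magnetisation_normal_Rn:
  assumes n: "0 < n" and t: "0 < t" and w[measurable]: "w \<in> borel_measurable borel"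
  shows "(\<integral>\<^sup>+ z. w (magnetisation n z) \<partial>normal_Rn n v t) =
    (\<integral>\<^sup>+ r. ennreal (normal_density (magnetisation n v) (sqrt (t / n)) r) * w r \<partial>lborel)"
proof -
  let ?N = "normal_Rn n v t"
  interpret prob_space ?N using t by (rule prob_space_normal_Rn)
  have comp: "distr ?N borel (\<lambda>z. z i) = normal_measure (v i) (sqrt t)" if i: "i \<in> {1..n}" for i
  proof -
    have "distr ?N borel (\<lambda>z. z i) = distr ?N (normal_measure (v i) (sqrt t)) (\<lambda>z. z i)"
      by (intro distr_cong) auto
    also have "\<dots> = normal_measure (v i) (sqrt t)"
      unfolding normal_Rn_def using i t
      by (intro distr_PiM_component[where M = "\<lambda>i. normal_measure (v i) (sqrt t)"])
         (auto intro: prob_space_normal_density)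
    finally show ?thesis .
  qed
  have coord[measurable]: "(\<lambda>z. z i) \<in> ?N \<rightarrow>\<^sub>M borel" if "i \<in> {1..n}" for i
    using measurable_component_singleton[OF that, of "\<lambda>_. borel"]
    by (simp add: measurable_cong_sets[OF sets_normal_Rn refl])
  have "indep_vars (\<lambda>_. borel) (\<lambda>i z. z i) {1..n}"
  proof (subst indep_vars_iff_distr_eq_PiM')
    have "distr ?N (borel_Rn n) (\<lambda>z. \<lambda>i\<in>{1..n}. z i) = distr ?N (borel_Rn n) (\<lambda>z. z)"
    proof (rule distr_cong)
      fix z assume "z \<in> space ?N"
      then have "z \<in> extensional {1..n}"
        by (simp add: sets_eq_imp_space_eq[OF sets_normal_Rn] space_PiM PiE_def)
      then show "(\<lambda>i\<in>{1..n}. z i) = z" by (rule extensional_restrict)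
    qed auto
    also have "\<dots> = ?N" by (rule distr_id2) simp
    also have "\<dots> = (\<Pi>\<^sub>M i\<in>{1..n}. normal_measure (v i) (sqrt t))" by (simp add: normal_Rn_def)
    also have "\<dots> = (\<Pi>\<^sub>M i\<in>{1..n}. distr ?N borel (\<lambda>z. z i))"
      by (intro PiM_cong refl comp[symmetric])
    finally show "distr ?N (borel_Rn n) (\<lambda>z. \<lambda>i\<in>{1..n}. z i) = (\<Pi>\<^sub>M i\<in>{1..n}. distr ?N borel (\<lambda>z. z i))" .
  qed (use n in auto)
  moreover have "distributed ?N lborel (\<lambda>z. z i) (normal_density (v i) (sqrt t))" if "i \<in> {1..n}" for i
    unfolding distributed_def using comp[OF that] that by (simp cong: distr_cong)
  ultimately have "distributed ?N lborel (\<lambda>z. \<Sum>i=1..n. z i)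
      (normal_density (\<Sum>i=1..n. v i) (sqrt (\<Sum>i=1..n. (sqrt t)\<^sup>2)))"
    using n t by (intro sum_indep_normal) auto
  then have sum: "distributed ?N lborel (\<lambda>z. \<Sum>i=1..n. z i) (normal_density (\<Sum>i=1..n. v i) (sqrt (n * t)))"
    using t by simp
  have "distributed ?N lborel (\<lambda>z. 0 + 1 / n * (\<Sum>i=1..n. z i))
      (normal_density (0 + 1 / n * (\<Sum>i=1..n. v i)) (\<bar>1 / n\<bar> * sqrt (n * t)))"
    using n t by (intro normal_density_affine[OF sum]) auto
  moreover have "\<bar>1 / n\<bar> * sqrt (n * t) = sqrt (t / n)"
  proof -
    have "\<bar>1 / real n\<bar> = sqrt ((1 / real n)\<^sup>2)" by simp
    then have "\<bar>1 / real n\<bar> * sqrt (n * t) = sqrt ((1 / real n)\<^sup>2 * (n * t))" by (simp only: real_sqrt_mult)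
    also have "(1 / real n)\<^sup>2 * (n * t) = t / n" using n by (simp add: power2_eq_square)
    finally show ?thesis .
  qed
  ultimately have "distributed ?N lborel (magnetisation n) (normal_density (magnetisation n v) (sqrt (t / n)))"
    by (simp add: magnetisation_def[abs_def])
  from distributed_nn_integral[OF this, of w] show ?thesis by simp
qed

section \<open>The conditional law of the first spin\<close>

text \<open>Up to \<open>norm_const V n\<close>, this is the density of the evolved measure with
  respect to the centred normal law of variance \<open>1 + t\<close>, at a configuration of
  magnetisation \<open>m\<close>: the Gibbs weight averaged over the initial magnetisation given the
  final configuration.\<close>

definition likelihood :: "(real \<Rightarrow> real) \<Rightarrow> real \<Rightarrow> nat \<Rightarrow> real \<Rightarrow> ennreal" where
  "likelihood V t n m = (\<integral>\<^sup>+ r. ennreal (normal_density (m / (1 + t)) (sqrt (t / (1 + t) / n)) r) *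
     ennreal (exp (- real n * V r)) \<partial>lborel)"

text \<open>The first spin \<open>u\<close> is integrated out while the other spins sum to
  \<open>s\<close>; this is, again up to \<open>norm_const V n\<close>, the density of the marginal
  law of the other spins.\<close>

definition likelihood_average :: "(real \<Rightarrow> real) \<Rightarrow> real \<Rightarrow> nat \<Rightarrow> real \<Rightarrow> ennreal" where
  "likelihood_average V t n s = (\<integral>\<^sup>+ u. likelihood V t n ((u + s) / n) \<partial>normal_measure 0 (sqrt (1 + t)))"

text \<open>Bayes' formula, joint density over marginal density. It depends on \<open>y\<close> only
  through the sum of the spins.\<close>

definition first_spin_kernel :: "(real \<Rightarrow> real) \<Rightarrow> real \<Rightarrow> nat \<Rightarrow> (nat \<Rightarrow> real) \<Rightarrow> real measure" where
  "first_spin_kernel V t n y = density (normal_measure 0 (sqrt (1 + t)))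
     (\<lambda>u. likelihood V t n ((u + (\<Sum>i=1..n-1. y i)) / n) / likelihood_average V t n (\<Sum>i=1..n-1. y i))"

lemma magnetisation_split_first:
  assumes "0 < n"
  shows "magnetisation n x = (x 1 + (\<Sum>i=1..n-1. other_spins n x i)) / n"
proof -
  have "(\<Sum>i=1..n. x i) = x 1 + (\<Sum>i=Suc 1..n. x i)"
    using assms by (intro sum.atLeast_Suc_atMost) simp
  also have "(\<Sum>i=Suc 1..n. x i) = (\<Sum>i=Suc 1..Suc (n - 1). x i)" using assms by simp
  also have "\<dots> = (\<Sum>i=1..n-1. x (Suc i))" by (rule sum.shift_bounds_cl_Suc_ivl)
  also have "\<dots> = (\<Sum>i=1..n-1. other_spins n x i)" by (intro sum.cong) (auto simp: other_spins_def)
  finally show ?thesis by (simp add: magnetisation_def)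
qed

lemma measurable_sum_spins [measurable]: "(\<lambda>y. \<Sum>i=1..n. y i) \<in> borel_measurable (borel_Rn n)"
  by (rule borel_measurable_sum) (rule measurable_component_singleton)

lemma measurable_other_spins [measurable]: "other_spins n \<in> borel_Rn n \<rightarrow>\<^sub>M borel_Rn (n - 1)"
  unfolding other_spins_def
  by (intro measurable_restrict measurable_component_singleton) auto

lemma measurable_first_spin: "0 < n \<Longrightarrow> (\<lambda>x. x 1) \<in> borel_Rn n \<rightarrow>\<^sub>M borel"
  by (rule measurable_component_singleton) simp

lemma nn_integral_normal_Rn_split_first:
  assumes n: "0 < n" and s: "0 < s" and \<Phi>: "\<Phi> \<in> borel_measurable (borel \<Otimes>\<^sub>M borel_Rn (n - 1))"
  shows "(\<integral>\<^sup>+ x. \<Phi> (x 1, other_spins n x) \<partial>normal_Rn n (\<lambda>_. 0) s) =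
    (\<integral>\<^sup>+ y. (\<integral>\<^sup>+ u. \<Phi> (u, y) \<partial>normal_measure 0 (sqrt s)) \<partial>normal_Rn (n - 1) (\<lambda>_. 0) s)"
proof -
  let ?N1 = "normal_measure 0 (sqrt s)" and ?N' = "normal_Rn (n - 1) (\<lambda>_. 0) s"
  interpret N1: prob_space ?N1 using s by (intro prob_space_normal_density) simp
  interpret N': prob_space ?N' using s by (rule prob_space_normal_Rn)
  interpret pair_prob_space ?N1 ?N' ..
  interpret N: product_sigma_finite "\<lambda>_ :: nat. ?N1" ..
  \<comment> \<open>The inverse of splitting off the first spin; the remaining spins are shifted by
    one index. Its image measure is identified with the product on boxes.\<close>
  define J where "J = (\<lambda>(u :: real, y). \<lambda>i\<in>{1..n}. if i = 1 then u else y (i - 1))"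
  have J: "J \<in> ?N1 \<Otimes>\<^sub>M ?N' \<rightarrow>\<^sub>M borel_Rn n"
    unfolding J_def split_beta'
  proof (rule measurable_restrict)
    fix i assume i: "i \<in> {1..n}"
    show "(\<lambda>p. if i = 1 then fst p else snd p (i - 1)) \<in> ?N1 \<Otimes>\<^sub>M ?N' \<rightarrow>\<^sub>M borel"
    proof (cases "i = 1")
      case True
      have "fst \<in> ?N1 \<Otimes>\<^sub>M ?N' \<rightarrow>\<^sub>M borel" by measurable
      then show ?thesis using True by simp
    next
      case False
      then have "(\<lambda>y. y (i - 1)) \<in> borel_Rn (n - 1) \<rightarrow>\<^sub>M borel"
        using i by (intro measurable_component_singleton) auto
      then have [measurable]: "(\<lambda>y. y (i - 1)) \<in> ?N' \<rightarrow>\<^sub>M borel"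
        by (simp only: measurable_cong_sets[OF sets_normal_Rn refl])
      have "(\<lambda>p. snd p (i - 1)) \<in> ?N1 \<Otimes>\<^sub>M ?N' \<rightarrow>\<^sub>M borel" by measurable
      then show ?thesis using False by simp
    qed
  qed
  have space: "space (?N1 \<Otimes>\<^sub>M ?N') = UNIV \<times> space (borel_Rn (n - 1))"
    by (simp add: space_pair_measure sets_eq_imp_space_eq[OF sets_normal_Rn])
  have "distr (?N1 \<Otimes>\<^sub>M ?N') (borel_Rn n) J = (\<Pi>\<^sub>M i\<in>{1..n}. ?N1)"
  proof (rule N.PiM_eqI)
    show "sets (distr (?N1 \<Otimes>\<^sub>M ?N') (borel_Rn n) J) = sets (\<Pi>\<^sub>M i\<in>{1..n}. ?N1)"
      unfolding sets_distr by (intro sets_PiM_cong) auto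
    fix A :: "nat \<Rightarrow> real set" assume A: "\<And>i. i \<in> {1..n} \<Longrightarrow> A i \<in> sets ?N1"
    define A' where "A' = (\<lambda>i. A (Suc i))"
    have A': "A' i \<in> sets ?N1" if "i \<in> {1..n - 1}" for i
      using A[of "Suc i"] that by (auto simp: A'_def)
    have vim: "J -` Pi\<^sub>E {1..n} A \<inter> space (?N1 \<Otimes>\<^sub>M ?N') = A 1 \<times> Pi\<^sub>E {1..n - 1} A'"
    proof (intro set_eqI iffI)
      fix p assume p: "p \<in> J -` Pi\<^sub>E {1..n} A \<inter> space (?N1 \<Otimes>\<^sub>M ?N')"
      obtain u y where uy: "p = (u, y)" by (cases p)
      have mem: "J (u, y) i \<in> A i" if "i \<in> {1..n}" for i using p uy that by (auto simp: PiE_iff)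
      have ext: "y \<in> extensional {1..n - 1}" using p uy unfolding space by (auto simp: space_PiM PiE_def)
      have "u \<in> A 1" using mem[of 1] n by (simp add: J_def)
      moreover have "y i \<in> A' i" if "i \<in> {1..n - 1}" for i
        using mem[of "Suc i"] that by (auto simp: J_def A'_def split: if_splits)
      ultimately show "p \<in> A 1 \<times> Pi\<^sub>E {1..n - 1} A'" using uy ext by (auto simp: PiE_def)
    next
      fix p assume p: "p \<in> A 1 \<times> Pi\<^sub>E {1..n - 1} A'"
      obtain u y where uy: "p = (u, y)" by (cases p)
      have "J (u, y) i \<in> A i" if i: "i \<in> {1..n}" for i
      proof (cases "i = 1")
        case True then show ?thesis using p uy i by (auto simp: J_def)
      next
        case False
        then have i': "i - 1 \<in> {1..n - 1}" "Suc (i - 1) = i" using i by auto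
        have "y \<in> Pi\<^sub>E {1..n - 1} A'" using p uy by simp
        then have "y (i - 1) \<in> A' (i - 1)" using i'(1) by (rule PiE_mem)
        then have "y (i - 1) \<in> A i" using i'(2) by (simp only: A'_def)
        then show ?thesis using False i by (simp add: J_def)
      qed
      then have "J (u, y) \<in> Pi\<^sub>E {1..n} A" by (auto simp: J_def PiE_def)
      moreover have "p \<in> space (?N1 \<Otimes>\<^sub>M ?N')" using p uy unfolding space by (auto simp: space_PiM PiE_def)
      ultimately show "p \<in> J -` Pi\<^sub>E {1..n} A \<inter> space (?N1 \<Otimes>\<^sub>M ?N')" using uy by simp
    qed
    have A'_in: "Pi\<^sub>E {1..n - 1} A' \<in> sets ?N'"
      unfolding sets_normal_Rn using A' by (intro sets_PiM_I_finite) auto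
    have "emeasure (distr (?N1 \<Otimes>\<^sub>M ?N') (borel_Rn n) J) (Pi\<^sub>E {1..n} A) = emeasure (?N1 \<Otimes>\<^sub>M ?N') (A 1 \<times> Pi\<^sub>E {1..n - 1} A')"
      unfolding vim[symmetric] using A by (intro emeasure_distr[OF J] sets_PiM_I_finite) auto
    also have "\<dots> = emeasure ?N1 (A 1) * emeasure ?N' (Pi\<^sub>E {1..n - 1} A')"
      using A[of 1] n A'_in by (intro N'.emeasure_pair_measure_Times) auto
    also have "emeasure ?N' (Pi\<^sub>E {1..n - 1} A') = (\<Prod>i=1..n-1. emeasure ?N1 (A' i))"
      unfolding normal_Rn_def using A' by (intro N.emeasure_PiM) auto
    also have "\<dots> = (\<Prod>i=Suc 1..Suc (n - 1). emeasure ?N1 (A i))"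
      unfolding A'_def by (rule prod.shift_bounds_cl_Suc_ivl[symmetric])
    also have "emeasure ?N1 (A 1) * \<dots> = (\<Prod>i=1..n. emeasure ?N1 (A i))"
      using n by (subst (2) prod.atLeast_Suc_atMost) auto
    finally show "emeasure (distr (?N1 \<Otimes>\<^sub>M ?N') (borel_Rn n) J) (Pi\<^sub>E {1..n} A) = (\<Prod>i=1..n. emeasure ?N1 (A i))" .
  qed simp
  then have "(\<integral>\<^sup>+ x. \<Phi> (x 1, other_spins n x) \<partial>normal_Rn n (\<lambda>_. 0) s) =
      (\<integral>\<^sup>+ x. \<Phi> (x 1, other_spins n x) \<partial>distr (?N1 \<Otimes>\<^sub>M ?N') (borel_Rn n) J)"
    by (simp add: normal_Rn_def)
  also have "\<dots> = (\<integral>\<^sup>+ p. \<Phi> (J p 1, other_spins n (J p)) \<partial>(?N1 \<Otimes>\<^sub>M ?N'))"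
  proof (rule nn_integral_distr[OF J])
    have "(\<lambda>x. \<Phi> (x 1, other_spins n x)) \<in> borel_measurable (borel_Rn n)"
      by (rule measurable_compose[OF measurable_Pair[OF measurable_first_spin[OF n] measurable_other_spins] \<Phi>])
    then show "(\<lambda>x. \<Phi> (x 1, other_spins n x)) \<in> borel_measurable (distr (?N1 \<Otimes>\<^sub>M ?N') (borel_Rn n) J)"
      by (simp only: measurable_cong_sets[OF sets_distr refl])
  qed
  also have "\<dots> = (\<integral>\<^sup>+ p. \<Phi> p \<partial>(?N1 \<Otimes>\<^sub>M ?N'))"
  proof (rule nn_integral_cong)
    fix p assume p: "p \<in> space (?N1 \<Otimes>\<^sub>M ?N')"
    obtain u y where uy: "p = (u, y)" by (cases p)
    have ext: "y \<in> extensional {1..n - 1}" using p uy unfolding space by (auto simp: space_PiM PiE_def)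
    have "other_spins n (J p) = y"
    proof (rule extensionalityI[OF _ ext])
      show "other_spins n (J p) \<in> extensional {1..n - 1}" by (simp add: other_spins_def)
      show "other_spins n (J p) i = y i" if "i \<in> {1..n - 1}" for i
        using that uy by (auto simp: other_spins_def J_def)
    qed
    moreover have "J p 1 = u" using n uy by (simp add: J_def)
    ultimately show "\<Phi> (J p 1, other_spins n (J p)) = \<Phi> p" using uy by simp
  qed
  also have "\<dots> = (\<integral>\<^sup>+ y. (\<integral>\<^sup>+ u. \<Phi> (u, y) \<partial>?N1) \<partial>?N')"
  proof (rule nn_integral_snd[symmetric])
    have "sets (?N1 \<Otimes>\<^sub>M ?N') = sets (borel \<Otimes>\<^sub>M borel_Rn (n - 1))"
      by (intro sets_pair_measure_cong) auto
    then show "\<Phi> \<in> borel_measurable (?N1 \<Otimes>\<^sub>M ?N')" using \<Phi> measurable_cong_sets by blast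
  qed
  finally show ?thesis .
qed

section \<open>Density of the evolved measure and Bayes' formula\<close>

locale mean_field_dynamics =
  fixes V :: "real \<Rightarrow> real" and t :: real
  assumes V_nonneg: "\<And>r. 0 \<le> V r" and V_lsc: "lower_semicontinuous V" and t_pos: "0 < t"
begin

lemma V_measurable [measurable]: "V \<in> borel_measurable borel"
  using V_lsc by (rule lower_semicontinuous_borel_measurable)

lemma likelihood_measurable [measurable]: "likelihood V t n \<in> borel_measurable borel"
  unfolding likelihood_def normal_density_def by measurable

lemma likelihood_pos: "0 < n \<Longrightarrow> 0 < likelihood V t n m"
proof -
  assume n: "0 < n"
  have "likelihood V t n m \<noteq> 0"
  proof
    assume "likelihood V t n m = 0"
    then have "AE r in lborel. ennreal (normal_density (m / (1 + t)) (sqrt (t / (1 + t) / n)) r) *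
        ennreal (exp (- real n * V r)) = 0"
      unfolding likelihood_def by (subst (asm) nn_integral_0_iff_AE) auto
    moreover have "ennreal (normal_density (m / (1 + t)) (sqrt (t / (1 + t) / n)) r) *
        ennreal (exp (- real n * V r)) \<noteq> 0" for r
      using normal_density_pos[of "sqrt (t / (1 + t) / n)" "m / (1 + t)" r] n t_pos by simp
    ultimately have "eventually (\<lambda>s :: real. False) (ae_filter lborel)" by simp
    from AE_E2[OF this] show False by simp
  qed
  then show ?thesis by (simp add: zero_less_iff_neq_zero)
qed

lemma likelihood_le_1: "0 < n \<Longrightarrow> likelihood V t n m \<le> 1"
proof -
  assume n: "0 < n"
  interpret prob_space "normal_measure (m / (1 + t)) (sqrt (t / (1 + t) / n))"
    using n t_pos by (intro prob_space_normal_density) simp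
  have "likelihood V t n m = (\<integral>\<^sup>+ r. ennreal (exp (- real n * V r)) \<partial>normal_measure (m / (1 + t)) (sqrt (t / (1 + t) / n)))"
    unfolding likelihood_def by (subst nn_integral_density) auto
  also have "\<dots> \<le> (\<integral>\<^sup>+ r. 1 \<partial>normal_measure (m / (1 + t)) (sqrt (t / (1 + t) / n)))"
    using V_nonneg by (intro nn_integral_mono) simp
  also have "\<dots> = 1" using emeasure_space_1 by simp
  finally show ?thesis .
qed

lemma likelihood_average_measurable [measurable]: "likelihood_average V t n \<in> borel_measurable borel"
proof -
  interpret prob_space "normal_measure 0 (sqrt (1 + t))"
    using t_pos by (intro prob_space_normal_density) simp
  show ?thesis unfolding likelihood_average_def by measurable
qed

lemma likelihood_average_bounds:
  assumes n: "0 < n"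
  shows "0 < likelihood_average V t n s" "likelihood_average V t n s \<le> 1"
proof -
  interpret prob_space "normal_measure 0 (sqrt (1 + t))"
    using t_pos by (intro prob_space_normal_density) simp
  have "likelihood_average V t n s \<le> (\<integral>\<^sup>+ u. 1 \<partial>normal_measure 0 (sqrt (1 + t)))"
    unfolding likelihood_average_def using likelihood_le_1[OF n] by (intro nn_integral_mono)
  also have "\<dots> = 1" using emeasure_space_1 by simp
  finally show "likelihood_average V t n s \<le> 1" .
  have "likelihood_average V t n s \<noteq> 0"
  proof
    assume "likelihood_average V t n s = 0"
    then have "AE u in normal_measure 0 (sqrt (1 + t)). likelihood V t n ((u + s) / n) = 0"
      unfolding likelihood_average_def by (subst (asm) nn_integral_0_iff_AE) auto
    then have "AE u in normal_measure 0 (sqrt (1 + t)). False"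
      using likelihood_pos[OF n] by (auto elim!: eventually_mono simp: less_le)
    then show False by simp
  qed
  then show "0 < likelihood_average V t n s" by (simp add: zero_less_iff_neq_zero)
qed

lemma norm_const_bounds: "0 < norm_const V n" "norm_const V n < \<infinity>"
proof -
  interpret N: prob_space "normal_Rn n (\<lambda>_. 0) 1" by (rule prob_space_normal_Rn) simp
  have "norm_const V n \<le> (\<integral>\<^sup>+ z. 1 \<partial>normal_Rn n (\<lambda>_. 0) 1)"
    unfolding norm_const_def using V_nonneg by (intro nn_integral_mono) simp
  also have "\<dots> < \<infinity>" using N.emeasure_space_1 by simp
  finally show "norm_const V n < \<infinity>" .
  have "norm_const V n \<noteq> 0" unfolding norm_const_def by (simp add: nn_integral_0_iff_AE)
  then show "0 < norm_const V n" by (simp add: zero_less_iff_neq_zero)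
qed

text \<open>Given the end point \<open>x\<close>, the starting point has mean
  \<open>x / (1 + t)\<close> in each coordinate. Since the magnetisation is linear, the inner
  average in the reversed formula depends on \<open>magnetisation n x\<close> only.\<close>

lemma emeasure_time_evolved_eq:
  assumes n: "0 < n" and A: "A \<in> sets (borel_Rn n)"
  shows "emeasure (time_evolved V t n) A =
    (\<integral>\<^sup>+ x. indicator A x * likelihood V t n (magnetisation n x) \<partial>normal_Rn n (\<lambda>_. 0) (1 + t)) / norm_const V n"
proof -
  let ?w = "\<lambda>r. ennreal (exp (- real n * V r))"
  have inner: "(\<integral>\<^sup>+ z. ?w (magnetisation n z) \<partial>normal_Rn n (\<lambda>i. x i / (1 + t)) (t / (1 + t))) =
      likelihood V t n (magnetisation n x)" for x
  proof -
    have "magnetisation n (\<lambda>i. x i / (1 + t)) = magnetisation n x / (1 + t)"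
      by (simp add: magnetisation_def field_simps flip: sum_divide_distrib)
    then show ?thesis
      using n t_pos by (subst nn_integral_magnetisation_normal_Rn) (auto simp: likelihood_def)
  qed
  have "(\<integral>\<^sup>+ z. emeasure (normal_Rn n z t) A * ?w (magnetisation n z) \<partial>normal_Rn n (\<lambda>_. 0) 1) =
    (\<integral>\<^sup>+ x. indicator A x * (\<integral>\<^sup>+ z. ?w (magnetisation n z) \<partial>normal_Rn n (\<lambda>i. x i / (1 + t)) (t / (1 + t)))
      \<partial>normal_Rn n (\<lambda>_. 0) (1 + t))"
    by (rule nn_integral_normal_Rn_bayes[OF t_pos _ A]) measurable
  then show ?thesis
    unfolding emeasure_time_evolved[OF V_nonneg V_lsc t_pos A] inner by simp
qed

lemma emeasure_time_evolved_split:
  assumes n: "0 < n" and A: "A \<in> sets borel" and B: "B \<in> sets (borel_Rn (n - 1))"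
  shows "emeasure (time_evolved V t n) {x \<in> space (borel_Rn n). x 1 \<in> A \<and> other_spins n x \<in> B} =
    (\<integral>\<^sup>+ y. indicator B y * (\<integral>\<^sup>+ u. indicator A u * likelihood V t n ((u + (\<Sum>i=1..n-1. y i)) / n)
        \<partial>normal_measure 0 (sqrt (1 + t))) \<partial>normal_Rn (n - 1) (\<lambda>_. 0) (1 + t)) / norm_const V n"
proof -
  note [measurable] = A B measurable_first_spin[OF n]
  let ?E = "{x \<in> space (borel_Rn n). x 1 \<in> A \<and> other_spins n x \<in> B}"
  define \<Phi> where "\<Phi> = (\<lambda>(u, y). indicator A u * (indicator B y * likelihood V t n ((u + (\<Sum>i=1..n-1. y i)) / n)))"
  have E: "?E \<in> sets (borel_Rn n)" by measurable
  have \<Phi>: "\<Phi> \<in> borel_measurable (borel \<Otimes>\<^sub>M borel_Rn (n - 1))"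
    unfolding \<Phi>_def split_beta' by measurable
  have "(\<integral>\<^sup>+ x. indicator ?E x * likelihood V t n (magnetisation n x) \<partial>normal_Rn n (\<lambda>_. 0) (1 + t)) =
    (\<integral>\<^sup>+ x. \<Phi> (x 1, other_spins n x) \<partial>normal_Rn n (\<lambda>_. 0) (1 + t))"
  proof (rule nn_integral_cong)
    fix x assume "x \<in> space (normal_Rn n (\<lambda>_. 0) (1 + t))"
    then have "x \<in> space (borel_Rn n)" by (simp only: sets_eq_imp_space_eq[OF sets_normal_Rn])
    then show "indicator ?E x * likelihood V t n (magnetisation n x) = \<Phi> (x 1, other_spins n x)"
      unfolding \<Phi>_def magnetisation_split_first[OF n] by (auto simp: indicator_def)
  qed
  also have "\<dots> = (\<integral>\<^sup>+ y. (\<integral>\<^sup>+ u. \<Phi> (u, y) \<partial>normal_measure 0 (sqrt (1 + t))) \<partial>normal_Rn (n - 1) (\<lambda>_. 0) (1 + t))"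
    using t_pos by (intro nn_integral_normal_Rn_split_first n \<Phi>) simp
  also have "\<dots> = (\<integral>\<^sup>+ y. indicator B y * (\<integral>\<^sup>+ u. indicator A u * likelihood V t n ((u + (\<Sum>i=1..n-1. y i)) / n)
        \<partial>normal_measure 0 (sqrt (1 + t))) \<partial>normal_Rn (n - 1) (\<lambda>_. 0) (1 + t))"
    by (intro nn_integral_cong) (simp add: \<Phi>_def mult.left_commute[of _ "indicator B _"] nn_integral_cmult)
  finally show ?thesis unfolding emeasure_time_evolved_eq[OF n E] by simp
qed

abbreviation other_spins_law :: "nat \<Rightarrow> (nat \<Rightarrow> real) measure" where
  "other_spins_law n \<equiv> distr (time_evolved V t n) (borel_Rn (n - 1)) (other_spins n)"

lemma other_spins_law_eq_density:
  assumes n: "0 < n"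
  shows "other_spins_law n = density (normal_Rn (n - 1) (\<lambda>_. 0) (1 + t))
    (\<lambda>y. likelihood_average V t n (\<Sum>i=1..n-1. y i) / norm_const V n)"
proof (rule measure_eqI)
  fix B assume "B \<in> sets (other_spins_law n)"
  then have B[measurable]: "B \<in> sets (borel_Rn (n - 1))" by simp
  have sets: "sets (time_evolved V t n) = sets (borel_Rn n)"
    by (rule sets_time_evolved[OF V_nonneg V_lsc t_pos])
  have other: "other_spins n \<in> time_evolved V t n \<rightarrow>\<^sub>M borel_Rn (n - 1)"
    using measurable_other_spins measurable_cong_sets[OF sets refl] by blast
  have "emeasure (other_spins_law n) B = emeasure (time_evolved V t n) {x \<in> space (borel_Rn n). x 1 \<in> UNIV \<and> other_spins n x \<in> B}"
    unfolding emeasure_distr[OF other B] sets_eq_imp_space_eq[OF sets]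
    by (rule arg_cong[where f = "emeasure _"]) auto
  also have "\<dots> = (\<integral>\<^sup>+ y. indicator B y * likelihood_average V t n (\<Sum>i=1..n-1. y i)
       \<partial>normal_Rn (n - 1) (\<lambda>_. 0) (1 + t)) / norm_const V n"
    by (subst emeasure_time_evolved_split[OF n _ B]) (auto simp: likelihood_average_def)
  also have "\<dots> = (\<integral>\<^sup>+ y. likelihood_average V t n (\<Sum>i=1..n-1. y i) / norm_const V n * indicator B y
       \<partial>normal_Rn (n - 1) (\<lambda>_. 0) (1 + t))"
    unfolding divide_ennreal_def
    by (subst nn_integral_multc[symmetric]) (measurable, auto intro!: nn_integral_cong simp: mult_ac)
  also have "\<dots> = emeasure (density (normal_Rn (n - 1) (\<lambda>_. 0) (1 + t))
    (\<lambda>y. likelihood_average V t n (\<Sum>i=1..n-1. y i) / norm_const V n)) B"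
    by (rule emeasure_density[symmetric]) measurable
  finally show "emeasure (other_spins_law n) B = \<dots>" .
qed simp

lemma sets_first_spin_kernel [simp, measurable_cong]: "sets (first_spin_kernel V t n y) = sets borel"
  by (simp add: first_spin_kernel_def)

lemma nn_integral_first_spin_kernel:
  assumes n: "0 < n" and f[measurable]: "f \<in> borel_measurable borel"
  shows "(\<integral>\<^sup>+ u. f u \<partial>first_spin_kernel V t n y) =
    (\<integral>\<^sup>+ u. f u * likelihood V t n ((u + (\<Sum>i=1..n-1. y i)) / n) \<partial>normal_measure 0 (sqrt (1 + t)))
      / likelihood_average V t n (\<Sum>i=1..n-1. y i)"
  unfolding first_spin_kernel_def divide_ennreal_def
  by (subst nn_integral_density, measurable, subst nn_integral_multc[symmetric])
     (measurable, auto intro!: nn_integral_cong simp: mult_ac)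

lemma prob_space_first_spin_kernel:
  assumes n: "0 < n"
  shows "prob_space (first_spin_kernel V t n y)"
proof
  have "emeasure (first_spin_kernel V t n y) (space (first_spin_kernel V t n y)) = (\<integral>\<^sup>+ u. 1 \<partial>first_spin_kernel V t n y)"
    by simp
  also have "\<dots> = 1"
    using likelihood_average_bounds[OF n, of "\<Sum>i=1..n-1. y i"]
    by (subst nn_integral_first_spin_kernel[OF n])
       (auto simp: likelihood_average_def intro!: ennreal_divide_self dest: le_less_trans[OF _ ennreal_one_less_top])
  finally show "emeasure (first_spin_kernel V t n y) (space (first_spin_kernel V t n y)) = 1" .
qed

lemma emeasure_first_spin_kernel:
  assumes n: "0 < n" and A: "A \<in> sets borel"
  shows "emeasure (first_spin_kernel V t n y) A =
    (\<integral>\<^sup>+ u. indicator A u * likelihood V t n ((u + (\<Sum>i=1..n-1. y i)) / n) \<partial>normal_measure 0 (sqrt (1 + t)))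
      / likelihood_average V t n (\<Sum>i=1..n-1. y i)"
  using nn_integral_first_spin_kernel[OF n, of "indicator A" y] A by simp

lemma measurable_first_spin_kernel_numerator:
  assumes A[measurable]: "A \<in> sets borel"
  shows "(\<lambda>y. \<integral>\<^sup>+ u. indicator A u * likelihood V t n ((u + (\<Sum>i=1..n-1. y i)) / n) \<partial>normal_measure 0 (sqrt (1 + t)))
    \<in> borel_measurable (borel_Rn (n - 1))"
proof -
  interpret prob_space "normal_measure 0 (sqrt (1 + t))"
    using t_pos by (intro prob_space_normal_density) simp
  show ?thesis by measurable
qed

lemma first_spin_rcp_kernel:
  assumes n: "0 < n"
  shows "first_spin_rcp n (time_evolved V t n) (first_spin_kernel V t n)"
  unfolding first_spin_rcp_def
proof (intro conjI ballI)
  let ?N = "normal_Rn (n - 1) (\<lambda>_. 0) (1 + t)"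
  show kernel: "first_spin_kernel V t n \<in> borel_Rn (n - 1) \<rightarrow>\<^sub>M subprob_algebra borel"
  proof (rule measurable_subprob_algebra)
    show "subprob_space (first_spin_kernel V t n y)" for y
      by (rule prob_space_imp_subprob_space[OF prob_space_first_spin_kernel[OF n]])
    fix A :: "real set" assume A: "A \<in> sets borel"
    note [measurable] = measurable_first_spin_kernel_numerator[OF A]
    show "(\<lambda>y. emeasure (first_spin_kernel V t n y) A) \<in> borel_measurable (borel_Rn (n - 1))"
      unfolding emeasure_first_spin_kernel[OF n A] by measurable
  qed simp
  fix A :: "real set" and B :: "(nat \<Rightarrow> real) set"
  assume A: "A \<in> sets borel" and B[measurable]: "B \<in> sets (borel_Rn (n - 1))"
  note [measurable] = measurable_first_spin_kernel_numerator[OF A]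
  have [measurable]: "(\<lambda>y. emeasure (first_spin_kernel V t n y) A) \<in> borel_measurable (borel_Rn (n - 1))"
    unfolding emeasure_first_spin_kernel[OF n A] by measurable
  have "(\<integral>\<^sup>+ y. indicator B y * emeasure (first_spin_kernel V t n y) A \<partial>other_spins_law n) =
    (\<integral>\<^sup>+ y. likelihood_average V t n (\<Sum>i=1..n-1. y i) / norm_const V n *
      (indicator B y * emeasure (first_spin_kernel V t n y) A) \<partial>?N)"
    unfolding other_spins_law_eq_density[OF n] by (rule nn_integral_density) measurable
  also have "\<dots> = (\<integral>\<^sup>+ y. indicator B y * (\<integral>\<^sup>+ u. indicator A u * likelihood V t n ((u + (\<Sum>i=1..n-1. y i)) / n)
        \<partial>normal_measure 0 (sqrt (1 + t))) / norm_const V n \<partial>?N)"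
  proof (rule nn_integral_cong)
    fix y
    \<comment> \<open>The marginal density contributes the very factor by which the kernel divides.
      Cancelling it in \<open>ennreal\<close> is sound because it is positive and at most 1.\<close>
    have cancel: "d / z * (b * (x / d)) = b * x / z" if "0 < d" "d \<le> 1" for d z b x :: ennreal
    proof -
      have "d / z * (b * (x / d)) = b * x / z * (d / d)" by (simp add: divide_ennreal_def mult_ac)
      also have "d / d = 1" using that by (intro ennreal_divide_self) (auto dest: le_less_trans[OF _ ennreal_one_less_top])
      finally show ?thesis by simp
    qed
    show "likelihood_average V t n (\<Sum>i=1..n-1. y i) / norm_const V n *
      (indicator B y * emeasure (first_spin_kernel V t n y) A) =
      indicator B y * (\<integral>\<^sup>+ u. indicator A u * likelihood V t n ((u + (\<Sum>i=1..n-1. y i)) / n)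
        \<partial>normal_measure 0 (sqrt (1 + t))) / norm_const V n"
      unfolding emeasure_first_spin_kernel[OF n A] by (rule cancel[OF likelihood_average_bounds[OF n]])
  qed
  also have "\<dots> = emeasure (time_evolved V t n) {x \<in> space (borel_Rn n). x 1 \<in> A \<and> other_spins n x \<in> B}"
    unfolding emeasure_time_evolved_split[OF n A B] divide_ennreal_def
    by (rule nn_integral_multc) measurable
  finally show "emeasure (time_evolved V t n) {x \<in> space (borel_Rn n). x 1 \<in> A \<and> other_spins n x \<in> B} =
    (\<integral>\<^sup>+ y. indicator B y * emeasure (first_spin_kernel V t n y) A \<partial>other_spins_law n)" by simp
qed

end

section \<open>Support, continuity and uniqueness\<close>

lemma emeasure_normal_measure_open_pos:
  assumes U: "open U" "x \<in> U" and s: "0 < s"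
  shows "0 < emeasure (normal_measure m s) U"
proof -
  obtain e where e: "0 < e" "ball x e \<subseteq> U" using U openE by blast
  have [measurable]: "U \<in> sets borel" using U(1) by (rule borel_open)
  have "emeasure (normal_measure m s) U \<noteq> 0"
  proof
    assume "emeasure (normal_measure m s) U = 0"
    then have "AE y in lborel. ennreal (normal_density m s y) * indicator U y = 0"
      by (simp add: emeasure_density nn_integral_0_iff_AE)
    then have "AE y in lborel. y \<notin> U"
      by eventually_elim (use normal_density_pos[OF s, of m] in \<open>auto simp: indicator_def less_le split: if_splits\<close>)
    then have "U \<in> null_sets lborel" using AE_iff_null_sets[of U lborel] by simp
    moreover have "emeasure lborel {x - e<..<x + e} \<le> emeasure lborel U"
    proof (rule emeasure_mono)
      have "{x - e<..<x + e} \<subseteq> ball x e" by (auto simp: dist_real_def)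
      then show "{x - e<..<x + e} \<subseteq> U" using e(2) by (rule subset_trans)
    qed simp
    ultimately show False using e(1) by (auto simp: null_sets_def)
  qed
  then show ?thesis by (simp add: zero_less_iff_neq_zero)
qed

lemma emeasure_normal_Rn_open_pos:
  assumes U: "openin (top_Rn n) U" "x \<in> U" and t: "0 < t" and A: "U \<subseteq> A" "A \<in> sets (borel_Rn n)"
  shows "0 < emeasure (normal_Rn n v t) A"
proof -
  interpret N: product_sigma_finite "\<lambda>i. normal_measure (v i) (sqrt t)"
    using t by (auto simp: product_sigma_finite_def intro!: prob_space_imp_sigma_finite prob_space_normal_density)
  obtain W where W: "\<And>i. i \<in> {1..n} \<Longrightarrow> open (W i)" "x \<in> Pi\<^sub>E {1..n} W" "Pi\<^sub>E {1..n} W \<subseteq> U"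
    using U unfolding openin_product_topology_alt by (metis open_openin)
  have "0 < (\<Prod>i=1..n. emeasure (normal_measure (v i) (sqrt t)) (W i))"
  proof -
    have "emeasure (normal_measure (v i) (sqrt t)) (W i) \<noteq> 0" if i: "i \<in> {1..n}" for i
      using emeasure_normal_measure_open_pos[OF W(1)[OF i], of "x i" "sqrt t" "v i"] PiE_mem[OF W(2) i] t by auto
    then have "(\<Prod>i=1..n. emeasure (normal_measure (v i) (sqrt t)) (W i)) \<noteq> 0" by (simp add: prod_zero_iff)
    then show ?thesis by (simp add: zero_less_iff_neq_zero)
  qed
  also have "\<dots> = emeasure (normal_Rn n v t) (Pi\<^sub>E {1..n} W)"
    unfolding normal_Rn_def using W(1) by (intro N.emeasure_PiM[symmetric]) auto
  also have "\<dots> \<le> emeasure (normal_Rn n v t) A"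
    using W(3) A by (intro emeasure_mono) auto
  finally show ?thesis .
qed

text \<open>For the product over all indices, the product sigma-algebra is known to be the Borel
  one. Extension by zero embeds the finite product there, and restriction pulls the open set back
  along a continuous map.\<close>

lemma sets_borel_Rn_openin:
  assumes U: "openin (top_Rn n) U"
  shows "U \<in> sets (borel_Rn n)"
proof -
  define g where "g = (\<lambda>(x :: nat \<Rightarrow> real) i. if i \<in> {1..n} then x i else 0)"
  have "continuous_map (product_topology (\<lambda>_. euclideanreal) UNIV) (top_Rn n) (\<lambda>x. restrict x {1..n})"
    unfolding continuous_map_componentwise by (auto intro: continuous_map_product_projection)
  then have "openin (product_topology (\<lambda>_. euclideanreal) UNIV)
      {x \<in> topspace (product_topology (\<lambda>_. euclideanreal) UNIV). restrict x {1..n} \<in> U}"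
    using U by (rule openin_continuous_map_preimage)
  then have "open {x :: nat \<Rightarrow> real. restrict x {1..n} \<in> U}"
    unfolding euclidean_product_topology by simp
  then have H: "{x :: nat \<Rightarrow> real. restrict x {1..n} \<in> U} \<in> sets (\<Pi>\<^sub>M i\<in>UNIV. borel)"
    unfolding sets_PiM_equal_borel by (rule borel_open)
  have "g \<in> borel_Rn n \<rightarrow>\<^sub>M (\<Pi>\<^sub>M i\<in>UNIV. borel)"
  proof (rule measurable_PiM_single')
    show "(\<lambda>x. g x i) \<in> borel_Rn n \<rightarrow>\<^sub>M borel" for i
      by (cases "i \<in> {1..n}") (auto simp: g_def intro: measurable_component_singleton)
  qed auto
  then have "g -` {x. restrict x {1..n} \<in> U} \<inter> space (borel_Rn n) \<in> sets (borel_Rn n)"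
    using H by (rule measurable_sets)
  also have "g -` {x. restrict x {1..n} \<in> U} \<inter> space (borel_Rn n) = U"
  proof -
    have "restrict (g x) {1..n} = x" if "x \<in> space (borel_Rn n)" for x
      using that by (auto simp: g_def space_PiM PiE_def extensional_def restrict_def)
    moreover have "U \<subseteq> space (borel_Rn n)"
      using openin_subset[OF U] by (simp add: space_PiM)
    ultimately show ?thesis by auto
  qed
  finally show ?thesis .
qed

text \<open>Here \<open>g\<close> is merely measurable, as the Gibbs weight of a lower
  semicontinuous \<open>V\<close> need not be continuous. Continuity therefore has to come from the
  density, and a dominating function uniform in the mean is required.\<close>

lemma isCont_integral_normal_measure_mean:
  assumes [measurable]: "g \<in> borel_measurable borel" and bound: "\<And>x. \<bar>g x\<bar> \<le> (B::real)" and s: "0 < s"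
  shows "isCont (\<lambda>m. LINT x|normal_measure m s. g x) m0"
proof -
  have eq: "(LINT x|normal_measure m s. g x) = (LINT x|lborel. normal_density m s x * g x)" for m
    by (subst integral_density) auto
  \<comment> \<open>Doubling the variance leaves room for a shift of the mean by at most 1, because
    (x - m0)^2 is at most 2 (x - m)^2 + 2 (m - m0)^2.\<close>
  have le: "normal_density m s x \<le> sqrt 2 * exp (1 / (2 * s\<^sup>2)) * normal_density m0 (sqrt 2 * s) x"
    if "\<bar>m - m0\<bar> \<le> 1" for m x
  proof -
    have "(m - m0)\<^sup>2 \<le> 1" using that by (simp add: abs_square_le_1)
    moreover have "0 \<le> (x + m0 - 2 * m)\<^sup>2" by simp
    then have "(x - m0)\<^sup>2 \<le> 2 * (x - m)\<^sup>2 + 2 * (m - m0)\<^sup>2" by (simp add: power2_eq_square algebra_simps)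
    ultimately have "(x - m0)\<^sup>2 / 2 - 1 \<le> (x - m)\<^sup>2" by linarith
    then have "- (x - m)\<^sup>2 / (2 * s\<^sup>2) \<le> (1 - (x - m0)\<^sup>2 / 2) / (2 * s\<^sup>2)"
      by (intro divide_right_mono) auto
    also have "\<dots> = 1 / (2 * s\<^sup>2) + - (x - m0)\<^sup>2 / (2 * (sqrt 2 * s)\<^sup>2)"
      by (simp add: diff_divide_distrib power_mult_distrib)
    finally have "exp (- (x - m)\<^sup>2 / (2 * s\<^sup>2)) \<le> exp (1 / (2 * s\<^sup>2)) * exp (- (x - m0)\<^sup>2 / (2 * (sqrt 2 * s)\<^sup>2))"
      by (simp flip: exp_add)
    moreover have "1 / sqrt (2 * pi * s\<^sup>2) = sqrt 2 * (1 / sqrt (2 * pi * (sqrt 2 * s)\<^sup>2))"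
    proof -
      have "sqrt (2 * pi * (sqrt 2 * s)\<^sup>2) = sqrt 2 * sqrt (2 * pi * s\<^sup>2)"
        by (simp add: power_mult_distrib real_sqrt_mult)
      then show ?thesis by simp
    qed
    ultimately show ?thesis
      unfolding normal_density_def
      by (simp only: mult.assoc mult.left_commute[of "exp (1 / (2 * s\<^sup>2))"])
         (intro mult_left_mono, auto)
  qed
  have "0 \<le> B" using bound[of 0] by simp
  show ?thesis
    unfolding eq continuous_at_sequentially comp_def
  proof (intro allI impI)
    fix u assume u: "u \<longlonglongrightarrow> m0"
    then have "\<forall>\<^sub>F n in sequentially. dist (u n) m0 < 1" by (rule tendstoD) simp
    then obtain N where N: "\<And>n. N \<le> n \<Longrightarrow> \<bar>u n - m0\<bar> \<le> 1"
      unfolding eventually_sequentially dist_real_def by (meson less_imp_le)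
    have "(\<lambda>n. LINT x|lborel. normal_density (u (n + N)) s x * g x) \<longlonglongrightarrow> (LINT x|lborel. normal_density m0 s x * g x)"
    proof (rule integral_dominated_convergence)
      show "integrable lborel (\<lambda>x. sqrt 2 * exp (1 / (2 * s\<^sup>2)) * normal_density m0 (sqrt 2 * s) x * B)"
        using s by (intro integrable_mult_left integrable_mult_right integrable_normal_density) simp
      have "(\<lambda>n. u (n + N)) \<longlonglongrightarrow> m0" using u by (rule LIMSEQ_ignore_initial_segment)
      then show "AE x in lborel. (\<lambda>n. normal_density (u (n + N)) s x * g x) \<longlonglongrightarrow> normal_density m0 s x * g x"
        unfolding normal_density_def using s by (intro AE_I2 tendsto_intros) auto
      show "AE x in lborel. norm (normal_density (u (n + N)) s x * g x) \<le>
          sqrt 2 * exp (1 / (2 * s\<^sup>2)) * normal_density m0 (sqrt 2 * s) x * B" for n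
        using le[OF N[of "n + N"]] bound \<open>0 \<le> B\<close>
        by (auto simp: abs_mult intro!: mult_mono mult_nonneg_nonneg)
    qed auto
    then show "(\<lambda>n. LINT x|lborel. normal_density (u n) s x * g x) \<longlonglongrightarrow> (LINT x|lborel. normal_density m0 s x * g x)"
      by (rule LIMSEQ_offset)
  qed
qed

context mean_field_dynamics
begin

text \<open>The law of the other spins has a nowhere vanishing density with respect to a normal law,
  which charges every nonempty open set.\<close>

lemma emeasure_other_spins_law_open_pos:
  assumes n: "0 < n" and U: "openin (top_Rn (n - 1)) U" "x \<in> U"
    and A: "U \<subseteq> A" "A \<in> sets (borel_Rn (n - 1))"
  shows "0 < emeasure (other_spins_law n) A"
proof -
  let ?N = "normal_Rn (n - 1) (\<lambda>_. 0) (1 + t)"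
  let ?d = "\<lambda>y. likelihood_average V t n (\<Sum>i=1..n-1. y i) / norm_const V n"
  note [measurable] = A(2)
  have A': "A \<in> sets ?N" using A(2) by simp
  have d: "?d \<in> borel_measurable ?N" by measurable
  have pos: "?d y \<noteq> 0" for y
    using likelihood_average_bounds(1)[OF n, of "\<Sum>i=1..n-1. y i"] norm_const_bounds(2)[of n]
    by (auto simp: divide_ennreal_def)
  have "emeasure (other_spins_law n) A \<noteq> 0"
  proof
    assume "emeasure (other_spins_law n) A = 0"
    then have "(\<integral>\<^sup>+ y. ?d y * indicator A y \<partial>?N) = 0"
      unfolding other_spins_law_eq_density[OF n] emeasure_density[OF d A'] .
    then have "AE y in ?N. ?d y * indicator A y = 0"
      by (subst (asm) nn_integral_0_iff_AE) measurable
    then have "AE y in ?N. y \<notin> A"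
      by eventually_elim (use pos in \<open>auto simp: indicator_def split: if_splits\<close>)
    then have "emeasure ?N A = 0"
      using A' AE_iff_null_sets[of A ?N] by (auto simp: null_sets_def)
    then show False using emeasure_normal_Rn_open_pos[OF U _ A, of "1 + t" "\<lambda>_. 0"] t_pos by simp
  qed
  then show ?thesis by (simp add: zero_less_iff_neq_zero)
qed

text \<open>The support is the whole space, so properness imposes no zero measures.\<close>

lemma proper_rcp_kernel:
  assumes n: "0 < n"
  shows "proper_rcp n (time_evolved V t n) (first_spin_kernel V t n)"
proof -
  have "y \<in> support_Rn (n - 1) (other_spins_law n)" if "y \<in> space (borel_Rn (n - 1))" for y
    using that emeasure_other_spins_law_open_pos[OF n _ _ order_refl sets_borel_Rn_openin]
    unfolding support_Rn_def by (auto simp: space_PiM)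
  then show ?thesis unfolding proper_rcp_def by blast
qed

text \<open>Real-valued twin of \<open>likelihood\<close> for \<open>0 < n\<close>, needed for
  Bochner integrals and for continuity in \<open>m\<close>.\<close>

definition likelihood_real :: "nat \<Rightarrow> real \<Rightarrow> real" where
  "likelihood_real n m = (LINT r|normal_measure (m / (1 + t)) (sqrt (t / (1 + t) / n)). exp (- real n * V r))"

lemma likelihood_real:
  assumes n: "0 < n"
  shows "likelihood V t n m = ennreal (likelihood_real n m)" "0 < likelihood_real n m" "likelihood_real n m \<le> 1"
    "isCont (likelihood_real n) m"
proof -
  let ?s = "sqrt (t / (1 + t) / n)"
  have s: "0 < ?s" using n t_pos by simp
  interpret prob_space "normal_measure (m / (1 + t)) ?s" by (intro prob_space_normal_density s)
  have "integrable (normal_measure (m / (1 + t)) ?s) (\<lambda>r. exp (- real n * V r))"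
    using V_nonneg by (intro integrable_const_bound[of _ 1]) auto
  then show eq: "likelihood V t n m = ennreal (likelihood_real n m)"
    unfolding likelihood_def likelihood_real_def
    by (subst nn_integral_density[symmetric]) (auto intro: nn_integral_eq_integral)
  show "0 < likelihood_real n m" using likelihood_pos[OF n, of m] unfolding eq by simp
  show "likelihood_real n m \<le> 1"
    using likelihood_le_1[OF n, of m] unfolding eq by (simp add: ennreal_le_1)
  have "isCont (\<lambda>m. LINT r|normal_measure m ?s. exp (- real n * V r)) (m / (1 + t))"
    using V_nonneg by (intro isCont_integral_normal_measure_mean[of _ 1] s) auto
  moreover have "isCont (\<lambda>m. m / (1 + t)) m" using t_pos by (intro isCont_divide continuous_ident continuous_const) simp
  ultimately have "isCont (\<lambda>m. LINT r|normal_measure (m / (1 + t)) ?s. exp (- real n * V r)) m"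
    by (rule isCont_o2[rotated])
  then show "isCont (likelihood_real n) m" unfolding likelihood_real_def .
qed

lemma likelihood_real_measurable [measurable]: "0 < n \<Longrightarrow> likelihood_real n \<in> borel_measurable borel"
  by (intro borel_measurable_continuous_onI continuous_at_imp_continuous_on ballI likelihood_real)

lemma average_real:
  assumes n: "0 < n"
  shows "likelihood_average V t n s = ennreal (LINT u|normal_measure 0 (sqrt (1 + t)). likelihood_real n ((u + s) / n))"
    and average_real_pos: "0 < (LINT u|normal_measure 0 (sqrt (1 + t)). likelihood_real n ((u + s) / n))"
proof -
  let ?N = "normal_measure 0 (sqrt (1 + t))"
  let ?L = "\<lambda>u. likelihood_real n ((u + s) / n)"
  interpret prob_space ?N using t_pos by (intro prob_space_normal_density) simp
  note [measurable] = likelihood_real_measurable[OF n]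
  have "integrable ?N ?L"
    using likelihood_real(2,3)[OF n] by (intro integrable_const_bound[of _ 1]) (auto simp: less_imp_le)
  then show D: "likelihood_average V t n s = ennreal (LINT u|?N. ?L u)"
    unfolding likelihood_average_def likelihood_real(1)[OF n]
    using likelihood_real(2)[OF n] by (intro nn_integral_eq_integral) (auto simp: less_imp_le)
  show "0 < (LINT u|?N. ?L u)" using likelihood_average_bounds(1)[OF n, of s] unfolding D by simp
qed

lemma integral_first_spin_kernel:
  assumes n: "0 < n" and f[measurable]: "f \<in> borel_measurable borel"
  shows "(LINT u|first_spin_kernel V t n y. f u) =
    (LINT u|normal_measure 0 (sqrt (1 + t)). likelihood_real n ((u + (\<Sum>i=1..n-1. y i)) / n) * f u) /
    (LINT u|normal_measure 0 (sqrt (1 + t)). likelihood_real n ((u + (\<Sum>i=1..n-1. y i)) / n))"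
    (is "_ = ?num / ?D")
proof -
  let ?N = "normal_measure 0 (sqrt (1 + t))"
  let ?L = "\<lambda>u. likelihood_real n ((u + (\<Sum>i=1..n-1. y i)) / n)"
  interpret prob_space ?N using t_pos by (intro prob_space_normal_density) simp
  note [measurable] = likelihood_real_measurable[OF n]
  note D = average_real(1)[OF n, of "\<Sum>i=1..n-1. y i"]
  note pos = average_real_pos[OF n, of "\<Sum>i=1..n-1. y i"]
  have "first_spin_kernel V t n y = density ?N (\<lambda>u. ennreal (?L u / ?D))"
    unfolding first_spin_kernel_def D likelihood_real(1)[OF n]
    using likelihood_real(2)[OF n] pos by (simp add: divide_ennreal less_imp_le)
  then have "(LINT u|first_spin_kernel V t n y. f u) = (LINT u|?N. ?L u / ?D * f u)"
    using likelihood_real(2)[OF n] pos by (simp only:) (subst integral_density, auto simp: less_imp_le)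
  also have "\<dots> = (LINT u|?N. ?L u * f u / ?D)" by simp
  also have "\<dots> = ?num / ?D" by (rule integral_divide_zero)
  finally show "(LINT u|first_spin_kernel V t n y. f u) = ?num / ?D" .
qed

text \<open>Integrals against the kernel are quotients of two continuous functions of the sum of the
  spins, with positive denominator; this reduces the claim to one real variable.\<close>

lemma weakly_continuous_kernel:
  assumes n: "0 < n"
  shows "weakly_continuous n (first_spin_kernel V t n)"
  unfolding weakly_continuous_def
proof (intro allI impI, elim conjE)
  fix f :: "real \<Rightarrow> real" assume f: "continuous_on UNIV f" "bounded (range f)"
  let ?N = "normal_measure 0 (sqrt (1 + t))"
  interpret prob_space ?N using t_pos by (intro prob_space_normal_density) simp
  have f_meas: "f \<in> borel_measurable borel" using f(1) by (rule borel_measurable_continuous_onI)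
  define num where "num = (\<lambda>(h :: real \<Rightarrow> real) s. LINT u|?N. likelihood_real n ((u + s) / n) * h u)"
  note [measurable] = likelihood_real_measurable[OF n]
  have cont: "isCont (num h) s0" if h[measurable]: "h \<in> borel_measurable borel" and hb: "bounded (range h)" for h s0
  proof -
    obtain B where B: "\<And>u. \<bar>h u\<bar> \<le> B" using hb by (auto simp: bounded_iff)
    then have "0 \<le> B" by (meson abs_ge_zero order_trans)
    show ?thesis
      unfolding continuous_at_sequentially comp_def num_def
    proof (intro allI impI, rule integral_dominated_convergence)
      fix x :: "nat \<Rightarrow> real" assume x: "x \<longlonglongrightarrow> s0"
      show "integrable ?N (\<lambda>_. 1 * B)" by simp
      have "(\<lambda>k. likelihood_real n ((u + x k) / n)) \<longlonglongrightarrow> likelihood_real n ((u + s0) / n)" for u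
        using n by (intro isCont_tendsto_compose[OF likelihood_real(4)[OF n]] tendsto_intros x) auto
      then show "AE u in ?N. (\<lambda>k. likelihood_real n ((u + x k) / n) * h u) \<longlonglongrightarrow> likelihood_real n ((u + s0) / n) * h u"
        by (intro AE_I2 tendsto_mult tendsto_const)
      show "AE u in ?N. norm (likelihood_real n ((u + x k) / n) * h u) \<le> 1 * B" for k
      proof (rule AE_I2)
        fix u
        have "likelihood_real n ((u + x k) / n) * \<bar>h u\<bar> \<le> 1 * B"
          using B by (intro mult_mono likelihood_real(3)[OF n]) auto
        then show "norm (likelihood_real n ((u + x k) / n) * h u) \<le> 1 * B"
          using likelihood_real(2)[OF n, of "(u + x k) / n"] by (simp add: abs_mult)
      qed
    qed auto
  qed
  have "continuous_on UNIV (\<lambda>s. num f s / num (\<lambda>_. 1) s)"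
  proof (intro continuous_at_imp_continuous_on ballI continuous_divide)
    show "isCont (num f) s" "isCont (num (\<lambda>_. 1)) s" for s
      using cont[OF f_meas f(2)] cont[of "\<lambda>_. 1"] by auto
    show "num (\<lambda>_. 1) s \<noteq> 0" for s
      using average_real_pos[OF n, of s] by (simp add: num_def)
  qed
  then have "continuous_map euclideanreal euclideanreal (\<lambda>s. num f s / num (\<lambda>_. 1) s)" by simp
  moreover have "continuous_map (top_Rn (n - 1)) euclideanreal (\<lambda>y. \<Sum>i=1..n-1. y i)"
    by (intro continuous_map_sum continuous_map_product_projection) auto
  ultimately have "continuous_map (top_Rn (n - 1)) euclideanreal
      ((\<lambda>s. num f s / num (\<lambda>_. 1) s) \<circ> (\<lambda>y. \<Sum>i=1..n-1. y i))"
    by (rule continuous_map_compose[rotated])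
  then show "continuous_map (top_Rn (n - 1)) euclideanreal (\<lambda>y. LINT u|first_spin_kernel V t n y. f u)"
    by (simp add: comp_def num_def integral_first_spin_kernel[OF n f_meas])
qed

end

lemma first_spin_rcpD:
  assumes "first_spin_rcp n \<rho> \<gamma>" "A \<in> sets borel" "B \<in> sets (borel_Rn (n - 1))"
  shows "emeasure \<rho> {x \<in> space (borel_Rn n). x 1 \<in> A \<and> other_spins n x \<in> B} =
    (\<integral>\<^sup>+ y. indicator B y * emeasure (\<gamma> y) A \<partial>distr \<rho> (borel_Rn (n - 1)) (other_spins n))"
  using assms unfolding first_spin_rcp_def by blast

context mean_field_dynamics
begin

lemma prob_space_other_spins_law:
  "prob_space (other_spins_law n)"
proof -
  have sets: "sets (time_evolved V t n) = sets (borel_Rn n)"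
    by (rule sets_time_evolved[OF V_nonneg V_lsc t_pos])
  have "other_spins n \<in> time_evolved V t n \<rightarrow>\<^sub>M borel_Rn (n - 1)"
    using measurable_other_spins measurable_cong_sets[OF sets refl] by blast
  then show ?thesis
    by (rule prob_space.prob_space_distr[OF prob_space_time_evolved[OF V_nonneg V_lsc t_pos]])
qed

text \<open>The defining identity concerns indicators of \<open>A\<close> only. For fixed
  \<open>B\<close> it says that two mixtures over the law restricted to \<open>B\<close> coincide as
  measures, so they integrate every \<open>f\<close> alike; varying \<open>B\<close> then identifies
  two densities.\<close>

lemma first_spin_rcp_AE_unique:
  assumes rcp: "first_spin_rcp n (time_evolved V t n) \<gamma>" "first_spin_rcp n (time_evolved V t n) \<gamma>'"
    and f[measurable]: "f \<in> borel_measurable borel"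
  shows "AE y in other_spins_law n. (\<integral>\<^sup>+ u. f u \<partial>\<gamma> y) = (\<integral>\<^sup>+ u. f u \<partial>\<gamma>' y)"
proof -
  let ?P = "other_spins_law n"
  interpret P: prob_space ?P by (rule prob_space_other_spins_law)
  have kernels: "\<gamma> \<in> borel_Rn (n - 1) \<rightarrow>\<^sub>M subprob_algebra borel" "\<gamma>' \<in> borel_Rn (n - 1) \<rightarrow>\<^sub>M subprob_algebra borel"
    using rcp by (auto simp: first_spin_rcp_def)
  have meas: "(\<lambda>y. \<integral>\<^sup>+ u. f u \<partial>\<gamma> y) \<in> borel_measurable ?P" "(\<lambda>y. \<integral>\<^sup>+ u. f u \<partial>\<gamma>' y) \<in> borel_measurable ?P"
    using measurable_compose[OF kernels(1) nn_integral_measurable_subprob_algebra[OF f]]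
      measurable_compose[OF kernels(2) nn_integral_measurable_subprob_algebra[OF f]] by auto
  have "density ?P (\<lambda>y. \<integral>\<^sup>+ u. f u \<partial>\<gamma> y) = density ?P (\<lambda>y. \<integral>\<^sup>+ u. f u \<partial>\<gamma>' y)"
  proof (rule measure_eqI)
    fix B assume "B \<in> sets (density ?P (\<lambda>y. \<integral>\<^sup>+ u. f u \<partial>\<gamma> y))"
    then have B[measurable]: "B \<in> sets (borel_Rn (n - 1))" by simp
    have B': "B \<in> sets ?P" using B by (simp only: sets_distr)
    \<comment> \<open>Restricting the law to \<open>B\<close> turns the identity for all
      \<open>A\<close> into an equation between \<open>M \<bind> \<gamma>\<close> and
      \<open>M \<bind> \<gamma>'\<close>.\<close>
    define M where "M = density ?P (indicator B)"
    have sets_M: "sets M = sets (borel_Rn (n - 1))" by (simp add: M_def)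
    have ne: "space M \<noteq> {}" by (simp add: M_def space_PiM PiE_eq_empty_iff)
    have k: "\<gamma> \<in> M \<rightarrow>\<^sub>M subprob_algebra borel" "\<gamma>' \<in> M \<rightarrow>\<^sub>M subprob_algebra borel"
      using kernels by (simp_all add: measurable_cong_sets[OF sets_M refl])
    have int: "(\<integral>\<^sup>+ y. g y \<partial>M) = (\<integral>\<^sup>+ y. indicator B y * g y \<partial>?P)"
      if "g \<in> borel_measurable (borel_Rn (n - 1))" for g
      unfolding M_def by (rule nn_integral_density) (use that in measurable)
    have "M \<bind> \<gamma> = M \<bind> \<gamma>'"
    proof (rule measure_eqI)
      show sets_eq: "sets (M \<bind> \<gamma>) = sets (M \<bind> \<gamma>')"
        using sets_bind[OF sets_kernel[OF k(1)] ne] sets_bind[OF sets_kernel[OF k(2)] ne] by simp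
      fix A assume "A \<in> sets (M \<bind> \<gamma>)"
      then have A: "A \<in> sets borel" using sets_bind[OF sets_kernel[OF k(1)] ne] by simp
      have em: "(\<lambda>y. emeasure (\<gamma> y) A) \<in> borel_measurable (borel_Rn (n - 1))"
        "(\<lambda>y. emeasure (\<gamma>' y) A) \<in> borel_measurable (borel_Rn (n - 1))"
        using measurable_emeasure_kernel[OF kernels(1) A] measurable_emeasure_kernel[OF kernels(2) A] .
      show "emeasure (M \<bind> \<gamma>) A = emeasure (M \<bind> \<gamma>') A"
        unfolding emeasure_bind[OF ne k(1) A] emeasure_bind[OF ne k(2) A] int[OF em(1)] int[OF em(2)]
        unfolding first_spin_rcpD[OF rcp(1) A B, symmetric] first_spin_rcpD[OF rcp(2) A B, symmetric] ..
    qed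
    then have "(\<integral>\<^sup>+ y. (\<integral>\<^sup>+ u. f u \<partial>\<gamma> y) \<partial>M) = (\<integral>\<^sup>+ y. (\<integral>\<^sup>+ u. f u \<partial>\<gamma>' y) \<partial>M)"
      using nn_integral_bind[OF f k(1)] nn_integral_bind[OF f k(2)] by simp
    then have "(\<integral>\<^sup>+ y. indicator B y * (\<integral>\<^sup>+ u. f u \<partial>\<gamma> y) \<partial>?P) = (\<integral>\<^sup>+ y. indicator B y * (\<integral>\<^sup>+ u. f u \<partial>\<gamma>' y) \<partial>?P)"
      using meas by (simp add: int)
    then show "emeasure (density ?P (\<lambda>y. \<integral>\<^sup>+ u. f u \<partial>\<gamma> y)) B = emeasure (density ?P (\<lambda>y. \<integral>\<^sup>+ u. f u \<partial>\<gamma>' y)) B"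
      unfolding emeasure_density[OF meas(1) B'] emeasure_density[OF meas(2) B'] by (simp only: mult.commute)
  qed simp
  then show ?thesis by (rule P.density_unique_iff[OF meas, THEN iffD1])
qed

text \<open>The configurations where the two integrals differ form an open set, which is null by
  almost sure uniqueness; a nonempty open set would have positive mass.\<close>

lemma weakly_continuous_rcp_unique:
  fixes f :: "real \<Rightarrow> real"
  assumes n: "0 < n"
    and rcp: "first_spin_rcp n (time_evolved V t n) \<gamma>" "first_spin_rcp n (time_evolved V t n) \<gamma>'"
    and cont: "weakly_continuous n \<gamma>" "weakly_continuous n \<gamma>'"
    and f: "continuous_on UNIV f" "bounded (range f)" "\<And>u. 0 \<le> f u"
    and y: "y \<in> space (borel_Rn (n - 1))"
  shows "(LINT u|\<gamma> y. f u) = (LINT u|\<gamma>' y. f u)"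
proof (rule ccontr)
  let ?q = "\<lambda>y. (LINT u|\<gamma> y. f u) - (LINT u|\<gamma>' y. f u)"
  assume neq: "(LINT u|\<gamma> y. f u) \<noteq> (LINT u|\<gamma>' y. f u)"
  have f_meas: "f \<in> borel_measurable borel" using f(1) by (rule borel_measurable_continuous_onI)
  define U where "U = {y \<in> topspace (top_Rn (n - 1)). ?q y \<in> - {0}}"
  have "continuous_map (top_Rn (n - 1)) euclideanreal ?q"
    using cont f(1,2) unfolding weakly_continuous_def by (intro continuous_map_diff) auto
  then have U: "openin (top_Rn (n - 1)) U"
    unfolding U_def by (rule openin_continuous_map_preimage) (simp add: open_Compl)
  moreover have "y \<in> U" using y neq by (auto simp: U_def space_PiM)
  ultimately have pos: "0 < emeasure (other_spins_law n) U"
    by (rule emeasure_other_spins_law_open_pos[OF n _ _ order_refl sets_borel_Rn_openin[OF U]])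
  have kernel: "sets (\<kappa> y) = sets borel" if "first_spin_rcp n (time_evolved V t n) \<kappa>" "y \<in> space (borel_Rn (n - 1))" for \<kappa> y
    using that sets_kernel[of \<kappa> "borel_Rn (n - 1)" borel] by (auto simp: first_spin_rcp_def)
  \<comment> \<open>Nonnegativity of \<open>f\<close> is what links the Bochner integral to the
    nonnegative integral of the almost sure statement.\<close>
  have lint: "(LINT u|\<kappa> y. f u) = enn2real (\<integral>\<^sup>+ u. ennreal (f u) \<partial>\<kappa> y)"
    if "first_spin_rcp n (time_evolved V t n) \<kappa>" "y \<in> space (borel_Rn (n - 1))" for \<kappa> y
    using f(3) f_meas by (intro integral_eq_nn_integral) (auto simp: measurable_cong_sets[OF kernel[OF that] refl])
  have "AE y in other_spins_law n. (\<integral>\<^sup>+ u. ennreal (f u) \<partial>\<gamma> y) = (\<integral>\<^sup>+ u. ennreal (f u) \<partial>\<gamma>' y)"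
    using f_meas by (intro first_spin_rcp_AE_unique[OF rcp]) auto
  then have "AE y in other_spins_law n. y \<notin> U"
    by (rule AE_mp, intro AE_I2 impI) (auto simp: U_def lint[OF rcp(1)] lint[OF rcp(2)])
  then have "emeasure (other_spins_law n) U = 0"
    using sets_borel_Rn_openin[OF U] AE_iff_null_sets[of U "other_spins_law n"] by (auto simp: null_sets_def)
  then show False using pos by simp
qed

section \<open>Exchanging the first spin with the initial magnetisation\<close>

definition field_center :: "nat \<Rightarrow> real \<Rightarrow> real" where
  "field_center n s = s / (n * (1 + t))"

text \<open>With \<open>spin_slope\<close> and \<open>spin_deviation\<close>, the parameters left by
  completing the square in \<open>normal_density_exchange\<close>. The Gaussian factor in
  \<open>r\<close> has variance \<open>1 / (2 * n * field_curvature n)\<close>; given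
  \<open>r\<close>, the first spin is normal with a mean linear in \<open>r\<close> and variance
  \<open>t * spin_slope n\<close>.\<close>

definition field_curvature :: "nat \<Rightarrow> real" where
  "field_curvature n = n * (1 + t) / (2 * (n * t + 1))"

definition spin_slope :: "nat \<Rightarrow> real" where
  "spin_slope n = n * (1 + t) / (n * t + 1)"

definition spin_deviation :: "nat \<Rightarrow> real" where
  "spin_deviation n = sqrt (t * spin_slope n)"

lemma spin_params_pos:
  assumes "0 < n"
  shows "0 < field_curvature n" "0 < spin_slope n" "0 < spin_deviation n"
proof -
  have "0 < n * t + 1" using assms t_pos by (intro add_nonneg_pos) auto
  then show "0 < field_curvature n" "0 < spin_slope n" "0 < spin_deviation n"
    using assms t_pos by (auto simp: field_curvature_def spin_slope_def spin_deviation_def intro!: divide_pos_pos mult_pos_pos)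
qed

text \<open>\<open>normal_density_bayes\<close> with the first spin \<open>u\<close> as parameter
  and the initial magnetisation \<open>r\<close> as observation. Conditioning on \<open>r\<close>
  instead of \<open>u\<close> is what brings out the Laplace weight.\<close>

lemma normal_density_exchange:
  assumes n: "0 < n"
  defines "\<tau> \<equiv> (n * t + 1) / ((real n)\<^sup>2 * (1 + t))"
  shows "normal_density 0 (sqrt (1 + t)) u * normal_density ((u + s) / n / (1 + t)) (sqrt (t / (1 + t) / n)) r =
    1 / sqrt (2 * pi * \<tau>) * exp (- real n * (field_curvature n * (r - field_center n s)\<^sup>2)) *
    normal_density (spin_slope n * (r - field_center n s)) (spin_deviation n) u"
proof -
  \<comment> \<open>One spin moves the mean of \<open>r\<close> by \<open>u / (n * (1 + t))\<close>;
    the other spins contribute the shift \<open>field_center n s\<close>.\<close>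
  define p where "p = 1 / (real n * (1 + t))"
  have t1: "0 < 1 + t" and n': "0 < real n" and nt: "0 < real n * t + 1"
    using t_pos n by (auto intro: add_nonneg_pos)
  have \<tau>: "\<tau> = t / (1 + t) / n + p\<^sup>2 * (1 + t)" "0 < \<tau>"
  proof -
    have "p\<^sup>2 * (1 + t) = 1 / ((real n)\<^sup>2 * (1 + t))"
      using t1 by (simp add: p_def power_divide power_mult_distrib power2_eq_square)
    moreover have "t / (1 + t) / n = real n * t / ((real n)\<^sup>2 * (1 + t))"
      using n' by (simp add: power2_eq_square mult.commute)
    ultimately show "\<tau> = t / (1 + t) / n + p\<^sup>2 * (1 + t)"
      by (simp add: \<tau>_def add_divide_distrib)
    show "0 < \<tau>" using t1 n' nt by (simp add: \<tau>_def)
  qed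
  have inv: "1 / \<tau> = (real n)\<^sup>2 * (1 + t) / (n * t + 1)" by (simp add: \<tau>_def)
  have mean: "p * u + field_center n s = (u + s) / n / (1 + t)"
    by (simp add: p_def field_center_def add_divide_distrib)
  have slope: "p * (1 + t) * x / \<tau> = spin_slope n * x" for x
  proof -
    have "p * (1 + t) * x / \<tau> = p * (1 + t) * x * (1 / \<tau>)" by simp
    also have "\<dots> = spin_slope n * x"
      unfolding inv using n' t1 by (simp add: p_def spin_slope_def power2_eq_square)
    finally show ?thesis .
  qed
  have var: "(1 + t) * (t / (1 + t) / n) / \<tau> = t * spin_slope n"
  proof -
    have "(1 + t) * (t / (1 + t) / n) / \<tau> = t / n * (1 / \<tau>)" using t1 by simp
    also have "\<dots> = t * spin_slope n"
      unfolding inv using n' by (simp add: spin_slope_def power2_eq_square)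
    finally show ?thesis .
  qed
  have curv: "x / (2 * \<tau>) = real n * (field_curvature n * x)" for x
  proof -
    have "x / (2 * \<tau>) = x / 2 * (1 / \<tau>)" by simp
    also have "\<dots> = real n * (field_curvature n * x)"
      unfolding inv by (simp add: field_curvature_def power2_eq_square)
    finally show ?thesis .
  qed
  have "normal_density 0 (sqrt (1 + t)) u * normal_density (p * u + field_center n s) (sqrt (t / (1 + t) / n)) r =
    normal_density (p * 0 + field_center n s) (sqrt \<tau>) r *
    normal_density (0 + p * (1 + t) * (r - p * 0 - field_center n s) / \<tau>) (sqrt ((1 + t) * (t / (1 + t) / n) / \<tau>)) u"
    using t_pos n \<tau>(1) by (intro normal_density_bayes) auto
  also have "\<dots> = normal_density (field_center n s) (sqrt \<tau>) r *
    normal_density (spin_slope n * (r - field_center n s)) (spin_deviation n) u"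
    by (simp only: slope var spin_deviation_def mult_zero_right add_0 diff_zero)
  also have "normal_density (field_center n s) (sqrt \<tau>) r =
    1 / sqrt (2 * pi * \<tau>) * exp (- real n * (field_curvature n * (r - field_center n s)\<^sup>2))"
    using \<tau>(2) by (simp add: normal_density_def curv)
  finally show ?thesis unfolding mean .
qed

text \<open>Fubini after the exchange of densities. The prefactor depends neither on
  \<open>f\<close> nor on \<open>s\<close>, so it cancels in the quotient defining the
  kernel.\<close>

lemma nn_integral_likelihood_exchange:
  assumes n: "0 < n" and f[measurable]: "f \<in> borel_measurable borel"
  shows "(\<integral>\<^sup>+ u. f u * likelihood V t n ((u + s) / n) \<partial>normal_measure 0 (sqrt (1 + t))) =
    ennreal (1 / sqrt (2 * pi * ((n * t + 1) / ((real n)\<^sup>2 * (1 + t))))) *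
    (\<integral>\<^sup>+ r. ennreal (laplace_weight V n (field_curvature n) (field_center n s) r) *
      (\<integral>\<^sup>+ u. f u \<partial>normal_measure (spin_slope n * (r - field_center n s)) (spin_deviation n)) \<partial>lborel)"
proof -
  define K where "K = 1 / sqrt (2 * pi * ((n * t + 1) / ((real n)\<^sup>2 * (1 + t))))"
  let ?a = "normal_density 0 (sqrt (1 + t))"
  let ?b = "\<lambda>u. normal_density ((u + s) / n / (1 + t)) (sqrt (t / (1 + t) / n))"
  let ?w = "laplace_weight V n (field_curvature n) (field_center n s)"
  let ?c = "\<lambda>r. normal_density (spin_slope n * (r - field_center n s)) (spin_deviation n)"
  have K: "0 \<le> K" using t_pos n by (simp add: K_def)
  have [measurable]: "(\<lambda>p. ?b (fst p) (snd p)) \<in> borel_measurable (lborel \<Otimes>\<^sub>M lborel)"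
    "(\<lambda>p. ?b (snd p) (fst p)) \<in> borel_measurable (lborel \<Otimes>\<^sub>M lborel)"
    "(\<lambda>p. ?c (fst p) (snd p)) \<in> borel_measurable (lborel \<Otimes>\<^sub>M lborel)"
    unfolding normal_density_def by measurable
  have eq: "ennreal (?a u) * (f u * (ennreal (?b u r) * ennreal (exp (- real n * V r)))) =
    ennreal K * (ennreal (?w r) * (ennreal (?c r u) * f u))" for u r
  proof -
    have "?a u * ?b u r * exp (- real n * V r) = K * ?w r * ?c r u"
    proof -
      have "?w r = exp (- real n * V r) * exp (- real n * (field_curvature n * (r - field_center n s)\<^sup>2))"
        by (simp add: laplace_weight_def distrib_left flip: exp_add)
      then show ?thesis unfolding normal_density_exchange[OF n] K_def by (simp only: mult_ac)
    qed
    moreover have "ennreal (?a u) * (f u * (ennreal (?b u r) * ennreal (exp (- real n * V r)))) =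
        ennreal (?a u * ?b u r * exp (- real n * V r)) * f u"
      by (simp add: ennreal_mult mult_ac)
    moreover have "ennreal K * (ennreal (?w r) * (ennreal (?c r u) * f u)) = ennreal (K * ?w r * ?c r u) * f u"
      using K by (simp add: ennreal_mult laplace_weight_def mult_ac)
    ultimately show ?thesis by simp
  qed
  have "(\<integral>\<^sup>+ u. f u * likelihood V t n ((u + s) / n) \<partial>normal_measure 0 (sqrt (1 + t))) =
    (\<integral>\<^sup>+ u. ennreal (?a u) * (f u * likelihood V t n ((u + s) / n)) \<partial>lborel)"
    by (rule nn_integral_density) measurable
  also have "\<dots> = (\<integral>\<^sup>+ u. (\<integral>\<^sup>+ r. ennreal (?a u) * (f u * (ennreal (?b u r) * ennreal (exp (- real n * V r)))) \<partial>lborel) \<partial>lborel)"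
    unfolding likelihood_def by (intro nn_integral_cong) (simp add: nn_integral_cmult)
  also have "\<dots> = (\<integral>\<^sup>+ r. (\<integral>\<^sup>+ u. ennreal (?a u) * (f u * (ennreal (?b u r) * ennreal (exp (- real n * V r)))) \<partial>lborel) \<partial>lborel)"
    by (rule lborel_pair.Fubini'[symmetric], unfold split_beta', measurable)
  also have "\<dots> = (\<integral>\<^sup>+ r. (\<integral>\<^sup>+ u. ennreal K * (ennreal (?w r) * (ennreal (?c r u) * f u)) \<partial>lborel) \<partial>lborel)"
    unfolding eq ..
  also have "\<dots> = (\<integral>\<^sup>+ r. ennreal K * (ennreal (?w r) * (\<integral>\<^sup>+ u. f u \<partial>normal_measure (spin_slope n * (r - field_center n s)) (spin_deviation n))) \<partial>lborel)"
    by (intro nn_integral_cong) (simp add: nn_integral_cmult nn_integral_density)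
  also have "\<dots> = ennreal K * (\<integral>\<^sup>+ r. ennreal (?w r) *
      (\<integral>\<^sup>+ u. f u \<partial>normal_measure (spin_slope n * (r - field_center n s)) (spin_deviation n)) \<partial>lborel)"
  proof (rule nn_integral_cmult)
    have "(\<lambda>r. \<integral>\<^sup>+ u. ennreal (?c r u) * f u \<partial>lborel) \<in> borel_measurable borel" by measurable
    then have [measurable]: "(\<lambda>r. \<integral>\<^sup>+ u. f u \<partial>normal_measure (spin_slope n * (r - field_center n s)) (spin_deviation n)) \<in> borel_measurable borel"
      by (simp add: nn_integral_density)
    show "(\<lambda>r. ennreal (?w r) * (\<integral>\<^sup>+ u. f u \<partial>normal_measure (spin_slope n * (r - field_center n s)) (spin_deviation n))) \<in> borel_measurable lborel"
      by measurable
  qed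
  finally show ?thesis unfolding K_def .
qed

end

section \<open>Limits of the conditional laws\<close>

text \<open>\<open>\<kappa> n\<close> is the largest \<open>k \<le> n\<close> with
  \<open>P k n\<close>. The cap makes the maximum exist, and each fixed \<open>K\<close> is
  eventually admissible, which forces growth.\<close>

lemma diagonal_eventually:
  assumes P: "\<And>k :: nat. \<forall>\<^sub>F n in sequentially. P k n"
  obtains \<kappa> :: "nat \<Rightarrow> nat" where "filterlim \<kappa> at_top sequentially" "\<forall>\<^sub>F n in sequentially. P (\<kappa> n) n"
proof
  define \<kappa> where "\<kappa> n = Max {k. k \<le> n \<and> P k n}" for n
  have fin: "finite {k. k \<le> n \<and> P k n}" for n by (rule finite_subset[of _ "{..n}"]) auto
  show "filterlim \<kappa> at_top sequentially"
    unfolding filterlim_at_top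
  proof
    fix K
    show "\<forall>\<^sub>F n in sequentially. K \<le> \<kappa> n"
      using P[of K] eventually_ge_at_top[of K]
      by eventually_elim (auto simp: \<kappa>_def intro!: Max_ge fin)
  qed
  \<comment> \<open>Validity of \<open>P 0 n\<close> keeps the candidate set nonempty.\<close>
  show "\<forall>\<^sub>F n in sequentially. P (\<kappa> n) n"
    using P[of 0]
  proof eventually_elim
    case (elim n)
    then have "{k. k \<le> n \<and> P k n} \<noteq> {}" by auto
    from Max_in[OF fin this] show ?case by (simp add: \<kappa>_def)
  qed
qed

text \<open>Adding the two optimality inequalities cancels the heights and the squares, leaving a
  product of \<open>b' - b\<close> with the difference of the minimisers. Every minimiser at a
  tilted field thus lies beyond every minimiser at the original one.\<close>

lemma argmin_pairs_mono:
  assumes x: "x \<in> argmin_pairs S k b" and y: "y \<in> argmin_pairs S k b'"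
    and k: "0 < k" and b: "b < b'"
  shows "fst x \<le> fst y"
proof -
  obtain r v s w where eq: "x = (r, v)" "y = (s, w)" by (metis surj_pair)
  have "v + k * (r - b)\<^sup>2 \<le> w + k * (s - b)\<^sup>2" "w + k * (s - b')\<^sup>2 \<le> v + k * (r - b')\<^sup>2"
    using x y unfolding eq by (auto simp: argmin_pairs_def)
  then have "0 \<le> k * (b' - b) * (2 * (s - r))" by (simp add: power2_eq_square algebra_simps)
  moreover have "0 < k * (b' - b)" using k b by simp
  ultimately show ?thesis unfolding eq by (simp add: zero_le_mult_iff)
qed

context mean_field_dynamics
begin

text \<open>Numerator and denominator of Bayes' formula are both rewritten by
  \<open>nn_integral_likelihood_exchange\<close>, the denominator with the constant function 1. The
  quotient is a mixture of normal laws over the Gibbs measure.\<close>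

lemma first_spin_kernel_eq_bind:
  fixes y :: "nat \<Rightarrow> real"
  assumes n: "0 < n"
  defines "s \<equiv> \<Sum>i=1..n-1. y i"
  defines "N \<equiv> \<lambda>r. normal_measure (spin_slope n * (r - field_center n s)) (spin_deviation n)"
  shows "N \<in> borel \<rightarrow>\<^sub>M subprob_algebra borel"
    and "first_spin_kernel V t n y = gibbs_measure V n (field_curvature n) (field_center n s) \<bind> N"
proof -
  let ?G = "gibbs_measure V n (field_curvature n) (field_center n s)"
  let ?w = "laplace_weight V n (field_curvature n) (field_center n s)"
  show N: "N \<in> borel \<rightarrow>\<^sub>M subprob_algebra borel"
  proof (rule measurable_subprob_algebra)
    show "subprob_space (N r)" for r
      unfolding N_def using spin_params_pos[OF n]
      by (intro prob_space_imp_subprob_space prob_space_normal_density)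
    fix A :: "real set" assume [measurable]: "A \<in> sets borel"
    have "(\<lambda>r. \<integral>\<^sup>+ u. ennreal (normal_density (spin_slope n * (r - field_center n s)) (spin_deviation n) u) * indicator A u \<partial>lborel)
      \<in> borel_measurable borel"
      unfolding normal_density_def by measurable
    then show "(\<lambda>r. emeasure (N r) A) \<in> borel_measurable borel"
      unfolding N_def by (simp add: emeasure_density)
  qed (simp add: N_def)
  then have N': "N \<in> ?G \<rightarrow>\<^sub>M subprob_algebra borel"
    by (simp add: measurable_cong_sets[OF sets_gibbs_measure refl])
  have ne: "space ?G \<noteq> {}" by (simp add: gibbs_measure_def)
  show "first_spin_kernel V t n y = ?G \<bind> N"
  proof (rule measure_eqI)
    show "sets (first_spin_kernel V t n y) = sets (?G \<bind> N)"
      using sets_bind[OF sets_kernel[OF N'] ne] by simp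
    fix A assume "A \<in> sets (first_spin_kernel V t n y)"
    then have A[measurable]: "A \<in> sets borel" by simp
    define K where "K = 1 / sqrt (2 * pi * ((n * t + 1) / ((real n)\<^sup>2 * (1 + t))))"
    have K: "0 < K" using n t_pos by (simp add: K_def add_nonneg_pos)
    define D where "D = (\<integral>\<^sup>+ r. ennreal (?w r) \<partial>lborel)"
    have D: "0 < D" "D < \<infinity>"
      unfolding D_def using laplace_weight_normaliser[OF V_measurable V_nonneg n spin_params_pos(1)[OF n]] by auto
    have one: "emeasure (N r) UNIV = 1" for r
      using prob_space.emeasure_space_1[OF prob_space_normal_density[OF spin_params_pos(3)[OF n]]]
      by (simp add: N_def)
    have "likelihood_average V t n s = ennreal K * (\<integral>\<^sup>+ r. ennreal (?w r) * (\<integral>\<^sup>+ u. 1 \<partial>N r) \<partial>lborel)"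
      using nn_integral_likelihood_exchange[OF n, of "\<lambda>_. 1" s]
      unfolding likelihood_average_def K_def N_def by simp
    also have "(\<integral>\<^sup>+ r. ennreal (?w r) * (\<integral>\<^sup>+ u. 1 \<partial>N r) \<partial>lborel) = D"
      unfolding D_def by (intro nn_integral_cong) (use one in \<open>simp add: N_def\<close>)
    finally have avg: "likelihood_average V t n s = ennreal K * D" .
    have [measurable]: "(\<lambda>r. emeasure (N r) A) \<in> borel_measurable borel"
      using A by (rule measurable_emeasure_kernel[OF N])
    have ind: "(indicator A :: real \<Rightarrow> ennreal) \<in> borel_measurable borel" by measurable
    have "emeasure (first_spin_kernel V t n y) A =
        (\<integral>\<^sup>+ u. indicator A u * likelihood V t n ((u + s) / n) \<partial>normal_measure 0 (sqrt (1 + t))) / likelihood_average V t n s"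
      unfolding s_def by (rule emeasure_first_spin_kernel[OF n A])
    also have "\<dots> = ennreal K * (\<integral>\<^sup>+ r. ennreal (?w r) * (\<integral>\<^sup>+ u. indicator A u \<partial>N r) \<partial>lborel) / (ennreal K * D)"
      unfolding avg nn_integral_likelihood_exchange[OF n ind] K_def N_def ..
    also have "(\<integral>\<^sup>+ r. ennreal (?w r) * (\<integral>\<^sup>+ u. indicator A u \<partial>N r) \<partial>lborel) =
        (\<integral>\<^sup>+ r. ennreal (?w r) * emeasure (N r) A \<partial>lborel)"
      by (intro nn_integral_cong) (simp add: N_def)
    also have "ennreal K * x / (ennreal K * D) = x / D" for x
    proof -
      obtain d where d: "D = ennreal d" "0 < d" using D by (cases D) auto
      have "inverse (ennreal K * D) = inverse (ennreal K) * inverse D"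
        using K d by (simp add: inverse_ennreal flip: ennreal_mult)
      moreover have "ennreal K * inverse (ennreal K) = 1"
        using K by (simp add: inverse_ennreal flip: ennreal_mult)
      ultimately show ?thesis unfolding divide_ennreal_def by (metis mult.assoc mult.commute mult.left_neutral)
    qed
    also have "(\<integral>\<^sup>+ r. ennreal (?w r) * emeasure (N r) A \<partial>lborel) / D = (\<integral>\<^sup>+ r. emeasure (N r) A \<partial>?G)"
      unfolding D_def by (rule nn_integral_gibbs_measure[symmetric]) measurable
    also have "\<dots> = emeasure (?G \<bind> N) A"
      by (rule emeasure_bind[OF ne N' A, symmetric])
    finally show "emeasure (first_spin_kernel V t n y) A = emeasure (?G \<bind> N) A" .
  qed
qed

text \<open>For \<open>n = 0\<close> the deviation degenerates to 0; the default value 0 keeps the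
  bound on \<open>f\<close> valid for all \<open>n\<close>, as the concentration lemmas
  demand.\<close>

definition spin_average :: "nat \<Rightarrow> (real \<Rightarrow> real) \<Rightarrow> real \<Rightarrow> real \<Rightarrow> real" where
  "spin_average n f b r = (if n = 0 then 0 else LINT u|normal_measure (spin_slope n * (r - b)) (spin_deviation n). f u)"

lemma spin_average_measurable [measurable]:
  assumes [measurable]: "f \<in> borel_measurable borel"
  shows "spin_average n f b \<in> borel_measurable borel"
proof -
  have "(\<lambda>r. LINT u|lborel. normal_density (spin_slope n * (r - b)) (spin_deviation n) u * f u) \<in> borel_measurable borel"
    unfolding normal_density_def by measurable
  moreover have "spin_average n f b = (if n = 0 then \<lambda>_. 0 else
      (\<lambda>r. LINT u|lborel. normal_density (spin_slope n * (r - b)) (spin_deviation n) u * f u))"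
    by (simp add: fun_eq_iff spin_average_def integral_density)
  ultimately show ?thesis by simp
qed

lemma spin_average_bound:
  assumes [measurable]: "f \<in> borel_measurable borel" and f: "\<And>u. \<bar>f u\<bar> \<le> B"
  shows "\<bar>spin_average n f b r\<bar> \<le> B"
proof (cases "n = 0")
  case True
  then show ?thesis using order_trans[OF abs_ge_zero f[of 0]] by (simp add: spin_average_def)
next
  case False
  interpret prob_space "normal_measure (spin_slope n * (r - b)) (spin_deviation n)"
    using False by (intro prob_space_normal_density spin_params_pos) simp
  have "\<bar>LINT u|normal_measure (spin_slope n * (r - b)) (spin_deviation n). f u\<bar>
    \<le> (LINT u|normal_measure (spin_slope n * (r - b)) (spin_deviation n). \<bar>f u\<bar>)"
    by (rule integral_abs_bound)
  also have "\<dots> \<le> (LINT u|normal_measure (spin_slope n * (r - b)) (spin_deviation n). B)"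
    using f by (intro integral_mono integrable_const integrable_const_bound[of _ B]) auto
  also have "\<dots> = B" using prob_space by (simp del: space_density)
  finally show ?thesis using False by (simp add: spin_average_def)
qed

lemma integral_first_spin_kernel_mixture:
  fixes y :: "nat \<Rightarrow> real"
  assumes n: "0 < n" and f[measurable]: "f \<in> borel_measurable borel" and bound: "\<And>u. \<bar>f u\<bar> \<le> B"
  defines "b \<equiv> field_center n (\<Sum>i=1..n-1. y i)"
  shows "(LINT u|first_spin_kernel V t n y. f u) =
    (LINT r|gibbs_measure V n (field_curvature n) b. spin_average n f b r)"
proof -
  let ?G = "gibbs_measure V n (field_curvature n) b"
  let ?N = "\<lambda>r. normal_measure (spin_slope n * (r - b)) (spin_deviation n)"
  interpret G: prob_space ?G
    by (intro prob_space_gibbs_measure V_measurable V_nonneg n spin_params_pos)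
  have N: "?N \<in> ?G \<rightarrow>\<^sub>M subprob_algebra borel"
    using first_spin_kernel_eq_bind(1)[OF n, of y]
    by (simp add: measurable_cong_sets[OF sets_gibbs_measure refl] b_def)
  have "emeasure (?N r) (space (?N r)) \<le> ennreal 1" for r
    using prob_space.emeasure_space_1[OF prob_space_normal_density[OF spin_params_pos(3)[OF n]]] by simp
  then have "(LINT u|(?G \<bind> ?N). f u) = (LINT r|?G. LINT u|?N r. f u)"
    using bound by (intro integral_bind[OF f _ N G.finite_measure_axioms, of B 1] AE_I2) auto
  then show ?thesis
    using n first_spin_kernel_eq_bind(2)[OF n, of y] by (simp add: spin_average_def b_def)
qed

lemma field_curvature_tendsto: "field_curvature \<longlonglongrightarrow> (1 + t) / (2 * t)"
  unfolding field_curvature_def using t_pos by (real_asymp, simp add: field_simps)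

lemma spin_slope_tendsto: "spin_slope \<longlonglongrightarrow> (1 + t) / t"
  unfolding spin_slope_def using t_pos by (real_asymp, simp add: field_simps)

lemma spin_deviation_tendsto: "spin_deviation \<longlonglongrightarrow> sqrt (1 + t)"
proof -
  have "spin_deviation \<longlonglongrightarrow> sqrt (t * ((1 + t) / t))"
    unfolding spin_deviation_def by (intro tendsto_intros spin_slope_tendsto)
  then show ?thesis using t_pos by simp
qed

text \<open>The general filter serves two uses: the product filter, where \<open>n\<close> and
  \<open>r\<close> vary together, and sequences with \<open>r\<close> fixed.\<close>

lemma spin_average_tendsto:
  assumes f: "continuous_on UNIV f" "\<And>u. \<bar>f u\<bar> \<le> B"
    and N: "filterlim N sequentially F" and b: "(b \<longlongrightarrow> b0) F" and r: "(r \<longlongrightarrow> r0) F"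
  shows "((\<lambda>p. spin_average (N p) f (b p) (r p)) \<longlongrightarrow>
    (LINT u|normal_measure ((1 + t) / t * (r0 - b0)) (sqrt (1 + t)). f u)) F"
proof -
  have "((\<lambda>p. LINT u|normal_measure (spin_slope (N p) * (r p - b p)) (spin_deviation (N p)). f u) \<longlongrightarrow>
    (LINT u|normal_measure ((1 + t) / t * (r0 - b0)) (sqrt (1 + t)). f u)) F"
    using t_pos
    by (intro integral_normal_measure_tendsto[OF f] tendsto_intros b r
      filterlim_compose[OF spin_slope_tendsto N] filterlim_compose[OF spin_deviation_tendsto N]) auto
  moreover have "\<forall>\<^sub>F p in F. 0 < N p"
    using N eventually_gt_at_top[of "0 :: nat"] by (auto simp: filterlim_iff)
  then have "\<forall>\<^sub>F p in F. (LINT u|normal_measure (spin_slope (N p) * (r p - b p)) (spin_deviation (N p)). f u) =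
      spin_average (N p) f (b p) (r p)"
    by eventually_elim (simp add: spin_average_def)
  ultimately show ?thesis by (rule Lim_transform_eventually)
qed

text \<open>The magnetisation of the other spins divides by \<open>n - 1\<close>, the field centre
  by \<open>n\<close>; the correcting factor \<open>(n - 1) / n\<close> tends to 1.\<close>

lemma field_center_tendsto:
  assumes v: "\<And>n. 2 \<le> n \<Longrightarrow> s n = (\<Sum>i=1..n-1. v (n - 1) i)"
    and lim: "(\<lambda>n. magnetisation (n - 1) (v (n - 1))) \<longlonglongrightarrow> \<alpha>"
  shows "(\<lambda>n. field_center n (s n)) \<longlonglongrightarrow> \<alpha> / (1 + t)"
proof -
  have "(\<lambda>n. (real n - 1) / real n) \<longlonglongrightarrow> 1" by real_asymp
  then have "(\<lambda>n. (real n - 1) / real n * magnetisation (n - 1) (v (n - 1)) / (1 + t)) \<longlonglongrightarrow> 1 * \<alpha> / (1 + t)"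
    using t_pos by (intro tendsto_intros lim) auto
  moreover have "\<forall>\<^sub>F n in sequentially. (real n - 1) / real n * magnetisation (n - 1) (v (n - 1)) / (1 + t) = field_center n (s n)"
    using eventually_ge_at_top[of 2]
  proof eventually_elim
    case (elim n)
    then have n: "real (n - 1) \<noteq> 0" "real n - 1 = real (n - 1)" by auto
    have "a / d * (S / a) / c = S / (d * c)" if "a \<noteq> 0" for a c d S :: real
      using that by simp
    from this[OF n(1)] show ?case
      unfolding v[OF elim] magnetisation_def field_center_def n(2) .
  qed
  ultimately show ?thesis using Lim_transform_eventually by fastforce
qed

lemma first_spin_kernel_tendsto:
  fixes f :: "real \<Rightarrow> real"
  assumes unique: "\<And>x. x \<in> argmin_pairs (ess_epigraph V) ((1 + t) / (2 * t)) b \<Longrightarrow> fst x = r"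
    and y: "(\<lambda>n. field_center n (\<Sum>i=1..n-1. y n i)) \<longlonglongrightarrow> b"
    and f: "continuous_on UNIV f" "\<And>u. \<bar>f u\<bar> \<le> B"
  shows "(\<lambda>n. LINT u|first_spin_kernel V t n (y n). f u) \<longlonglongrightarrow>
    (LINT u|normal_measure ((1 + t) / t * (r - b)) (sqrt (1 + t)). f u)"
proof -
  define c where "c n = field_center n (\<Sum>i=1..n-1. y n i)" for n
  have f_meas: "f \<in> borel_measurable borel" using f(1) by (rule borel_measurable_continuous_onI)
  have "(\<lambda>n. LINT r|gibbs_measure V n (field_curvature n) (c n). spin_average n f (c n) r) \<longlonglongrightarrow>
    (LINT u|normal_measure ((1 + t) / t * (r - b)) (sqrt (1 + t)). f u)"
  proof (rule gibbs_measure_integral_tendsto[OF V_measurable V_nonneg field_curvature_tendsto])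
    show "c \<longlonglongrightarrow> b" using y by (simp add: c_def[abs_def])
    then have "filterlim (\<lambda>p. c (fst p)) (nhds b) (sequentially \<times>\<^sub>F nhds r)"
      by (rule filterlim_compose[OF _ filterlim_fst])
    then show "((\<lambda>(n, r). spin_average n f (c n) r) \<longlongrightarrow>
        (LINT u|normal_measure ((1 + t) / t * (r - b)) (sqrt (1 + t)). f u)) (sequentially \<times>\<^sub>F nhds r)"
      unfolding case_prod_beta by (intro spin_average_tendsto[OF f] filterlim_fst filterlim_snd)
  qed (use t_pos unique f_meas in \<open>auto intro: spin_average_bound[OF _ f(2)]\<close>)
  moreover have "\<forall>\<^sub>F n in sequentially.
      (LINT r|gibbs_measure V n (field_curvature n) (c n). spin_average n f (c n) r) =
      (LINT u|first_spin_kernel V t n (y n). f u)"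
    using eventually_gt_at_top[of 0]
    by eventually_elim (simp add: c_def integral_first_spin_kernel_mixture[OF _ f_meas f(2)])
  ultimately show ?thesis by (rule Lim_transform_eventually)
qed

text \<open>The limiting normal law is determined by \<alpha> and the minimiser \<open>r\<close>, so
  it is common to all admissible sequences \<open>v\<close>.\<close>

lemma good_magnetisation_if_unique:
  assumes unique: "\<And>x. x \<in> argmin_pairs (ess_epigraph V) ((1 + t) / (2 * t)) (\<alpha> / (1 + t)) \<Longrightarrow> fst x = r"
  shows "good_magnetisation (time_evolved V t) \<alpha>"
  unfolding good_magnetisation_def
proof (intro exI conjI allI impI)
  let ?N = "normal_measure ((1 + t) / t * (r - \<alpha> / (1 + t))) (sqrt (1 + t))"
  show "first_spin_rcp n (time_evolved V t n) (first_spin_kernel V t n)"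
    "proper_rcp n (time_evolved V t n) (first_spin_kernel V t n)"
    "weakly_continuous n (first_spin_kernel V t n)" if "2 \<le> n" for n
    using that by (auto intro: first_spin_rcp_kernel proper_rcp_kernel weakly_continuous_kernel)
  show "prob_space ?N" using t_pos by (intro prob_space_normal_density) simp
  show "sets ?N = sets borel" by simp
  fix v :: "nat \<Rightarrow> nat \<Rightarrow> real"
  assume "(\<forall>n\<ge>2. v (n - 1) \<in> space (borel_Rn (n - 1))) \<and> (\<lambda>n. magnetisation (n - 1) (v (n - 1))) \<longlonglongrightarrow> \<alpha>"
  then have lim: "(\<lambda>n. magnetisation (n - 1) (v (n - 1))) \<longlonglongrightarrow> \<alpha>" by simp
  show "weakly_converges (\<lambda>n. first_spin_kernel V t n (v (n - 1))) ?N"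
    unfolding weakly_converges_def
  proof (intro allI impI, elim conjE)
    fix f :: "real \<Rightarrow> real" assume f: "continuous_on UNIV f" "bounded (range f)"
    then obtain B where B: "\<And>u. \<bar>f u\<bar> \<le> B" by (auto simp: bounded_iff)
    show "(\<lambda>n. LINT u|first_spin_kernel V t n (v (n - 1)). f u) \<longlonglongrightarrow> (LINT u|?N. f u)"
      by (rule first_spin_kernel_tendsto[OF unique field_center_tendsto[OF _ lim] f(1) B]) auto
  qed
qed

text \<open>At a tilted field minimisers may still be non-unique, so no limit is claimed. A strictly
  increasing test function needs only that the Gibbs measure concentrates above \<open>q\<close>:
  there, the normal laws have larger means than at \<open>q\<close>.\<close>

lemma eventually_kernel_integral_ge:
  fixes f :: "real \<Rightarrow> real"
  assumes f: "continuous_on UNIV f" "strict_mono f" "\<And>u. \<bar>f u\<bar> \<le> B"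
    and minimisers: "\<And>x. x \<in> argmin_pairs (ess_epigraph V) ((1 + t) / (2 * t)) b \<Longrightarrow> q < fst x"
    and m: "m < (1 + t) / t * (q - b)"
    and y: "(\<lambda>n. field_center n (\<Sum>i=1..n-1. y n i)) \<longlonglongrightarrow> b"
  shows "\<forall>\<^sub>F n in sequentially. (LINT u|normal_measure m (sqrt (1 + t)). f u) \<le> (LINT u|first_spin_kernel V t n (y n). f u)"
proof -
  define c where "c n = field_center n (\<Sum>i=1..n-1. y n i)" for n
  have c: "c \<longlonglongrightarrow> b" using y by (simp add: c_def[abs_def])
  have f_meas: "f \<in> borel_measurable borel" using f(1) by (rule borel_measurable_continuous_onI)
  define A where "A = (LINT u|normal_measure m (sqrt (1 + t)). f u)"
  define L where "L = (LINT u|normal_measure ((1 + t) / t * (q - b)) (sqrt (1 + t)). f u)"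
  have "A < L" unfolding A_def L_def using t_pos by (intro integral_normal_measure_strict_mono[OF f _ m]) simp
  \<comment> \<open>Half of the gap secures the convergence at \<open>q\<close>, the other half pays
    for the mass remaining in \<open>{..q}\<close>.\<close>
  define d where "d = (L - A) / 2"
  have d: "0 < d" "A + d < L" using \<open>A < L\<close> by (auto simp: d_def field_simps)
  have "(\<lambda>n. spin_average n f (c n) q) \<longlonglongrightarrow> L"
    unfolding L_def by (intro spin_average_tendsto[OF f(1,3)] filterlim_ident c tendsto_const)
  then have "\<forall>\<^sub>F n in sequentially. A + d < spin_average n f (c n) q" using d(2) by (rule order_tendstoD)
  then have ge: "\<forall>\<^sub>F n in sequentially. \<forall>r. r \<notin> {..q} \<longrightarrow> A + d \<le> spin_average n f (c n) r"
    using eventually_gt_at_top[of 0]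
  proof eventually_elim
    case (elim n)
    have "spin_average n f (c n) q < spin_average n f (c n) r" if "q < r" for r
      unfolding spin_average_def using elim(2) that spin_params_pos[OF elim(2)]
      by (auto intro!: integral_normal_measure_strict_mono[OF f])
    then show ?case using elim(1) by (meson atMost_iff less_imp_le less_trans not_le)
  qed
  have "\<forall>\<^sub>F n in sequentially. A + d - d \<le> (LINT r|gibbs_measure V n (field_curvature n) (c n). spin_average n f (c n) r)"
  proof (rule gibbs_measure_integral_ge[OF V_measurable V_nonneg field_curvature_tendsto c _ _ _ _ _ ge d(1)])
    show "fst x \<notin> {..q}" if "x \<in> argmin_pairs (ess_epigraph V) ((1 + t) / (2 * t)) b" for x
      using minimisers[OF that] by simp
  qed (use t_pos f_meas in \<open>auto intro: spin_average_bound[OF _ f(3)]\<close>)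
  then show ?thesis using eventually_gt_at_top[of 0]
    by eventually_elim (simp add: A_def c_def integral_first_spin_kernel_mixture[OF _ f_meas f(3)])
qed

lemma eventually_kernel_integral_le:
  fixes f :: "real \<Rightarrow> real"
  assumes f: "continuous_on UNIV f" "strict_mono f" "\<And>u. \<bar>f u\<bar> \<le> B"
    and minimisers: "\<And>x. x \<in> argmin_pairs (ess_epigraph V) ((1 + t) / (2 * t)) b \<Longrightarrow> fst x < q"
    and m: "(1 + t) / t * (q - b) < m"
    and y: "(\<lambda>n. field_center n (\<Sum>i=1..n-1. y n i)) \<longlonglongrightarrow> b"
  shows "\<forall>\<^sub>F n in sequentially. (LINT u|first_spin_kernel V t n (y n). f u) \<le> (LINT u|normal_measure m (sqrt (1 + t)). f u)"
proof -
  define c where "c n = field_center n (\<Sum>i=1..n-1. y n i)" for n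
  have c: "c \<longlonglongrightarrow> b" using y by (simp add: c_def[abs_def])
  have f_meas: "f \<in> borel_measurable borel" using f(1) by (rule borel_measurable_continuous_onI)
  define A where "A = (LINT u|normal_measure m (sqrt (1 + t)). f u)"
  define L where "L = (LINT u|normal_measure ((1 + t) / t * (q - b)) (sqrt (1 + t)). f u)"
  have "L < A" unfolding A_def L_def using t_pos by (intro integral_normal_measure_strict_mono[OF f _ m]) simp
  define d where "d = (A - L) / 2"
  have d: "0 < d" "L < A - d" using \<open>L < A\<close> by (auto simp: d_def field_simps)
  have "(\<lambda>n. spin_average n f (c n) q) \<longlonglongrightarrow> L"
    unfolding L_def by (intro spin_average_tendsto[OF f(1,3)] filterlim_ident c tendsto_const)
  then have "\<forall>\<^sub>F n in sequentially. spin_average n f (c n) q < A - d" using d(2) by (rule order_tendstoD)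
  then have le: "\<forall>\<^sub>F n in sequentially. \<forall>r. r \<notin> {q..} \<longrightarrow> spin_average n f (c n) r \<le> A - d"
    using eventually_gt_at_top[of 0]
  proof eventually_elim
    case (elim n)
    have "spin_average n f (c n) r < spin_average n f (c n) q" if "r < q" for r
      unfolding spin_average_def using elim(2) that spin_params_pos[OF elim(2)]
      by (auto intro!: integral_normal_measure_strict_mono[OF f])
    then show ?case using elim(1) by (meson atLeast_iff less_imp_le less_trans not_le)
  qed
  have "\<forall>\<^sub>F n in sequentially. (LINT r|gibbs_measure V n (field_curvature n) (c n). spin_average n f (c n) r) \<le> A - d + d"
  proof (rule gibbs_measure_integral_le[OF V_measurable V_nonneg field_curvature_tendsto c _ _ _ _ _ le d(1)])
    show "fst x \<notin> {q..}" if "x \<in> argmin_pairs (ess_epigraph V) ((1 + t) / (2 * t)) b" for x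
      using minimisers[OF that] by simp
  qed (use t_pos f_meas in \<open>auto intro: spin_average_bound[OF _ f(3)]\<close>)
  then show ?thesis using eventually_gt_at_top[of 0]
    by eventually_elim (simp add: A_def c_def integral_first_spin_kernel_mixture[OF _ f_meas f(3)])
qed

section \<open>Failure of good magnetisations with two minimisers\<close>

definition constant_spins :: "nat \<Rightarrow> real \<Rightarrow> nat \<Rightarrow> real" where
  "constant_spins n a = (\<lambda>i\<in>{1..n}. a)"

lemma constant_spins_space: "constant_spins n a \<in> space (borel_Rn n)"
  by (auto simp: constant_spins_def space_PiM)

lemma sum_constant_spins: "(\<Sum>i=1..n. constant_spins n a i) = real n * a"
  by (simp add: constant_spins_def)

lemma magnetisation_constant_spins: "0 < n \<Longrightarrow> magnetisation n (constant_spins n a) = a"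
  by (simp add: magnetisation_def sum_constant_spins del: One_nat_def)

lemma field_center_constant_spins:
  "(\<lambda>n. field_center n (\<Sum>i=1..n-1. constant_spins (n - 1) a i)) \<longlonglongrightarrow> a / (1 + t)"
proof (rule field_center_tendsto[where v = "\<lambda>n. constant_spins n a"])
  have "\<forall>\<^sub>F n in sequentially. magnetisation (n - 1) (constant_spins (n - 1) a) = a"
    using eventually_ge_at_top[of 2] by eventually_elim (simp add: magnetisation_constant_spins)
  then show "(\<lambda>n. magnetisation (n - 1) (constant_spins (n - 1) a)) \<longlonglongrightarrow> a"
    by (rule tendsto_eventually)
qed simp

text \<open>The kernel in \<open>good_magnetisation\<close> is arbitrary; uniqueness replaces it by
  the explicit one. One \<open>L\<close> serves all sequences, which is what two opposite tilts will
  contradict.\<close>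

lemma kernel_integral_tendsto_if_good:
  fixes f :: "real \<Rightarrow> real"
  assumes good: "good_magnetisation (time_evolved V t) \<alpha>"
    and f: "continuous_on UNIV f" "bounded (range f)" "\<And>u. 0 \<le> f u"
  obtains L where "\<And>a. a \<longlonglongrightarrow> \<alpha> \<Longrightarrow>
    (\<lambda>n. LINT u|first_spin_kernel V t n (constant_spins (n - 1) (a n)). f u) \<longlonglongrightarrow> L"
proof -
  obtain \<gamma> \<gamma>\<^sub>\<alpha> where \<gamma>: "\<And>n. 2 \<le> n \<Longrightarrow> first_spin_rcp n (time_evolved V t n) (\<gamma> n)"
      "\<And>n. 2 \<le> n \<Longrightarrow> weakly_continuous n (\<gamma> n)"
    and conv: "\<And>v. \<forall>n\<ge>2. v (n - 1) \<in> space (borel_Rn (n - 1)) \<Longrightarrow>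
      (\<lambda>n. magnetisation (n - 1) (v (n - 1))) \<longlonglongrightarrow> \<alpha> \<Longrightarrow> weakly_converges (\<lambda>n. \<gamma> n (v (n - 1))) \<gamma>\<^sub>\<alpha>"
    using good unfolding good_magnetisation_def by blast
  show ?thesis
  proof (rule that)
    fix a assume a: "a \<longlonglongrightarrow> \<alpha>"
    \<comment> \<open>Configurations are indexed by their dimension \<open>n - 1\<close>, the
      targets \<open>a\<close> by \<open>n\<close>; hence the successor.\<close>
    define v where "v m = constant_spins m (a (Suc m))" for m
    have v: "v (n - 1) = constant_spins (n - 1) (a n)" if "2 \<le> n" for n using that by (simp add: v_def)
    have "\<forall>\<^sub>F n in sequentially. a n = magnetisation (n - 1) (v (n - 1))"
      using eventually_ge_at_top[of 2]
    proof eventually_elim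
      case (elim n)
      then show ?case unfolding v[OF elim] by (intro magnetisation_constant_spins[symmetric]) simp
    qed
    with a have "(\<lambda>n. magnetisation (n - 1) (v (n - 1))) \<longlonglongrightarrow> \<alpha>" by (rule Lim_transform_eventually)
    then have "weakly_converges (\<lambda>n. \<gamma> n (v (n - 1))) \<gamma>\<^sub>\<alpha>"
      by (rule conv[rotated]) (unfold v_def, intro allI impI constant_spins_space)
    then have "(\<lambda>n. LINT u|\<gamma> n (v (n - 1)). f u) \<longlonglongrightarrow> (LINT u|\<gamma>\<^sub>\<alpha>. f u)"
      using f unfolding weakly_converges_def by blast
    moreover have "\<forall>\<^sub>F n in sequentially. (LINT u|\<gamma> n (v (n - 1)). f u) =
        (LINT u|first_spin_kernel V t n (constant_spins (n - 1) (a n)). f u)"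
      using eventually_ge_at_top[of 2]
    proof eventually_elim
      case (elim n)
      then have n: "0 < n" by simp
      show ?case
        unfolding v[OF elim]
        by (rule weakly_continuous_rcp_unique[OF n \<gamma>(1)[OF elim] first_spin_rcp_kernel[OF n] \<gamma>(2)[OF elim]
          weakly_continuous_kernel[OF n] f constant_spins_space])
    qed
    ultimately show "(\<lambda>n. LINT u|first_spin_kernel V t n (constant_spins (n - 1) (a n)). f u) \<longlonglongrightarrow> (LINT u|\<gamma>\<^sub>\<alpha>. f u)"
      by (rule Lim_transform_eventually)
  qed
qed

text \<open>Two minimisers are separated by tilting the field slightly up or down: the kernels along
  constant configurations then concentrate near the upper or the lower one.\<close>

lemma not_good_magnetisation_if_two_minimisers:
  assumes x: "x \<in> argmin_pairs (ess_epigraph V) ((1 + t) / (2 * t)) (\<alpha> / (1 + t))"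
    and y: "y \<in> argmin_pairs (ess_epigraph V) ((1 + t) / (2 * t)) (\<alpha> / (1 + t))"
    and less: "fst x < fst y"
  shows "\<not> good_magnetisation (time_evolved V t) \<alpha>"
proof
  assume good: "good_magnetisation (time_evolved V t) \<alpha>"
  let ?k = "(1 + t) / (2 * t)" and ?c = "(1 + t) / t" and ?b = "\<alpha> / (1 + t)"
  let ?I = "\<lambda>m f. LINT u|normal_measure m (sqrt (1 + t)). f u"
  have k: "0 < ?k" "0 < ?c" "0 < 1 + t" using t_pos by auto
  \<comment> \<open>Strictly increasing to separate normal means, bounded for weak convergence, and
    shifted to be nonnegative for the uniqueness of kernels.\<close>
  define f where "f u = arctan u + pi" for u
  have f: "continuous_on UNIV f" "strict_mono f" "bounded (range f)" "\<And>u. 0 \<le> f u"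
  proof -
    show "continuous_on UNIV f" unfolding f_def by (intro continuous_intros)
    show "strict_mono f" unfolding f_def by (intro strict_monoI) (simp add: arctan_monotone)
    have "0 \<le> f u \<and> f u \<le> 2 * pi" for u
      using arctan_lbound[of u] arctan_ubound[of u] pi_gt_zero by (auto simp: f_def)
    then show "bounded (range f)" "\<And>u. 0 \<le> f u" by (auto simp: bounded_iff intro!: exI[of _ "2 * pi"])
  qed
  obtain B where B: "\<And>u. \<bar>f u\<bar> \<le> B" using f(3) by (auto simp: bounded_iff)
  \<comment> \<open>With tilts of size at most \<open>d\<close>, the thresholds
    \<open>fst x + 7 * d\<close> and \<open>fst x + d\<close>, corrected by the tilt, stay above
    \<open>fst x + 6 * d\<close> and below \<open>fst x + 2 * d\<close> (weakly). The comparison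
    levels at \<open>5 * d\<close> and \<open>3 * d\<close> are then strictly inside.\<close>
  define d where "d = (fst y - fst x) / 8"
  have "8 * d = fst y - fst x" by (simp add: d_def)
  then have d: "0 < d" "fst y = fst x + 8 * d" using less by linarith+
  define l h where "l = ?c * (fst x + 3 * d - ?b)" and "h = ?c * (fst x + 5 * d - ?b)"
  have "l < h" unfolding l_def h_def using k d by (intro mult_strict_left_mono) auto
  define e where "e k = d / real (Suc k)" for k
  have e: "0 < e k" "e k \<le> d" for k using d by (auto simp: e_def field_simps)
  have e_lim: "e \<longlonglongrightarrow> 0" unfolding e_def by (rule LIMSEQ_Suc) (rule lim_const_over_n)
  have center: "(?b + s) * (1 + t) / (1 + t) = ?b + s" for s using k by simp
  have up: "\<forall>\<^sub>F n in sequentially. ?I h f \<le>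
      (LINT u|first_spin_kernel V t n (constant_spins (n - 1) ((?b + e k) * (1 + t))). f u)" for k
  proof (rule eventually_kernel_integral_ge[OF f(1,2) B])
    show "fst x + 7 * d < fst z" if "z \<in> argmin_pairs (ess_epigraph V) ?k (?b + e k)" for z
      using argmin_pairs_mono[OF y that k(1)] d e(1)[of k] by simp
    show "h < ?c * (fst x + 7 * d - (?b + e k))"
      unfolding h_def using k d e(2)[of k] by (intro mult_strict_left_mono) auto
    show "(\<lambda>n. field_center n (\<Sum>i=1..n-1. constant_spins (n - 1) ((?b + e k) * (1 + t)) i)) \<longlonglongrightarrow> ?b + e k"
      using field_center_constant_spins[of "(?b + e k) * (1 + t)"] unfolding center .
  qed
  have down: "\<forall>\<^sub>F n in sequentially.
      (LINT u|first_spin_kernel V t n (constant_spins (n - 1) ((?b + - e k) * (1 + t))). f u) \<le> ?I l f" for k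
  proof (rule eventually_kernel_integral_le[OF f(1,2) B])
    show "fst z < fst x + d" if "z \<in> argmin_pairs (ess_epigraph V) ?k (?b + - e k)" for z
      using argmin_pairs_mono[OF that x k(1)] d e(1)[of k] by simp
    show "?c * (fst x + d - (?b + - e k)) < l"
      unfolding l_def using k d e(2)[of k] by (intro mult_strict_left_mono) auto
    show "(\<lambda>n. field_center n (\<Sum>i=1..n-1. constant_spins (n - 1) ((?b + - e k) * (1 + t)) i)) \<longlonglongrightarrow> ?b + - e k"
      using field_center_constant_spins[of "(?b + - e k) * (1 + t)"] unfolding center .
  qed
  obtain L where L: "\<And>a. a \<longlonglongrightarrow> \<alpha> \<Longrightarrow>
      (\<lambda>n. LINT u|first_spin_kernel V t n (constant_spins (n - 1) (a n)). f u) \<longlonglongrightarrow> L"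
    using kernel_integral_tendsto_if_good[OF good f(1,3,4)] by blast
  \<comment> \<open>A fixed tilt changes the limiting magnetisation. Diagonally, the tilt tends to
    zero so slowly that the bound persists while the magnetisation tends to \<alpha>.\<close>
  obtain \<kappa> where \<kappa>: "filterlim \<kappa> at_top sequentially" "\<forall>\<^sub>F n in sequentially. ?I h f \<le>
      (LINT u|first_spin_kernel V t n (constant_spins (n - 1) ((?b + e (\<kappa> n)) * (1 + t))). f u)"
    using diagonal_eventually[OF up] .
  have "(\<lambda>n. (?b + e (\<kappa> n)) * (1 + t)) \<longlonglongrightarrow> (?b + 0) * (1 + t)"
    by (intro tendsto_intros filterlim_compose[OF e_lim \<kappa>(1)])
  then have "?I h f \<le> L"
    using k \<kappa>(2) by (intro tendsto_lowerbound[OF L]) auto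
  moreover obtain \<kappa>' where \<kappa>': "filterlim \<kappa>' at_top sequentially" "\<forall>\<^sub>F n in sequentially.
      (LINT u|first_spin_kernel V t n (constant_spins (n - 1) ((?b + - e (\<kappa>' n)) * (1 + t))). f u) \<le> ?I l f"
    using diagonal_eventually[OF down] .
  have "(\<lambda>n. (?b + - e (\<kappa>' n)) * (1 + t)) \<longlonglongrightarrow> (?b + - 0) * (1 + t)"
    by (intro tendsto_intros filterlim_compose[OF e_lim \<kappa>'(1)])
  then have "L \<le> ?I l f"
    using k \<kappa>'(2) by (intro tendsto_upperbound[OF L]) auto
  moreover have "?I l f < ?I h f"
    using \<open>l < h\<close> k by (intro integral_normal_measure_strict_mono[OF f(1,2) B]) auto
  ultimately show False by linarith
qed

text \<open>Fields and magnetisations correspond by \<alpha> = b (1 + t), a bijection of the line,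
  so quantifying over one is quantifying over the other.\<close>

lemma sequentially_Gibbs_iff:
  "sequentially_Gibbs (time_evolved V t) \<longleftrightarrow> unique_minimisers (ess_epigraph V) ((1 + t) / (2 * t))"
proof
  assume gibbs: "sequentially_Gibbs (time_evolved V t)"
  show "unique_minimisers (ess_epigraph V) ((1 + t) / (2 * t))"
  proof (rule ccontr)
    assume "\<not> ?thesis"
    then obtain b x y where xy: "x \<in> argmin_pairs (ess_epigraph V) ((1 + t) / (2 * t)) b"
        "y \<in> argmin_pairs (ess_epigraph V) ((1 + t) / (2 * t)) b" "fst x < fst y"
      unfolding unique_minimisers_def by (metis linorder_neq_iff)
    have "b * (1 + t) / (1 + t) = b" using t_pos by simp
    then have "\<not> good_magnetisation (time_evolved V t) (b * (1 + t))"
      using xy by (intro not_good_magnetisation_if_two_minimisers[of x _ y]) auto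
    then show False using gibbs by (simp add: sequentially_Gibbs_def)
  qed
next
  assume unique: "unique_minimisers (ess_epigraph V) ((1 + t) / (2 * t))"
  have "0 \<le> v" if "(r, v) \<in> ess_epigraph V" for r v
    using V_nonneg that by (rule ess_epigraph_nonneg)
  then have "argmin_pairs (ess_epigraph V) ((1 + t) / (2 * t)) b \<noteq> {}" for b
    using t_pos by (intro argmin_pairs_nonempty closed_ess_epigraph ess_epigraph_nonempty V_measurable) auto
  then have "\<exists>r. \<forall>x \<in> argmin_pairs (ess_epigraph V) ((1 + t) / (2 * t)) b. fst x = r" for b
    using unique unfolding unique_minimisers_def by blast
  then show "sequentially_Gibbs (time_evolved V t)"
    unfolding sequentially_Gibbs_def using good_magnetisation_if_unique by metis
qed

end

theorem theorem4:
  fixes V :: "real \<Rightarrow> real"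
  assumes V_nonneg: "\<And>r. 0 \<le> V r"
    and V_lsc: "lower_semicontinuous V"
  shows "(\<forall>t>0. (\<exists>\<alpha>. has_multiple_global_minimisers (rate_function V t \<alpha>)) \<longleftrightarrow>
            (\<exists>a b c. a < b \<and> b < c \<and> second_diff_quot V a b c \<le> - ((1 + t) / (2 * t)))) \<and>
         (\<exists>t\<^sub>c::ereal. 0 \<le> t\<^sub>c \<and>
            (\<forall>t>0. (ereal t < t\<^sub>c \<longrightarrow> sequentially_Gibbs (time_evolved V t)) \<and>
                   (t\<^sub>c < ereal t \<longrightarrow> \<not> sequentially_Gibbs (time_evolved V t))))"
proof (intro conjI allI impI)
  fix t :: real assume t: "0 < t"
  then have "0 < (1 + t) / (2 * t)" by simp
  with t show "(\<exists>\<alpha>. has_multiple_global_minimisers (rate_function V t \<alpha>)) \<longleftrightarrow>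
      (\<exists>a b c. a < b \<and> b < c \<and> second_diff_quot V a b c \<le> - ((1 + t) / (2 * t)))"
    by (simp only: has_multiple_global_minimisers_rate_function_iff
        unique_minimisers_epigraph_of_iff[OF V_nonneg V_lsc])
next
  let ?unique = "\<lambda>t. unique_minimisers (ess_epigraph V) ((1 + t) / (2 * t))"
  have gibbs: "sequentially_Gibbs (time_evolved V t) \<longleftrightarrow> ?unique t" if "0 < t" for t
  proof -
    interpret mean_field_dynamics V t by unfold_locales (use V_nonneg V_lsc that in auto)
    show ?thesis by (rule sequentially_Gibbs_iff)
  qed
  have nonneg: "0 \<le> v" if "(r, v) \<in> ess_epigraph V" for r v
    using V_nonneg that by (rule ess_epigraph_nonneg)
  have mono: "?unique s" if "?unique t" "0 < s" "s \<le> t" for s t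
  proof (rule unique_minimisers_mono[OF closed_ess_epigraph nonneg])
    show "V \<in> borel_measurable borel" using V_lsc by (rule lower_semicontinuous_borel_measurable)
    show "0 < (1 + t) / (2 * t)" "(1 + t) / (2 * t) \<le> (1 + s) / (2 * s)"
      using that by (auto simp: field_simps)
  qed (use that in auto)
  \<comment> \<open>The times at which uniqueness fails. If there are none, the infimum in the
    extended reals is infinite; otherwise \<open>mono\<close> spreads failure at \<open>s\<close> to
    all later times.\<close>
  define T where "T = {t. 0 < t \<and> \<not> ?unique t}"
  define t\<^sub>c where "t\<^sub>c = Inf (ereal ` T)"
  have "sequentially_Gibbs (time_evolved V t)" if "0 < t" "ereal t < t\<^sub>c" for t
  proof -
    have "t \<notin> T" using that(2) Inf_lower[of "ereal t" "ereal ` T"] unfolding t\<^sub>c_def by (auto simp: not_le)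
    then show ?thesis using that(1) gibbs by (simp add: T_def)
  qed
  moreover have "\<not> sequentially_Gibbs (time_evolved V t)" if t: "0 < t" and less: "t\<^sub>c < ereal t" for t
  proof -
    obtain s where "s \<in> T" "s < t" using less unfolding t\<^sub>c_def Inf_less_iff by auto
    then show ?thesis using gibbs[OF t] mono[of t s] by (auto simp: T_def)
  qed
  moreover have "0 \<le> t\<^sub>c" unfolding t\<^sub>c_def by (rule Inf_greatest) (auto simp: T_def)
  ultimately show "\<exists>t\<^sub>c::ereal. 0 \<le> t\<^sub>c \<and>
      (\<forall>t>0. (ereal t < t\<^sub>c \<longrightarrow> sequentially_Gibbs (time_evolved V t)) \<and>
             (t\<^sub>c < ereal t \<longrightarrow> \<not> sequentially_Gibbs (time_evolved V t)))"
    by blast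
qed

end
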